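(* Let $\Gamma$ be a semigroup which is Markov with respect to a finite generating set $O$. Assume that $\Gamma$ acts on a probability space $(X,\nu)$ by measure-preserving transformations, $g\mapsto T_g$. For $n\ge 0$ let $S_O(n)=\{g\in\Gamma: |g|_O=n\}$ and, for $\varphi\in L^1(X,\nu)$, put $$c_N(\varphi)=\frac1N\sum_{n=0}^{N-1}\frac{1}{\#S_O(n)}\sum_{g\in S_O(n)}\varphi\circ T_g$$ (with the inner average interpreted as $0$ if $S_O(n)=\varnothing$). Then for every $p$ with $1\le p<\infty$ and every $\varphi\in L^p(X,\nu)$ the sequence $c_N(\varphi)$ converges in $L^p(X,\nu)$ as $N\to\infty$. If moreover $\varphi\in L^\infty(X,\nu)$, then $c_N(\varphi)$ converges $\nu$-almost everywhere as $N\to\infty$.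
   Context: For a semigroup $\Gamma$ with finite generating set $O$, $|g|_O$ denotes the length of the shortest word over the alphabet $O$ representing $g$. $\Gamma$ is called Markov with respect to $O$ if there exist a finite directed graph $\mathcal G$ (loops and multiple arcs allowed), a vertex $v_0$ of $\mathcal G$, and a labelling $\xi$ from the set of arcs of $\mathcal G$ to $O$ such that, extending $\xi$ to finite paths $p=e_1\dots e_n$ starting at $v_0$ by $\xi(p)=\xi(e_1)\cdots\xi(e_n)$ (the empty path being sent to the identity element), the map $\xi$ from the set of all finite paths in $\mathcal G$ starting at $v_0$ to $\Gamma$ is a bijection, and $|\xi(p)|_O=n$ for every such path $p$ of length $n$. $\#$ denotes cardinality. *)

theory Defs
  imports "HOL-Probability.Probability"
begin

definition word_length :: "'g::monoid_mult set \<Rightarrow> 'g \<Rightarrow> nat" where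
  "word_length Gen g = (LEAST n. \<exists>ws. set ws \<subseteq> Gen \<and> length ws = n \<and> prod_list ws = g)"

definition generates :: "'g::monoid_mult set \<Rightarrow> bool" where
  "generates Gen \<longleftrightarrow> (\<forall>g. \<exists>ws. set ws \<subseteq> Gen \<and> prod_list ws = g)"

definition graph_paths :: "nat set \<Rightarrow> (nat \<Rightarrow> nat) \<Rightarrow> (nat \<Rightarrow> nat) \<Rightarrow> nat \<Rightarrow> nat list set" where
  "graph_paths E src tgt v0 =
     {p. set p \<subseteq> E \<and> (p \<noteq> [] \<longrightarrow> src (hd p) = v0) \<and>
         (\<forall>i. Suc i < length p \<longrightarrow> tgt (p ! i) = src (p ! Suc i))}"

definition markov :: "'g::monoid_mult set \<Rightarrow> bool" where
  "markov Gen \<longleftrightarrow> (\<exists>(V::nat set) (E::nat set) src tgt (lab::nat \<Rightarrow> 'g) v0.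
      finite V \<and> finite E \<and> v0 \<in> V \<and> src ` E \<subseteq> V \<and> tgt ` E \<subseteq> V \<and> lab ` E \<subseteq> Gen \<and>
      bij_betw (\<lambda>p. prod_list (map lab p)) (graph_paths E src tgt v0) UNIV \<and>
      (\<forall>p\<in>graph_paths E src tgt v0. word_length Gen (prod_list (map lab p)) = length p))"

definition sphere :: "'g::monoid_mult set \<Rightarrow> nat \<Rightarrow> 'g set" where
  "sphere Gen n = {g. word_length Gen g = n}"

definition cesaro_sph :: "'g::monoid_mult set \<Rightarrow> ('g \<Rightarrow> 'x \<Rightarrow> 'x) \<Rightarrow> ('x \<Rightarrow> real) \<Rightarrow> nat \<Rightarrow> 'x \<Rightarrow> real" where
  "cesaro_sph Gen T \<phi> N x = (1 / real N) * (\<Sum>n<N.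
      (if sphere Gen n = {} then 0
       else (1 / real (card (sphere Gen n))) * (\<Sum>g\<in>sphere Gen n. \<phi> (T g x))))"

definition in_Lp :: "'x measure \<Rightarrow> real \<Rightarrow> ('x \<Rightarrow> real) \<Rightarrow> bool" where
  "in_Lp M p f \<longleftrightarrow> f \<in> borel_measurable M \<and> integrable M (\<lambda>x. \<bar>f x\<bar> powr p)"

definition in_Linf :: "'x measure \<Rightarrow> ('x \<Rightarrow> real) \<Rightarrow> bool" where
  "in_Linf M f \<longleftrightarrow> f \<in> borel_measurable M \<and> (\<exists>C. AE x in M. \<bar>f x\<bar> \<le> C)"

end

theory Submission
  imports Defs "HOL-Real_Asymp.Real_Asymp"
begin

text \<open>
  Write \<open>F n w\<close> for the sum of \<open>\<phi> \<circ> T g\<close> over the elements \<open>g\<close> represented by paths of length \<open>n\<close> from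
  \<open>v0\<close> to \<open>w\<close>, and \<open>b n w\<close> for the number of these paths. Both satisfy the linear recursion given
  by the arcs of the graph, the arc \<open>e\<close> acting on functions by composition with \<open>T (lab e)\<close>. Passing to a
  power of the graph (and to residue classes of \<open>n\<close>), every vertex on a cycle carries a loop. One then
  shows, one strongly connected component at a time, that \<open>b n w\<close> vanishes eventually or is
  asymptotic to \<open>c a^n n^k\<close>, and that for bounded \<open>\<phi>\<close> the quotients \<open>F n w / b n w\<close> are Cesaro convergent
  almost everywhere.

  Inside a component the Perron eigenvectors normalise the recursion to \<open>\<eta> (n+1) = P (\<eta> n) + \<zeta> n\<close>
  with a Markov operator \<open>P\<close> that has an invariant measure, where the input \<open>\<zeta>\<close> comes from preceding
  components. If the input grows exponentially after this normalisation, the oscillation \<open>D\<close> of the averages satisfies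
  \<open>D \<le> P D / a\<close> with \<open>a > 1\<close>, so it is zero. Otherwise the partial sums of \<open>\<eta>\<close> are
  convolutions of powers of \<open>P\<close> with sequences of polynomial growth, and they are controlled by
  Hopf's ergodic theorem. The latter is proved for bounded functions by the observation that the upper limit \<open>g\<close>
  of the averages satisfies \<open>g \<le> P g\<close>, hence \<open>g = P g\<close> by invariance of the measure.

  Convergence in \<open>L\<^sup>p\<close> follows by truncation, because the averages are contractions of \<open>L\<^sup>p\<close>.
\<close>

section \<open>Cesaro means\<close>

text \<open>The quotients \<open>F n w / b n w\<close> converge only in the Cesaro sense, and this
  survives multiplication by a sequence only if that sequence converges. Contributions of several
  predecessors can therefore be added only if their relative weights \<open>b / (b + b')\<close>
  have limits; hence exact asymptotics of the counts travel through the induction, together with a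
  bound of \<open>F\<close> by a multiple of \<open>b\<close>. The same need explains the loops:
  with a period the normalised counts could oscillate, while loops allow paths to be padded to one
  common length, which gives a Doeblin minorisation and convergence of the counts. If the input does
  not outgrow the component, its partial sums, divided by a power of \<open>n\<close>, converge
  genuinely, although the input itself need not. So the recursion is first summed over time and the
  ergodic theorem is applied to the sums; the averaged functions then vary with time, which calls
  for a Maker-type extension of Hopf's theorem. Arcs are appended at the end of a path and
  \<open>T (g * h)\<close> is \<open>T g\<close> after \<open>T h\<close>, so the last letter acts
  first on \<open>x\<close>; this yields a recursion over incoming arcs.\<close>

definition cesaro_mean :: "(nat \<Rightarrow> real) \<Rightarrow> nat \<Rightarrow> real" where
  "cesaro_mean x N = (\<Sum>n<N. x n) / real N"

lemma cesaro_mean_tendsto: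
  fixes x :: "nat \<Rightarrow> real"
  assumes "x \<longlonglongrightarrow> L"
  shows "cesaro_mean x \<longlonglongrightarrow> L"
proof (rule LIMSEQ_I)
  fix e :: real assume e: "e > 0"
  obtain M where M: "\<And>n. n \<ge> M \<Longrightarrow> \<bar>x n - L\<bar> < e/2"
    using LIMSEQ_D[OF assms, of "e/2"] e by auto
  define K where "K = (\<Sum>n<M. \<bar>x n - L\<bar>)"
  have K0: "K \<ge> 0" by (simp add: K_def sum_nonneg)
  obtain N0 :: nat where N0: "2 * K / e < real N0" using reals_Archimedean2 by blast
  have "\<bar>cesaro_mean x N - L\<bar> < e" if N: "N \<ge> max (max M N0) 1" for N
  proof -
    have N1: "real N > 0" using N by simp
    have "cesaro_mean x N - L = (\<Sum>n<N. x n - L) / real N"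
      using N1 by (simp add: cesaro_mean_def sum_subtractf field_simps)
    also have "\<bar>\<dots>\<bar> \<le> (\<Sum>n<N. \<bar>x n - L\<bar>) / real N"
      using N1 by (simp add: divide_right_mono)
    also have "(\<Sum>n<N. \<bar>x n - L\<bar>) = K + (\<Sum>n\<in>{M..<N}. \<bar>x n - L\<bar>)"
      unfolding K_def using N sum.atLeastLessThan_concat[of 0 M N "\<lambda>n. \<bar>x n - L\<bar>"]
      by (simp add: atLeast0LessThan)
    also have "(\<Sum>n\<in>{M..<N}. \<bar>x n - L\<bar>) \<le> (\<Sum>n\<in>{M..<N}. e/2)"
      by (rule sum_mono) (use M less_imp_le in auto)
    also have "\<dots> \<le> real N * (e/2)" using e by simp
    finally have a: "\<bar>cesaro_mean x N - L\<bar> \<le> (K + real N * (e/2)) / real N"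
      using N1 by (simp add: divide_right_mono)
    have "K < real N * (e/2)"
    proof -
      have "K < real N0 * (e/2)" using N0 e by (simp add: field_simps)
      also have "\<dots> \<le> real N * (e/2)" using N e by simp
      finally show ?thesis .
    qed
    then have "(K + real N * (e/2)) / real N < e" using N1 by (simp add: field_simps)
    with a show ?thesis by simp
  qed
  then show "\<exists>no. \<forall>n\<ge>no. norm (cesaro_mean x n - L) < e" by (metis real_norm_def)
qed

lemma abs_cesaro_mean_le:
  assumes "\<And>n. \<bar>x n\<bar> \<le> K" shows "\<bar>cesaro_mean x N\<bar> \<le> K"
proof (cases "N = 0")
  case True then show ?thesis using assms[of 0] by (simp add: cesaro_mean_def)
next
  case False
  have "\<bar>\<Sum>n<N. x n\<bar> \<le> real (card {..<N}) * K"
    by (rule order_trans[OF sum_abs sum_bounded_above]) (rule assms)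
  then show ?thesis using False by (simp add: cesaro_mean_def divide_le_eq mult.commute)
qed

text \<open>Write \<open>y\<close> as \<open>c\<close> plus a null sequence: a bounded
  \<open>x\<close> times a null sequence is null, so only the constant factor remains. This is the
  tool for replacing one normalising sequence by a comparable one.\<close>

lemma convergent_cesaro_mean_mult:
  fixes x y :: "nat \<Rightarrow> real"
  assumes x: "convergent (cesaro_mean x)" and b: "\<And>n. \<bar>x n\<bar> \<le> K" and y: "y \<longlonglongrightarrow> c"
  shows "convergent (cesaro_mean (\<lambda>n. x n * y n))"
proof -
  have "(\<lambda>n. y n - c) \<longlonglongrightarrow> 0" using y by (simp add: LIM_zero)
  then have "(\<lambda>n. x n * (y n - c)) \<longlonglongrightarrow> 0"
    by (rule lim_null_mult_left_bounded[where B=K, rotated]) (use b in \<open>auto simp: always_eventually\<close>)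
  then have "convergent (cesaro_mean (\<lambda>n. x n * (y n - c)))"
    using cesaro_mean_tendsto convergentI by blast
  then have "convergent (\<lambda>N. cesaro_mean x N * c + cesaro_mean (\<lambda>n. x n * (y n - c)) N)"
    by (intro convergent_add convergent_mult x convergent_const)
  also have "(\<lambda>N. cesaro_mean x N * c + cesaro_mean (\<lambda>n. x n * (y n - c)) N) = cesaro_mean (\<lambda>n. x n * y n)"
    by (auto simp: cesaro_mean_def fun_eq_iff algebra_simps sum_subtractf sum_distrib_left diff_divide_distrib)
  finally show ?thesis .
qed

lemma convergent_cesaro_mean_add:
  "convergent (cesaro_mean x) \<Longrightarrow> convergent (cesaro_mean y) \<Longrightarrow> convergent (cesaro_mean (\<lambda>n. x n + y n))"
proof -
  assume "convergent (cesaro_mean x)" "convergent (cesaro_mean y)"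
  then have "convergent (\<lambda>N. cesaro_mean x N + cesaro_mean y N)" by (rule convergent_add)
  also have "(\<lambda>N. cesaro_mean x N + cesaro_mean y N) = cesaro_mean (\<lambda>n. x n + y n)"
    by (auto simp: cesaro_mean_def sum.distrib add_divide_distrib)
  finally show ?thesis .
qed

text \<open>A single term is invisible to Cesaro means. The shift later bypasses index 0, where
  scales such as \<open>a ^ n * real n ^ k\<close> may vanish and division by zero yields 0.\<close>

lemma convergent_cesaro_mean_Suc_iff:
  "convergent (cesaro_mean (\<lambda>n. x (Suc n))) \<longleftrightarrow> convergent (cesaro_mean x)"
proof -
  have e: "\<forall>\<^sub>F N in sequentially. cesaro_mean (\<lambda>n. x (Suc n)) N
      = cesaro_mean x (Suc N) * (real (Suc N) / real N) - x 0 / real N"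
    using eventually_gt_at_top[of 0]
  proof eventually_elim
    case (elim N)
    have "(\<Sum>n<Suc N. x n) = x 0 + (\<Sum>n<N. x (Suc n))" by (rule sum.lessThan_Suc_shift)
    then have "(\<Sum>n<N. x (Suc n)) = (\<Sum>n<Suc N. x n) - x 0" by simp
    then show ?case unfolding cesaro_mean_def
      by (simp add: diff_divide_distrib del: sum.lessThan_Suc of_nat_Suc)
  qed
  have l1: "(\<lambda>N. real (Suc N) / real N) \<longlonglongrightarrow> 1" by real_asymp
  have l2: "(\<lambda>N. x 0 / real N) \<longlonglongrightarrow> 0" by real_asymp
  have l3: "(\<lambda>N. real N / real (Suc N)) \<longlonglongrightarrow> 1" by real_asymp
  have l4: "(\<lambda>N. x 0 / real (Suc N)) \<longlonglongrightarrow> 0" by real_asymp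
  show ?thesis
  proof
    assume "convergent (cesaro_mean x)"
    then obtain L where "cesaro_mean x \<longlonglongrightarrow> L" by (auto simp: convergent_def)
    then have "(\<lambda>N. cesaro_mean x (Suc N)) \<longlonglongrightarrow> L" by (rule LIMSEQ_Suc)
    then have "(\<lambda>N. cesaro_mean x (Suc N) * (real (Suc N) / real N) - x 0 / real N) \<longlonglongrightarrow> L * 1 - 0"
      by (intro tendsto_intros l1 l2)
    then have "cesaro_mean (\<lambda>n. x (Suc n)) \<longlonglongrightarrow> L * 1 - 0"
      by (simp only: tendsto_cong[OF e])
    then show "convergent (cesaro_mean (\<lambda>n. x (Suc n)))" by (rule convergentI)
  next
    assume "convergent (cesaro_mean (\<lambda>n. x (Suc n)))"
    then obtain L where "cesaro_mean (\<lambda>n. x (Suc n)) \<longlonglongrightarrow> L" by (auto simp: convergent_def)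
    then have "(\<lambda>N. cesaro_mean (\<lambda>n. x (Suc n)) N * (real N / real (Suc N)) + x 0 / real (Suc N)) \<longlonglongrightarrow> L * 1 + 0"
      by (intro tendsto_intros l3 l4)
    moreover have "\<forall>\<^sub>F N in sequentially. cesaro_mean (\<lambda>n. x (Suc n)) N * (real N / real (Suc N)) + x 0 / real (Suc N)
       = cesaro_mean x (Suc N)"
      using eventually_gt_at_top[of 0]
    proof eventually_elim
      case (elim N)
      have "(\<Sum>n<Suc N. x n) = x 0 + (\<Sum>n<N. x (Suc n))" by (rule sum.lessThan_Suc_shift)
      then show ?case using elim unfolding cesaro_mean_def
        by (simp add: add_divide_distrib del: sum.lessThan_Suc of_nat_Suc)
    qed
    ultimately have "(\<lambda>N. cesaro_mean x (Suc N)) \<longlonglongrightarrow> L * 1 + 0"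
      by (rule Lim_transform_eventually)
    then show "convergent (cesaro_mean x)" using LIMSEQ_imp_Suc convergentI by blast
  qed
qed

section \<open>Sums with power weights and summation by parts\<close>

lemma sum_power_weight_null:
  fixes e :: "nat \<Rightarrow> real"
  assumes "e \<longlonglongrightarrow> 0"
  shows "(\<lambda>N. (\<Sum>n<N. real n ^ j * e n) / real N ^ Suc j) \<longlonglongrightarrow> 0"
proof (rule Lim_null_comparison)
  have "(\<lambda>n. \<bar>e n\<bar>) \<longlonglongrightarrow> 0" using assms by (simp add: tendsto_rabs_zero)
  then show "cesaro_mean (\<lambda>n. \<bar>e n\<bar>) \<longlonglongrightarrow> 0" by (rule cesaro_mean_tendsto)
  \<comment> \<open>Bounding every weight \<open>n ^ j\<close> by \<open>N ^ j\<close> leaves the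
    Cesaro mean of \<open>\<bar>e n\<bar>\<close>.\<close>
  have "norm ((\<Sum>n<N. real n ^ j * e n) / real N ^ Suc j) \<le> cesaro_mean (\<lambda>n. \<bar>e n\<bar>) N" for N
  proof (cases "N = 0")
    case False
    have "\<bar>\<Sum>n<N. real n ^ j * e n\<bar> \<le> (\<Sum>n<N. \<bar>real n ^ j * e n\<bar>)" by (rule sum_abs)
    also have "\<dots> \<le> (\<Sum>n<N. real N ^ j * \<bar>e n\<bar>)"
      by (intro sum_mono) (auto simp: abs_mult intro!: mult_right_mono power_mono)
    also have "\<dots> = real N ^ j * (\<Sum>n<N. \<bar>e n\<bar>)" by (simp add: sum_distrib_left)
    finally show ?thesis using False
      by (simp add: cesaro_mean_def divide_simps mult_ac)
  qed (simp add: cesaro_mean_def)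
  then show "\<forall>\<^sub>F N in sequentially. norm ((\<Sum>n<N. real n ^ j * e n) / real N ^ Suc j) \<le> cesaro_mean (\<lambda>n. \<bar>e n\<bar>) N"
    by simp
qed

text \<open>Telescoping: the increments of \<open>n ^ Suc j\<close> are
  \<open>n ^ j * (Suc j + e n)\<close>, and \<open>e\<close> is null because \<open>Suc j\<close> is
  the derivative of \<open>x ^ Suc j\<close> at 1.\<close>

lemma sum_powers_asymp:
  "(\<lambda>N. (\<Sum>n<N. real n ^ j) / real N ^ Suc j) \<longlonglongrightarrow> 1 / real (Suc j)"
proof -
  define e where "e n = (if n = 0 then 0 else (real (Suc n) ^ Suc j - real n ^ Suc j) / real n ^ j - real (Suc j))" for n
  have "(\<lambda>n. (real (Suc n) ^ Suc j - real n ^ Suc j) / real n ^ j) \<longlonglongrightarrow> real (Suc j)"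
  proof -
    have d: "((\<lambda>h::real. ((1 + h) ^ Suc j - 1) / h) \<longlongrightarrow> real (Suc j)) (at 0)"
    proof -
      have "((\<lambda>x::real. x ^ Suc j) has_real_derivative real (Suc j)) (at 1)"
        by (auto intro!: derivative_eq_intros)
      then show ?thesis by (simp add: DERIV_def)
    qed
    have f: "filterlim (\<lambda>n. 1 / real n) (at 0) sequentially" by real_asymp
    have "(\<lambda>n. ((1 + 1 / real n) ^ Suc j - 1) / (1 / real n)) \<longlonglongrightarrow> real (Suc j)"
      using filterlim_compose[OF d f] .
    moreover have "\<forall>\<^sub>F n in sequentially. ((1 + 1 / real n) ^ Suc j - 1) / (1 / real n)
        = (real (Suc n) ^ Suc j - real n ^ Suc j) / real n ^ j"
      using eventually_gt_at_top[of 0]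
    proof eventually_elim
      case (elim n)
      have "1 + 1 / real n = real (Suc n) / real n" using elim by (simp add: field_simps)
      then have "((1 + 1 / real n) ^ Suc j - 1) / (1 / real n) = (real (Suc n) ^ Suc j / real n ^ Suc j - 1) * real n"
        by (simp only: power_divide) simp
      also have "\<dots> = (real (Suc n) ^ Suc j - real n ^ Suc j) / real n ^ j"
        using elim by (simp add: field_simps)
      finally show ?case .
    qed
    ultimately show ?thesis by (rule Lim_transform_eventually)
  qed
  then have "(\<lambda>n. (real (Suc n) ^ Suc j - real n ^ Suc j) / real n ^ j - real (Suc j)) \<longlonglongrightarrow> 0"
    by (simp add: LIM_zero)
  moreover have "\<forall>\<^sub>F n in sequentially. (real (Suc n) ^ Suc j - real n ^ Suc j) / real n ^ j - real (Suc j) = e n"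
    using eventually_gt_at_top[of 0] by eventually_elim (simp add: e_def)
  ultimately have "e \<longlonglongrightarrow> 0" by (rule Lim_transform_eventually)
  then have *: "(\<lambda>N. (\<Sum>n<N. real n ^ j * e n) / real N ^ Suc j) \<longlonglongrightarrow> 0" by (rule sum_power_weight_null)
  \<comment> \<open>Correction for the term \<open>n = 0\<close>, where \<open>e\<close> is set to 0
    instead of being given by the quotient.\<close>
  define d where "d = (\<Sum>n<1. real (Suc n) ^ Suc j - real n ^ Suc j - real (Suc j) * real n ^ j - real n ^ j * e n)"
  have tel: "real N ^ Suc j = real (Suc j) * (\<Sum>n<N. real n ^ j) + (\<Sum>n<N. real n ^ j * e n) + d" if "N > 0" for N
    using that
  proof (induction N)
    case (Suc N)
    show ?case
    proof (cases "N = 0")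
      case True then show ?thesis by (simp add: d_def e_def)
    next
      case False
      have "real N ^ j * e N = real (Suc N) ^ Suc j - real N ^ Suc j - real (Suc j) * real N ^ j"
        using False by (simp add: e_def field_simps)
      then show ?thesis using Suc False by (simp add: algebra_simps)
    qed
  qed simp
  have dl: "(\<lambda>N. d / real N ^ Suc j) \<longlonglongrightarrow> 0"
  proof -
    have "(\<lambda>N. d * (1 / real N) ^ Suc j) \<longlonglongrightarrow> d * 0 ^ Suc j"
      by (intro tendsto_intros lim_1_over_n)
    then show ?thesis by (simp add: power_divide)
  qed
  have "(\<lambda>N. (1 - (\<Sum>n<N. real n ^ j * e n) / real N ^ Suc j - d / real N ^ Suc j) / real (Suc j)) \<longlonglongrightarrow> (1 - 0 - 0) / real (Suc j)"
    by (intro tendsto_intros * dl) simp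
  moreover have "\<forall>\<^sub>F N in sequentially. (1 - (\<Sum>n<N. real n ^ j * e n) / real N ^ Suc j - d / real N ^ Suc j) / real (Suc j)
      = (\<Sum>n<N. real n ^ j) / real N ^ Suc j"
    using eventually_gt_at_top[of 0]
  proof eventually_elim
    case (elim N)
    have p: "real N ^ Suc j > 0" using elim by simp
    have s: "(\<Sum>n<N. real n ^ j) = (real N ^ Suc j - (\<Sum>n<N. real n ^ j * e n) - d) / real (Suc j)"
      using tel[OF elim] by (simp add: field_simps)
    show ?case unfolding s using p by (simp add: diff_divide_distrib mult.commute del: power_Suc of_nat_Suc)
  qed
  ultimately show ?thesis by (auto dest: Lim_transform_eventually)
qed

text \<open>Subtracting \<open>L * n ^ j\<close> leaves \<open>n ^ j\<close> times a null sequence;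
  the main term is the sum of powers.\<close>

lemma sum_asymp_power:
  fixes u :: "nat \<Rightarrow> real"
  assumes "(\<lambda>n. u n / real n ^ j) \<longlonglongrightarrow> L"
  shows "(\<lambda>N. (\<Sum>n<N. u n) / real N ^ Suc j) \<longlonglongrightarrow> L / real (Suc j)"
proof -
  have 1: "(\<lambda>N. (\<Sum>n<N. real n ^ j * (u n / real n ^ j - L)) / real N ^ Suc j) \<longlonglongrightarrow> 0"
    by (rule sum_power_weight_null) (use assms LIM_zero in blast)
  \<comment> \<open>For \<open>j > 0\<close> the quotient at \<open>n = 0\<close> is 0, so
    multiplying it back loses \<open>u 0\<close>; \<open>d\<close> restores it.\<close>
  define d where "d = u 0 - 0 ^ j * (u 0 / 0 ^ j)"
  have s: "(\<Sum>n<N. u n) = (\<Sum>n<N. real n ^ j * (u n / real n ^ j - L)) + L * (\<Sum>n<N. real n ^ j) + d" if "N > 0" for N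
    using that
  proof (induction N)
    case (Suc N)
    show ?case
    proof (cases "N = 0")
      case True then show ?thesis by (simp add: d_def algebra_simps)
    next
      case False
      then show ?thesis using Suc by (simp add: algebra_simps)
    qed
  qed simp
  have dl: "(\<lambda>N. d / real N ^ Suc j) \<longlonglongrightarrow> 0"
  proof -
    have "(\<lambda>N. d * (1 / real N) ^ Suc j) \<longlonglongrightarrow> d * 0 ^ Suc j"
      by (intro tendsto_intros lim_1_over_n)
    then show ?thesis by (simp add: power_divide)
  qed
  have "(\<lambda>N. (\<Sum>n<N. real n ^ j * (u n / real n ^ j - L)) / real N ^ Suc j
       + L * ((\<Sum>n<N. real n ^ j) / real N ^ Suc j) + d / real N ^ Suc j) \<longlonglongrightarrow> 0 + L * (1 / real (Suc j)) + 0"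
    by (intro tendsto_intros 1 dl sum_powers_asymp)
  moreover have "\<forall>\<^sub>F N in sequentially. (\<Sum>n<N. real n ^ j * (u n / real n ^ j - L)) / real N ^ Suc j
       + L * ((\<Sum>n<N. real n ^ j) / real N ^ Suc j) + d / real N ^ Suc j = (\<Sum>n<N. u n) / real N ^ Suc j"
    using eventually_gt_at_top[of 0] by eventually_elim (simp add: s add_divide_distrib)
  ultimately show ?thesis by (auto dest: Lim_transform_eventually)
qed

text \<open>Abel summation raises the weight by one power per induction step: the new sum is
  \<open>N * Y N\<close> minus the sum of the \<open>Y (Suc n)\<close>, and the known asymptotics of
  \<open>Y\<close> can be summed.\<close>

lemma convergent_power_weighted_sum:
  fixes x :: "nat \<Rightarrow> real"
  assumes "convergent (cesaro_mean x)"
  shows "convergent (\<lambda>N. (\<Sum>n<N. real n ^ k * x n) / real N ^ Suc k)"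
proof (induction k)
  case 0
  then show ?case using assms by (simp add: cesaro_mean_def[abs_def])
next
  case (Suc k)
  define Y where "Y N = (\<Sum>n<N. real n ^ k * x n)" for N
  obtain L where L: "(\<lambda>N. Y N / real N ^ Suc k) \<longlonglongrightarrow> L" using Suc by (auto simp: convergent_def Y_def)
  have "(\<lambda>n. Y (Suc n) / real (Suc n) ^ Suc k * (real (Suc n) / real n) ^ Suc k) \<longlonglongrightarrow> L * 1 ^ Suc k"
    by (intro tendsto_intros LIMSEQ_Suc[OF L]) real_asymp
  then have "(\<lambda>n. Y (Suc n) / real n ^ Suc k) \<longlonglongrightarrow> L"
    by (simp add: power_divide del: power_Suc of_nat_Suc)
  then have "(\<lambda>N. (\<Sum>n<N. Y (Suc n)) / real N ^ Suc (Suc k)) \<longlonglongrightarrow> L / real (Suc (Suc k))"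
    by (rule sum_asymp_power)
  then have "(\<lambda>N. Y N / real N ^ Suc k - (\<Sum>n<N. Y (Suc n)) / real N ^ Suc (Suc k)) \<longlonglongrightarrow> L - L / real (Suc (Suc k))"
    by (intro tendsto_diff L)
  moreover have abel: "(\<Sum>n<N. real n ^ Suc k * x n) = real N * Y N - (\<Sum>n<N. Y (Suc n))" for N
    by (induction N) (simp_all add: Y_def algebra_simps)
  have "\<forall>\<^sub>F N in sequentially. Y N / real N ^ Suc k - (\<Sum>n<N. Y (Suc n)) / real N ^ Suc (Suc k)
     = (\<Sum>n<N. real n ^ Suc k * x n) / real N ^ Suc (Suc k)"
    using eventually_gt_at_top[of 0]
    by eventually_elim (unfold abel, simp add: diff_divide_distrib)
  ultimately have "(\<lambda>N. (\<Sum>n<N. real n ^ Suc k * x n) / real N ^ Suc (Suc k)) \<longlonglongrightarrow> L - L / real (Suc (Suc k))"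
    by (rule Lim_transform_eventually)
  then show ?case by (rule convergentI)
qed

text \<open>Each induction step divides by one factor \<open>n\<close>, again by Abel summation, now
  with kernel \<open>1 / (n * (n + 1))\<close>. This turns control of rescaled partial sums into
  Cesaro convergence of quotients.\<close>

lemma convergent_cesaro_mean_power_divide:
  fixes y :: "nat \<Rightarrow> real"
  assumes "convergent (\<lambda>N. (\<Sum>n<N. y n) / real N ^ Suc k)"
  shows "convergent (cesaro_mean (\<lambda>n. y n / real n ^ k))"
  using assms
proof (induction k arbitrary: y)
  case 0
  then show ?case by (simp add: cesaro_mean_def[abs_def])
next
  case (Suc k)
  define Y where "Y N = (\<Sum>n<N. y n)" for N
  obtain L where L: "(\<lambda>N. Y N / real N ^ Suc (Suc k)) \<longlonglongrightarrow> L" using Suc.prems by (auto simp: convergent_def Y_def)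
  \<comment> \<open>\<open>Y N\<close> contains \<open>y 0\<close>, whereas the summand
    \<open>y 0 / real 0\<close> is 0.\<close>
  define c where "c = - y 0"
  have s: "(\<Sum>n<N. y n / real n) = Y N / real N + (\<Sum>n<N. Y (Suc n) / (real n * real (Suc n))) + c" if "N > 0" for N
    using that
  proof (induction N)
    case (Suc N)
    show ?case
    proof (cases "N = 0")
      case True then show ?thesis by (simp add: c_def Y_def)
    next
      case False
      have "y N / real N = (Y (Suc N) - Y N) / real N" by (simp add: Y_def)
      moreover have "Y (Suc N) / (real N * real (Suc N)) = Y (Suc N) / real N - Y (Suc N) / real (Suc N)"
        using False by (simp add: field_simps)
      ultimately show ?thesis using Suc False by (simp add: diff_divide_distrib)
    qed
  qed simp
  have "(\<lambda>n. Y (Suc n) / real (Suc n) ^ Suc (Suc k) * (real (Suc n) / real n) ^ Suc k) \<longlonglongrightarrow> L * 1 ^ Suc k"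
    by (intro tendsto_intros LIMSEQ_Suc[OF L]) real_asymp
  moreover have "Y (Suc n) / real (Suc n) ^ Suc (Suc k) * (real (Suc n) / real n) ^ Suc k
     = Y (Suc n) / (real n * real (Suc n)) / real n ^ k" for n
    by (simp add: power_divide field_simps del: of_nat_Suc)
  ultimately have "(\<lambda>n. Y (Suc n) / (real n * real (Suc n)) / real n ^ k) \<longlonglongrightarrow> L" by simp
  then have 1: "(\<lambda>N. (\<Sum>n<N. Y (Suc n) / (real n * real (Suc n))) / real N ^ Suc k) \<longlonglongrightarrow> L / real (Suc k)"
    by (rule sum_asymp_power)
  have cl: "(\<lambda>N. c / real N ^ Suc k) \<longlonglongrightarrow> 0"
  proof -
    have "(\<lambda>N. c * (1 / real N) ^ Suc k) \<longlonglongrightarrow> c * 0 ^ Suc k"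
      by (intro tendsto_intros lim_1_over_n)
    then show ?thesis by (simp add: power_divide)
  qed
  have "(\<lambda>N. Y N / real N ^ Suc (Suc k) + (\<Sum>n<N. Y (Suc n) / (real n * real (Suc n))) / real N ^ Suc k
        + c / real N ^ Suc k) \<longlonglongrightarrow> L + L / real (Suc k) + 0"
    by (intro tendsto_intros L 1 cl)
  moreover have "\<forall>\<^sub>F N in sequentially. Y N / real N ^ Suc (Suc k) + (\<Sum>n<N. Y (Suc n) / (real n * real (Suc n))) / real N ^ Suc k
        + c / real N ^ Suc k = (\<Sum>n<N. y n / real n) / real N ^ Suc k"
    using eventually_gt_at_top[of 0] by eventually_elim (simp add: s add_divide_distrib)
  ultimately have "(\<lambda>N. (\<Sum>n<N. y n / real n) / real N ^ Suc k) \<longlonglongrightarrow> L + L / real (Suc k) + 0"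
    by (rule Lim_transform_eventually)
  then have "convergent (cesaro_mean (\<lambda>n. y n / real n / real n ^ k))"
    by (intro Suc.IH convergentI)
  then show ?case by simp
qed

text \<open>Complete blocks of \<open>d\<close> terms average the residue classes; boundedness of
  \<open>x\<close> makes the incomplete last block of fewer than \<open>d\<close> terms
  negligible.\<close>

lemma convergent_cesaro_mean_residues:
  fixes x :: "nat \<Rightarrow> real"
  assumes d: "d > 0" and b: "\<And>n. \<bar>x n\<bar> \<le> K"
    and c: "\<And>r. r < d \<Longrightarrow> convergent (cesaro_mean (\<lambda>m. x (d * m + r)))"
  shows "convergent (cesaro_mean x)"
proof -
  obtain L where L: "\<And>r. r < d \<Longrightarrow> cesaro_mean (\<lambda>m. x (d * m + r)) \<longlonglongrightarrow> L r"
    using c unfolding convergent_def by metis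
  define A where "A m = (\<Sum>r<d. cesaro_mean (\<lambda>m. x (d * m + r)) m) / real d" for m
  have A: "A \<longlonglongrightarrow> (\<Sum>r<d. L r) / real d"
    unfolding A_def using d by (intro tendsto_intros L) auto
  have S: "(\<Sum>n<d*m. x n) = real (d * m) * A m" for m
  proof -
    have "(\<Sum>n<d*m. x n) = (\<Sum>i<m. \<Sum>r<d. x (d * i + r))"
    proof (induction m)
      case (Suc m)
      have "(\<Sum>n<d*Suc m. x n) = (\<Sum>n<d*m. x n) + (\<Sum>n\<in>{d*m..<d*m+d}. x n)"
        using sum.atLeastLessThan_concat[of 0 "d*m" "d*m+d" x] by (simp add: atLeast0LessThan add.commute)
      also have "(\<Sum>n\<in>{d*m..<d*m+d}. x n) = (\<Sum>r<d. x (d * m + r))"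
        using sum.shift_bounds_nat_ivl[of x 0 "d*m" d] by (simp add: atLeast0LessThan add.commute)
      finally show ?case using Suc by simp
    qed simp
    also have "\<dots> = (\<Sum>r<d. \<Sum>i<m. x (d * i + r))" by (rule sum.swap)
    also have "\<dots> = real (d * m) * A m"
      using d by (cases "m = 0") (auto simp: A_def cesaro_mean_def sum_divide_distrib[symmetric] simp flip: sum_divide_distrib)
    finally show ?thesis .
  qed
  have fd: "filterlim (\<lambda>N. N div d) at_top sequentially"
    using d by (intro filterlim_at_top_div_const_nat)
  have A': "(\<lambda>N. A (N div d)) \<longlonglongrightarrow> (\<Sum>r<d. L r) / real d"
    using filterlim_compose[OF A fd] .
  have r1: "(\<lambda>N. real (d * (N div d)) / real N) \<longlonglongrightarrow> 1"
  proof (rule tendsto_sandwich)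
    show "(\<lambda>N. (real N - real d) / real N) \<longlonglongrightarrow> 1" by real_asymp
    show "(\<lambda>N. 1::real) \<longlonglongrightarrow> 1" by simp
    show "\<forall>\<^sub>F N in sequentially. (real N - real d) / real N \<le> real (d * (N div d)) / real N"
    proof (rule always_eventually, rule allI)
      fix N
      have "N \<le> d * (N div d) + d" using d mod_less_divisor[of d N] mult_div_mod_eq[of d N] by linarith
      then have "real N \<le> real (d * (N div d)) + real d" by (metis of_nat_add of_nat_mono)
      then show "(real N - real d) / real N \<le> real (d * (N div d)) / real N"
        by (intro divide_right_mono) auto
    qed
    show "\<forall>\<^sub>F N in sequentially. real (d * (N div d)) / real N \<le> 1"
    proof (rule always_eventually, rule allI)
      fix N
      have "real (d * (N div d)) \<le> real N" by (simp only: of_nat_le_iff) simp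
      then show "real (d * (N div d)) / real N \<le> 1" by (cases "N = 0") (auto simp: divide_le_eq_1)
    qed
  qed
  have K0: "K \<ge> 0" using b[of 0] by linarith
  have r2: "(\<lambda>N. (\<Sum>n\<in>{d * (N div d)..<N}. x n) / real N) \<longlonglongrightarrow> 0"
  proof (rule Lim_null_comparison)
    show "(\<lambda>N. real d * K / real N) \<longlonglongrightarrow> 0" by real_asymp
    show "\<forall>\<^sub>F N in sequentially. norm ((\<Sum>n\<in>{d * (N div d)..<N}. x n) / real N) \<le> real d * K / real N"
    proof (rule always_eventually, rule allI)
      fix N
      have c: "real (card {d * (N div d)..<N}) \<le> real d"
        using d by (simp only: card_atLeastLessThan of_nat_le_iff minus_mult_div_eq_mod) (simp add: less_imp_le)
      have "\<bar>\<Sum>n\<in>{d * (N div d)..<N}. x n\<bar> \<le> real (card {d * (N div d)..<N}) * K"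
        by (rule order_trans[OF sum_abs sum_bounded_above]) (rule b)
      also have "\<dots> \<le> real d * K" using c K0 by (intro mult_right_mono)
      finally show "norm ((\<Sum>n\<in>{d * (N div d)..<N}. x n) / real N) \<le> real d * K / real N"
        by (simp add: divide_right_mono)
    qed
  qed
  have "(\<lambda>N. real (d * (N div d)) / real N * A (N div d) + (\<Sum>n\<in>{d * (N div d)..<N}. x n) / real N)
     \<longlonglongrightarrow> 1 * ((\<Sum>r<d. L r) / real d) + 0"
    by (intro tendsto_intros A' r1 r2)
  moreover have "real (d * (N div d)) / real N * A (N div d) + (\<Sum>n\<in>{d * (N div d)..<N}. x n) / real N = cesaro_mean x N" for N
  proof -
    have "(\<Sum>n<N. x n) = (\<Sum>n<d*(N div d). x n) + (\<Sum>n\<in>{d * (N div d)..<N}. x n)"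
      using sum.atLeastLessThan_concat[of 0 "d*(N div d)" N x] by (simp add: atLeast0LessThan)
    then show ?thesis unfolding cesaro_mean_def S by (simp add: add_divide_distrib)
  qed
  ultimately show ?thesis by (auto intro: convergentI)
qed

section \<open>Exponential-polynomial growth\<close>

text \<open>Two members that are not eventually zero are always comparable, through the
  lexicographic order of their pairs \<open>(a, k)\<close>. The first alternative covers vertices
  that no long path reaches.\<close>

definition exp_poly_growth :: "(nat \<Rightarrow> real) \<Rightarrow> bool" where
  "exp_poly_growth b \<longleftrightarrow> (\<forall>\<^sub>F n in sequentially. b n = 0) \<or>
     (\<exists>a>0. \<exists>k. \<exists>c>0. (\<lambda>n. b n / (a ^ n * real n ^ k)) \<longlonglongrightarrow> c)"

lemma exp_poly_growthE:
  assumes "exp_poly_growth b" "\<not> (\<forall>\<^sub>F n in sequentially. b n = 0)"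
  obtains a k c where "a > 0" "c > 0" "(\<lambda>n. b n / (a ^ n * real n ^ k)) \<longlonglongrightarrow> c"
proof -
  have "\<exists>a>0. \<exists>k. \<exists>c>0. (\<lambda>n. b n / (a ^ n * real n ^ k)) \<longlonglongrightarrow> c"
    using assms unfolding exp_poly_growth_def by argo
  then show ?thesis by (elim exE conjE) (rule that)
qed

lemma power_times_geometric_null:
  fixes x :: real
  assumes "0 \<le> x" "x < 1"
  shows "(\<lambda>n. real n ^ k * x ^ n) \<longlonglongrightarrow> 0"
proof (cases "x = 0")
  case True
  have "\<forall>\<^sub>F n in sequentially. real n ^ k * x ^ n = 0"
    using eventually_gt_at_top[of 0] by eventually_elim (simp add: True)
  then show ?thesis by (simp add: tendsto_eventually)
next
  case False
  then have "x > 0" using assms by simp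
  with assms(2) show ?thesis by real_asymp
qed

lemma exp_poly_compare:
  fixes a a' :: real
  assumes "0 < a" "a < a' \<or> a = a' \<and> k < k'"
  shows "(\<lambda>n. (a ^ n * real n ^ k) / (a' ^ n * real n ^ k')) \<longlonglongrightarrow> 0"
  using assms(2)
proof
  assume l: "a < a'"
  have 1: "(\<lambda>n. real n ^ k * (a / a') ^ n) \<longlonglongrightarrow> 0"
    by (rule power_times_geometric_null) (use assms(1) l in auto)
  show ?thesis
  proof (rule Lim_null_comparison[OF _ 1])
    show "\<forall>\<^sub>F n in sequentially. norm ((a ^ n * real n ^ k) / (a' ^ n * real n ^ k')) \<le> real n ^ k * (a / a') ^ n"
      using eventually_gt_at_top[of 0]
    proof eventually_elim
      case (elim n)
      have p: "a ^ n * real n ^ k / a' ^ n \<ge> 0" using assms(1) l by simp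
      have "norm ((a ^ n * real n ^ k) / (a' ^ n * real n ^ k')) = (a ^ n * real n ^ k / a' ^ n) / real n ^ k'"
        using assms(1) l by simp
      also have "\<dots> \<le> (a ^ n * real n ^ k / a' ^ n) / 1"
        using elim p by (intro divide_left_mono) auto
      finally show ?case by (simp add: power_divide mult_ac)
    qed
  qed
next
  assume l: "a = a' \<and> k < k'"
  have 1: "(\<lambda>n. 1 / real n) \<longlonglongrightarrow> 0" by (rule lim_1_over_n)
  show ?thesis
  proof (rule Lim_null_comparison[OF _ 1])
    show "\<forall>\<^sub>F n in sequentially. norm ((a ^ n * real n ^ k) / (a' ^ n * real n ^ k')) \<le> 1 / real n"
      using eventually_gt_at_top[of 0]
    proof eventually_elim
      case (elim n)
      obtain m where k: "k' = Suc m + k" using l less_iff_Suc_add[of k k'] by (auto simp: add.commute)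
      have "norm ((a ^ n * real n ^ k) / (a' ^ n * real n ^ k')) = 1 / real n ^ Suc m"
        using assms(1) l elim by (simp add: power_add k)
      also have "\<dots> \<le> 1 / real n ^ 1"
        using elim by (intro divide_left_mono power_increasing) auto
      finally show ?case by simp
    qed
  qed
qed

text \<open>Domination by \<open>K * b'\<close> excludes the case in which \<open>b\<close> has the
  larger pair \<open>(a, k)\<close>, since it would force \<open>c \<le> 0\<close>. In the other
  cases the quotient of the two scales has a limit.\<close>

lemma exp_poly_growth_ratio:
  assumes g: "exp_poly_growth b" "exp_poly_growth b'"
    and nn: "\<And>n. 0 \<le> b n" "\<And>n. 0 \<le> b' n" and le: "\<And>n. b n \<le> K * b' n"
  shows "convergent (\<lambda>n. b n / b' n)"
proof (cases "(\<forall>\<^sub>F n in sequentially. b n = 0) \<or> (\<forall>\<^sub>F n in sequentially. b' n = 0)")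
  case True
  then have "\<forall>\<^sub>F n in sequentially. b n / b' n = 0"
    by (elim disjE; elim eventually_mono) simp_all
  then show ?thesis by (rule convergentI[OF tendsto_eventually])
next
  case False
  obtain a k c where 1: "a > 0" "c > 0" "(\<lambda>n. b n / (a ^ n * real n ^ k)) \<longlonglongrightarrow> c"
    by (rule exp_poly_growthE[OF g(1)]) (use False in simp)
  obtain a' k' c' where 2: "a' > 0" "c' > 0" "(\<lambda>n. b' n / (a' ^ n * real n ^ k')) \<longlonglongrightarrow> c'"
    by (rule exp_poly_growthE[OF g(2)]) (use False in simp)
  let ?s = "\<lambda>n. a ^ n * real n ^ k" and ?s' = "\<lambda>n. a' ^ n * real n ^ k'"
  have conv: "convergent (\<lambda>n. b n / b' n)" if "(\<lambda>n. ?s n / ?s' n) \<longlonglongrightarrow> r" for r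
  proof -
    have "(\<lambda>n. (b n / ?s n) * (?s n / ?s' n) / (b' n / ?s' n)) \<longlonglongrightarrow> c * r / c'"
      using that 1 2 by (intro tendsto_intros) auto
    moreover have "\<forall>\<^sub>F n in sequentially. (b n / ?s n) * (?s n / ?s' n) / (b' n / ?s' n) = b n / b' n"
      using eventually_gt_at_top[of 0] by eventually_elim (use 1 2 in auto)
    ultimately have "(\<lambda>n. b n / b' n) \<longlonglongrightarrow> c * r / c'" by (rule Lim_transform_eventually)
    then show ?thesis by (rule convergentI)
  qed
  consider "a = a' \<and> k = k'" | "a < a' \<or> a = a' \<and> k < k'" | "a' < a \<or> a' = a \<and> k' < k" by linarith
  then show ?thesis
  proof cases
    case 1
    have "\<forall>\<^sub>F n in sequentially. ?s n / ?s' n = 1"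
      using eventually_gt_at_top[of 0] by eventually_elim (use 1 2 in auto)
    then show ?thesis by (rule conv[OF tendsto_eventually])
  next
    case l: 2 then show ?thesis by (rule conv[OF exp_poly_compare[OF 1(1)]])
  next
    case 3
    have r: "(\<lambda>n. ?s' n / ?s n) \<longlonglongrightarrow> 0" by (rule exp_poly_compare[OF 2(1) 3])
    have "(\<lambda>n. K * ((b' n / ?s' n) * (?s' n / ?s n))) \<longlonglongrightarrow> K * (c' * 0)"
      by (intro tendsto_intros r 2)
    moreover have "\<forall>\<^sub>F n in sequentially. b n / ?s n \<le> K * ((b' n / ?s' n) * (?s' n / ?s n))"
      using eventually_gt_at_top[of 0]
    proof eventually_elim
      case (elim n)
      have "b n / ?s n \<le> K * b' n / ?s n" using le 1 by (intro divide_right_mono) auto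
      then show ?case using elim 1 2 by simp
    qed
    ultimately have "c \<le> K * (c' * 0)"
      using tendsto_le[OF sequentially_bot _ 1(3)] by blast
    with 1 show ?thesis by simp
  qed
qed

text \<open>The lexicographically larger scale governs the sum; positivity of the leading constants
  excludes cancellation.\<close>

lemma exp_poly_growth_add:
  assumes g: "exp_poly_growth b" "exp_poly_growth b'"
  shows "exp_poly_growth (\<lambda>n. b n + b' n)"
proof -
  have dom: "exp_poly_growth (\<lambda>n. b n + b' n)"
    if 1: "a > 0" "c > 0" "(\<lambda>n. b n / (a ^ n * real n ^ k)) \<longlonglongrightarrow> c"
      and 2: "(\<lambda>n. b' n / (a ^ n * real n ^ k)) \<longlonglongrightarrow> c'" "c' \<ge> 0" for a c k c' b b'
  proof -
    have "(\<lambda>n. b n / (a ^ n * real n ^ k) + b' n / (a ^ n * real n ^ k)) \<longlonglongrightarrow> c + c'"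
      by (intro tendsto_intros 1 2)
    then have "(\<lambda>n. (b n + b' n) / (a ^ n * real n ^ k)) \<longlonglongrightarrow> c + c'"
      by (simp add: add_divide_distrib)
    then show ?thesis using 1 2 unfolding exp_poly_growth_def by (meson add_pos_nonneg)
  qed
  have zero: "exp_poly_growth (\<lambda>n. b n + b' n)" if z: "\<forall>\<^sub>F n in sequentially. b' n = 0" and g: "exp_poly_growth b" for b b'
    using g unfolding exp_poly_growth_def
  proof (elim disjE exE conjE)
    assume "\<forall>\<^sub>F n in sequentially. b n = 0"
    with z have "\<forall>\<^sub>F n in sequentially. b n + b' n = 0" by eventually_elim simp
    then show "(\<forall>\<^sub>F n in sequentially. b n + b' n = 0) \<or>
      (\<exists>a>0. \<exists>k. \<exists>c>0. (\<lambda>n. (b n + b' n) / (a ^ n * real n ^ k)) \<longlonglongrightarrow> c)" by blast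
  next
    fix a k c assume 1: "a > 0" "c > 0" "(\<lambda>n. b n / (a ^ n * real n ^ k)) \<longlonglongrightarrow> c"
    have "\<forall>\<^sub>F n in sequentially. b' n / (a ^ n * real n ^ k) = 0" using z by eventually_elim simp
    then have "(\<lambda>n. b' n / (a ^ n * real n ^ k)) \<longlonglongrightarrow> 0" by (rule tendsto_eventually)
    from dom[OF 1 this] show "(\<forall>\<^sub>F n in sequentially. b n + b' n = 0) \<or>
      (\<exists>a>0. \<exists>k. \<exists>c>0. (\<lambda>n. (b n + b' n) / (a ^ n * real n ^ k)) \<longlonglongrightarrow> c)"
      by (simp add: exp_poly_growth_def)
  qed
  consider "\<forall>\<^sub>F n in sequentially. b' n = 0" | "\<forall>\<^sub>F n in sequentially. b n = 0"
    | "\<not> (\<forall>\<^sub>F n in sequentially. b' n = 0)" "\<not> (\<forall>\<^sub>F n in sequentially. b n = 0)" by blast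
  then show ?thesis
  proof cases
    case 1 then show ?thesis using zero g by blast
  next
    case 2 then show ?thesis using zero[of b b'] g by (simp add: add.commute)
  next
    case 3
    obtain a k c where 1: "a > 0" "c > 0" "(\<lambda>n. b n / (a ^ n * real n ^ k)) \<longlonglongrightarrow> c"
      by (rule exp_poly_growthE[OF g(1)]) (use 3 in simp)
    obtain a' k' c' where 2: "a' > 0" "c' > 0" "(\<lambda>n. b' n / (a' ^ n * real n ^ k')) \<longlonglongrightarrow> c'"
      by (rule exp_poly_growthE[OF g(2)]) (use 3 in simp)
    have lesser: "(\<lambda>n. b n / (a' ^ n * real n ^ k')) \<longlonglongrightarrow> 0"
      if 1: "a > 0" "a' > 0" "(\<lambda>n. b n / (a ^ n * real n ^ k)) \<longlonglongrightarrow> c" "a < a' \<or> a = a' \<and> k < k'" for a a' c k k' b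
    proof -
      have "(\<lambda>n. b n / (a ^ n * real n ^ k) * ((a ^ n * real n ^ k) / (a' ^ n * real n ^ k'))) \<longlonglongrightarrow> c * 0"
        by (intro tendsto_intros 1 exp_poly_compare)
      moreover have "\<forall>\<^sub>F n in sequentially. b n / (a ^ n * real n ^ k) * ((a ^ n * real n ^ k) / (a' ^ n * real n ^ k')) = b n / (a' ^ n * real n ^ k')"
        using eventually_gt_at_top[of 0] by eventually_elim (use 1 in auto)
      ultimately show ?thesis unfolding mult_zero_right by (rule Lim_transform_eventually)
    qed
    consider "a = a' \<and> k = k'" | "a < a' \<or> a = a' \<and> k < k'" | "a' < a \<or> a' = a \<and> k' < k" by linarith
    then show ?thesis
    proof cases
      case 1 then show ?thesis using dom[OF \<open>a>0\<close> \<open>c>0\<close>] \<open>c' > 0\<close> \<open>_ \<longlonglongrightarrow> c\<close> \<open>_ \<longlonglongrightarrow> c'\<close> by auto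
    next
      case l: 2
      from dom[OF 2 lesser[OF 1(1) 2(1) 1(3) l]] show ?thesis by (simp add: add.commute)
    next
      case l: 3
      from dom[OF 1 lesser[OF 2(1) 1(1) 2(3) l]] show ?thesis by simp
    qed
  qed
qed

lemma exp_poly_growth_scale:
  assumes g: "exp_poly_growth b" and "r > 0" "s > 0"
  shows "exp_poly_growth (\<lambda>n. r ^ n * s * b n)"
  using g unfolding exp_poly_growth_def
proof (elim disjE exE conjE)
  assume "\<forall>\<^sub>F n in sequentially. b n = 0"
  then have "\<forall>\<^sub>F n in sequentially. r ^ n * s * b n = 0" by eventually_elim simp
  then show "(\<forall>\<^sub>F n in sequentially. r ^ n * s * b n = 0) \<or>
      (\<exists>a>0. \<exists>k. \<exists>c>0. (\<lambda>n. r ^ n * s * b n / (a ^ n * real n ^ k)) \<longlonglongrightarrow> c)" by blast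
next
  fix a k c assume 1: "a > 0" "c > 0" "(\<lambda>n. b n / (a ^ n * real n ^ k)) \<longlonglongrightarrow> c"
  have "(\<lambda>n. s * (b n / (a ^ n * real n ^ k))) \<longlonglongrightarrow> s * c" by (intro tendsto_intros 1)
  moreover have "s * (b n / (a ^ n * real n ^ k)) = r ^ n * s * b n / ((r * a) ^ n * real n ^ k)" for n
    using assms by (simp add: power_mult_distrib)
  ultimately have "(\<lambda>n. r ^ n * s * b n / ((r * a) ^ n * real n ^ k)) \<longlonglongrightarrow> s * c" by simp
  then show "(\<forall>\<^sub>F n in sequentially. r ^ n * s * b n = 0) \<or>
      (\<exists>a>0. \<exists>k. \<exists>c>0. (\<lambda>n. r ^ n * s * b n / (a ^ n * real n ^ k)) \<longlonglongrightarrow> c)"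
    using 1 assms by (meson mult_pos_pos)
qed

lemma exp_poly_growth_Suc:
  assumes g: "exp_poly_growth (\<lambda>n. b (Suc n))"
  shows "exp_poly_growth b"
  using g unfolding exp_poly_growth_def
proof (elim disjE exE conjE)
  assume "\<forall>\<^sub>F n in sequentially. b (Suc n) = 0"
  then have "\<forall>\<^sub>F n in sequentially. b n = 0" using eventually_sequentially_Suc[of "\<lambda>n. b n = 0"] by simp
  then show "(\<forall>\<^sub>F n in sequentially. b n = 0) \<or> (\<exists>a>0. \<exists>k. \<exists>c>0. (\<lambda>n. b n / (a ^ n * real n ^ k)) \<longlonglongrightarrow> c)" by blast
next
  fix a k c assume 1: "a > 0" "c > 0" "(\<lambda>n. b (Suc n) / (a ^ n * real n ^ k)) \<longlonglongrightarrow> c"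
  have l: "(\<lambda>n. real n / real (Suc n)) \<longlonglongrightarrow> 1" by real_asymp
  have "(\<lambda>n. b (Suc n) / (a ^ n * real n ^ k) * (real n / real (Suc n)) ^ k / a) \<longlonglongrightarrow> c * 1 ^ k / a"
    using 1 by (intro tendsto_intros 1 l) auto
  moreover have "\<forall>\<^sub>F n in sequentially. b (Suc n) / (a ^ n * real n ^ k) * (real n / real (Suc n)) ^ k / a
      = b (Suc n) / (a ^ Suc n * real (Suc n) ^ k)"
    using eventually_gt_at_top[of 0]
    by eventually_elim (use 1 in \<open>simp add: power_divide del: of_nat_Suc\<close>)
  ultimately have "(\<lambda>n. b (Suc n) / (a ^ Suc n * real (Suc n) ^ k)) \<longlonglongrightarrow> c * 1 ^ k / a" by (rule Lim_transform_eventually)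
  then have "(\<lambda>n. b n / (a ^ n * real n ^ k)) \<longlonglongrightarrow> c * 1 ^ k / a"
    by (rule LIMSEQ_imp_Suc)
  then show "(\<forall>\<^sub>F n in sequentially. b n = 0) \<or> (\<exists>a>0. \<exists>k. \<exists>c>0. (\<lambda>n. b n / (a ^ n * real n ^ k)) \<longlonglongrightarrow> c)"
    using 1 by (metis divide_pos_pos mult_1_right power_one)
qed

text \<open>This is the property propagated along the graph. The growth class of \<open>b\<close>
  and the domination of \<open>F\<close> are included because adding two such pairs requires both.
  Where \<open>b n = 0\<close> the domination forces \<open>F n x = 0\<close>, so division by zero
  is harmless.\<close>

definition cesaro_regular :: "'x measure \<Rightarrow> (nat \<Rightarrow> real) \<Rightarrow> (nat \<Rightarrow> 'x \<Rightarrow> real) \<Rightarrow> bool" where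
  "cesaro_regular M b F \<longleftrightarrow> (\<forall>n. 0 \<le> b n) \<and> exp_poly_growth b \<and> (\<forall>n. F n \<in> borel_measurable M) \<and>
     (\<exists>K. \<forall>n. \<forall>x\<in>space M. \<bar>F n x\<bar> \<le> K * b n) \<and>
     (AE x in M. convergent (cesaro_mean (\<lambda>n. F n x / b n)))"

lemma cesaro_regularI:
  assumes "\<And>n. 0 \<le> b n" "exp_poly_growth b" "\<And>n. F n \<in> borel_measurable M"
    "\<And>n x. x \<in> space M \<Longrightarrow> \<bar>F n x\<bar> \<le> K * b n"
    "AE x in M. convergent (cesaro_mean (\<lambda>n. F n x / b n))"
  shows "cesaro_regular M b F"
  using assms unfolding cesaro_regular_def by blast

lemma cesaro_regularE:
  assumes "cesaro_regular M b F"
  obtains K where "K \<ge> 0" "\<And>n. 0 \<le> b n" "exp_poly_growth b" "\<And>n. F n \<in> borel_measurable M"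
    "\<And>n x. x \<in> space M \<Longrightarrow> \<bar>F n x\<bar> \<le> K * b n"
    "AE x in M. convergent (cesaro_mean (\<lambda>n. F n x / b n))"
proof -
  obtain K where K: "\<And>n x. x \<in> space M \<Longrightarrow> \<bar>F n x\<bar> \<le> K * b n" and nn: "\<And>n. 0 \<le> b n"
    using assms unfolding cesaro_regular_def by blast
  have "\<bar>F n x\<bar> \<le> \<bar>K\<bar> * b n" if "x \<in> space M" for n x
    using K[OF that, of n] mult_right_mono[OF abs_ge_self[of K] nn[of n]] by linarith
  then show ?thesis using that[of "\<bar>K\<bar>"] assms unfolding cesaro_regular_def by simp
qed

lemma abs_quotient_le:
  fixes f b K :: real
  assumes "\<bar>f\<bar> \<le> K * b" "0 \<le> b" "0 \<le> K"
  shows "\<bar>f / b\<bar> \<le> K"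
  using assms by (cases "b = 0") (auto simp: divide_le_eq)

text \<open>The new quotient combines \<open>F / b\<close> and \<open>F' / b'\<close> with the
  weights \<open>b / (b + b')\<close> and \<open>b' / (b + b')\<close>, which converge by
  \<open>exp_poly_growth_ratio\<close>.\<close>

lemma cesaro_regular_add:
  assumes 1: "cesaro_regular M b F" and 2: "cesaro_regular M b' F'"
  shows "cesaro_regular M (\<lambda>n. b n + b' n) (\<lambda>n x. F n x + F' n x)"
proof -
  obtain K where K: "K \<ge> 0" "\<And>n. 0 \<le> b n" "exp_poly_growth b" "\<And>n. F n \<in> borel_measurable M"
    "\<And>n x. x \<in> space M \<Longrightarrow> \<bar>F n x\<bar> \<le> K * b n"
    "AE x in M. convergent (cesaro_mean (\<lambda>n. F n x / b n))" by (rule cesaro_regularE[OF 1]) blast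
  obtain K' where K': "K' \<ge> 0" "\<And>n. 0 \<le> b' n" "exp_poly_growth b'" "\<And>n. F' n \<in> borel_measurable M"
    "\<And>n x. x \<in> space M \<Longrightarrow> \<bar>F' n x\<bar> \<le> K' * b' n"
    "AE x in M. convergent (cesaro_mean (\<lambda>n. F' n x / b' n))" by (rule cesaro_regularE[OF 2]) blast
  have g: "exp_poly_growth (\<lambda>n. b n + b' n)" by (rule exp_poly_growth_add) fact+
  obtain c where c: "(\<lambda>n. b n / (b n + b' n)) \<longlonglongrightarrow> c"
    using exp_poly_growth_ratio[OF K(3) g K(2), of 1] K(2) K'(2) by (auto simp: convergent_def)
  obtain c' where c': "(\<lambda>n. b' n / (b n + b' n)) \<longlonglongrightarrow> c'"
    using exp_poly_growth_ratio[OF K'(3) g K'(2), of 1] K(2) K'(2) by (auto simp: convergent_def)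
  show ?thesis
  proof (rule cesaro_regularI[OF _ g, where K="max K K'"])
    show "0 \<le> b n + b' n" for n using K(2) K'(2) by (simp add: add_nonneg_nonneg)
    show "(\<lambda>x. F n x + F' n x) \<in> borel_measurable M" for n using K(4) K'(4) by (intro borel_measurable_add)
    show "\<bar>F n x + F' n x\<bar> \<le> max K K' * (b n + b' n)" if "x \<in> space M" for n x
    proof -
      have "\<bar>F n x\<bar> \<le> max K K' * b n" "\<bar>F' n x\<bar> \<le> max K K' * b' n"
        using K(5)[OF that, of n] K'(5)[OF that, of n] mult_right_mono[OF max.cobounded1[of K K'] K(2)[of n]]
          mult_right_mono[OF max.cobounded2[of K' K] K'(2)[of n]] by linarith+
      then show ?thesis by (simp add: distrib_left)
    qed
    show "AE x in M. convergent (cesaro_mean (\<lambda>n. (F n x + F' n x) / (b n + b' n)))"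
      using K(6) K'(6) AE_space
    proof eventually_elim
      case (elim x)
      have *: "convergent (cesaro_mean (\<lambda>n. F n x / b n * (b n / (b n + b' n)) + F' n x / b' n * (b' n / (b n + b' n))))"
      proof (intro convergent_cesaro_mean_add convergent_cesaro_mean_mult)
        show "\<bar>F n x / b n\<bar> \<le> K" for n using K(1,2) K(5)[OF elim(3)] by (intro abs_quotient_le) auto
        show "\<bar>F' n x / b' n\<bar> \<le> K'" for n using K'(1,2) K'(5)[OF elim(3)] by (intro abs_quotient_le) auto
      qed (fact elim c c')+
      have 1: "F n x / b n * (b n / (b n + b' n)) = F n x / (b n + b' n)" for n
        using K(5)[OF elim(3), of n] by (cases "b n = 0") auto
      have 2: "F' n x / b' n * (b' n / (b n + b' n)) = F' n x / (b n + b' n)" for n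
        using K'(5)[OF elim(3), of n] by (cases "b' n = 0") auto
      from * show ?case by (simp only: 1 2 add_divide_distrib)
    qed
  qed
qed

lemma cesaro_regular_zero: "cesaro_regular M (\<lambda>n. 0) (\<lambda>n x. 0)"
  by (rule cesaro_regularI[where K=0])
    (auto simp: exp_poly_growth_def cesaro_mean_def[abs_def] convergent_const)

lemma cesaro_regular_sum:
  assumes "finite I" "\<And>i. i \<in> I \<Longrightarrow> cesaro_regular M (b i) (F i)"
  shows "cesaro_regular M (\<lambda>n. \<Sum>i\<in>I. b i n) (\<lambda>n x. \<Sum>i\<in>I. F i n x)"
  using assms
proof (induction I rule: finite_induct)
  case empty then show ?case by (simp add: cesaro_regular_zero)
next
  case (insert i I)
  then show ?case using cesaro_regular_add[of M "b i" "F i"] by simp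
qed

text \<open>Measure preservation pulls the exceptional null set back to a null set.\<close>

lemma cesaro_regular_comp:
  assumes 1: "cesaro_regular M b F" and t: "\<tau> \<in> M \<rightarrow>\<^sub>M M" "distr M M \<tau> = M"
  shows "cesaro_regular M b (\<lambda>n x. F n (\<tau> x))"
proof -
  obtain K where K: "K \<ge> 0" "\<And>n. 0 \<le> b n" "exp_poly_growth b" "\<And>n. F n \<in> borel_measurable M"
    "\<And>n x. x \<in> space M \<Longrightarrow> \<bar>F n x\<bar> \<le> K * b n"
    "AE x in M. convergent (cesaro_mean (\<lambda>n. F n x / b n))" by (rule cesaro_regularE[OF 1]) blast
  have "AE x in distr M M \<tau>. convergent (cesaro_mean (\<lambda>n. F n x / b n))" by (subst t(2)) (rule K(6))
  then have "AE x in M. convergent (cesaro_mean (\<lambda>n. F n (\<tau> x) / b n))" by (rule AE_distrD[OF t(1)])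
  then show ?thesis
    by (intro cesaro_regularI[OF K(2,3), where K=K])
      (use K t measurable_space[OF t(1)] in \<open>auto intro: measurable_compose\<close>)
qed

text \<open>The common factor cancels in the quotient. This serves both to introduce and to remove
  the Perron normalisation.\<close>

lemma cesaro_regular_scale:
  assumes 1: "cesaro_regular M b F" and rs: "r > 0" "s > 0"
  shows "cesaro_regular M (\<lambda>n. r ^ n * s * b n) (\<lambda>n x. r ^ n * s * F n x)"
proof -
  obtain K where K: "K \<ge> 0" "\<And>n. 0 \<le> b n" "exp_poly_growth b" "\<And>n. F n \<in> borel_measurable M"
    "\<And>n x. x \<in> space M \<Longrightarrow> \<bar>F n x\<bar> \<le> K * b n"
    "AE x in M. convergent (cesaro_mean (\<lambda>n. F n x / b n))" by (rule cesaro_regularE[OF 1]) blast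
  show ?thesis
  proof (rule cesaro_regularI[where K=K])
    show "\<bar>r ^ n * s * F n x\<bar> \<le> K * (r ^ n * s * b n)" if "x \<in> space M" for n x
    proof -
      have "\<bar>r ^ n * s * F n x\<bar> = (r ^ n * s) * \<bar>F n x\<bar>" using rs by (simp add: abs_mult)
      also have "\<dots> \<le> (r ^ n * s) * (K * b n)" using rs K(5)[OF that] by (intro mult_left_mono) auto
      finally show ?thesis by (simp add: mult_ac)
    qed
    show "AE x in M. convergent (cesaro_mean (\<lambda>n. r ^ n * s * F n x / (r ^ n * s * b n)))"
      using K(6) rs by simp
  qed (use K rs exp_poly_growth_scale in auto)
qed

text \<open>Serves vertices without a loop: there the recursion describes \<open>b (Suc n)\<close>
  through other vertices, and about time 0 only a bound is known.\<close>

lemma cesaro_regular_Suc: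
  assumes 1: "cesaro_regular M (\<lambda>n. b (Suc n)) (\<lambda>n. F (Suc n))"
    and 0: "0 \<le> b 0" "F 0 \<in> borel_measurable M" "\<And>x. x \<in> space M \<Longrightarrow> \<bar>F 0 x\<bar> \<le> K0 * b 0"
  shows "cesaro_regular M b F"
proof -
  obtain K where K: "K \<ge> 0" "\<And>n. 0 \<le> b (Suc n)" "exp_poly_growth (\<lambda>n. b (Suc n))" "\<And>n. F (Suc n) \<in> borel_measurable M"
    "\<And>n x. x \<in> space M \<Longrightarrow> \<bar>F (Suc n) x\<bar> \<le> K * b (Suc n)"
    "AE x in M. convergent (cesaro_mean (\<lambda>n. F (Suc n) x / b (Suc n)))" by (rule cesaro_regularE[OF 1]) blast
  have nn: "0 \<le> b n" for n using K(2) 0 by (cases n) auto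
  show ?thesis
  proof (rule cesaro_regularI[where K="max K K0"])
    show "\<bar>F n x\<bar> \<le> max K K0 * b n" if "x \<in> space M" for n x
    proof (cases n)
      case 0
      have "\<bar>F 0 x\<bar> \<le> K0 * b 0" using assms(4) that by blast
      also have "\<dots> \<le> max K K0 * b 0" using nn by (intro mult_right_mono) auto
      finally show ?thesis using 0 by simp
    next
      case (Suc m)
      have "\<bar>F n x\<bar> \<le> K * b n" using K(5)[OF that] Suc by simp
      also have "\<dots> \<le> max K K0 * b n" using nn by (intro mult_right_mono) auto
      finally show ?thesis .
    qed
    show "F n \<in> borel_measurable M" for n using K(4) 0 by (cases n) auto
    show "AE x in M. convergent (cesaro_mean (\<lambda>n. F n x / b n))"
      using K(6) by eventually_elim (subst (asm) convergent_cesaro_mean_Suc_iff)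
  qed (use nn exp_poly_growth_Suc[OF K(3)] in auto)
qed

section \<open>Hopf's ergodic theorem for bounded functions\<close>

definition rlimsup :: "(nat \<Rightarrow> real) \<Rightarrow> real" where
  "rlimsup X = real_of_ereal (limsup (\<lambda>n. ereal (X n)))"

context
  fixes X :: "nat \<Rightarrow> real" and K :: real
  assumes bounded: "\<And>n. \<bar>X n\<bar> \<le> K"
begin

lemma ereal_rlimsup: "ereal (rlimsup X) = limsup (\<lambda>n. ereal (X n))"
proof -
  have "limsup (\<lambda>n. ereal (X n)) \<le> ereal K"
    by (rule Limsup_bounded) (use bounded in \<open>auto simp: abs_le_iff intro!: always_eventually\<close>)
  moreover have "ereal (- K) \<le> limsup (\<lambda>n. ereal (X n))"
  proof -
    have "ereal (- K) \<le> liminf (\<lambda>n. ereal (X n))"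
      by (rule Liminf_bounded) (use bounded in \<open>auto simp: abs_le_iff minus_le_iff intro!: always_eventually\<close>)
    also have "\<dots> \<le> limsup (\<lambda>n. ereal (X n))" by (simp add: Liminf_le_Limsup)
    finally show ?thesis .
  qed
  ultimately show ?thesis unfolding rlimsup_def
    by (cases "limsup (\<lambda>n. ereal (X n))") auto
qed

lemma rlimsup_eventually_less:
  assumes "e > 0" shows "\<forall>\<^sub>F n in sequentially. X n < rlimsup X + e"
proof -
  have "limsup (\<lambda>n. ereal (X n)) \<le> ereal (rlimsup X)" by (simp add: ereal_rlimsup)
  then have "\<forall>y>ereal (rlimsup X). \<forall>\<^sub>F n in sequentially. ereal (X n) < y" by (simp add: Limsup_le_iff)
  moreover have "ereal (rlimsup X) < ereal (rlimsup X + e)" using assms by simp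
  ultimately have "\<forall>\<^sub>F n in sequentially. ereal (X n) < ereal (rlimsup X + e)" by blast
  then show ?thesis by simp
qed

lemma rlimsup_le:
  assumes "\<forall>\<^sub>F n in sequentially. X n \<le> c" shows "rlimsup X \<le> c"
proof -
  have "limsup (\<lambda>n. ereal (X n)) \<le> ereal c" by (rule Limsup_bounded) (use assms in simp)
  then show ?thesis by (simp add: ereal_rlimsup[symmetric])
qed

lemma rlimsup_frequently_greater:
  assumes "e > 0" shows "\<exists>\<^sub>F n in sequentially. X n > rlimsup X - e"
proof (rule ccontr)
  assume "\<not> ?thesis"
  then have "\<forall>\<^sub>F n in sequentially. X n \<le> rlimsup X - e" by (simp add: frequently_def not_less)
  from rlimsup_le[OF this] show False using assms by simp
qed

lemma abs_rlimsup_le: "\<bar>rlimsup X\<bar> \<le> K"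
proof -
  have "rlimsup X \<le> K" by (rule rlimsup_le) (use bounded abs_le_D1 in \<open>auto intro!: always_eventually\<close>)
  moreover have "- K \<le> rlimsup X"
  proof (rule ccontr)
    assume "\<not> ?thesis"
    then have "- K - rlimsup X > 0" by simp
    from rlimsup_eventually_less[OF this] obtain n where "X n < - K"
      by (auto simp: eventually_sequentially)
    then show False using bounded[of n] by (simp add: abs_le_iff)
  qed
  ultimately show ?thesis by (simp add: abs_le_iff)
qed

lemma rlimsup_tendsto_eq: "X \<longlonglongrightarrow> L \<Longrightarrow> rlimsup X = L"
  unfolding rlimsup_def using lim_imp_Limsup[of sequentially "\<lambda>n. ereal (X n)" "ereal L"] by simp

text \<open>The sum is limsup minus liminf, the oscillation of \<open>X\<close>. Later arguments
  show that such an oscillation has integral at most zero, which by this inequality makes it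
  vanish.\<close>

lemma rlimsup_uminus_ge: "0 \<le> rlimsup X + rlimsup (\<lambda>n. - X n)"
proof -
  have "- liminf (\<lambda>n. ereal (X n)) = limsup (\<lambda>n. ereal (- X n))"
    using ereal_Limsup_uminus[of sequentially "\<lambda>n. ereal (X n)"] by simp
  moreover have "liminf (\<lambda>n. ereal (X n)) \<le> limsup (\<lambda>n. ereal (X n))" by (simp add: Liminf_le_Limsup)
  ultimately have "- ereal (rlimsup X) \<le> limsup (\<lambda>n. ereal (- X n))"
    by (metis ereal_minus_le_minus ereal_rlimsup)
  moreover have "limsup (\<lambda>n. ereal (- X n)) \<le> ereal K"
    by (rule Limsup_bounded) (use bounded in \<open>auto simp: abs_le_iff minus_le_iff intro!: always_eventually\<close>)
  ultimately show ?thesis unfolding rlimsup_def[of "\<lambda>n. - X n"]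
    by (cases "limsup (\<lambda>n. ereal (- X n))") auto
qed

end

lemma rlimsup_tendsto:
  assumes b: "\<And>n. \<bar>X n\<bar> \<le> K" and le: "rlimsup X + rlimsup (\<lambda>n. - X n) \<le> 0"
  shows "X \<longlonglongrightarrow> rlimsup X"
proof (rule LIMSEQ_I)
  fix e :: real assume e: "e > 0"
  have "\<forall>\<^sub>F n in sequentially. X n < rlimsup X + e" by (rule rlimsup_eventually_less[OF b e])
  moreover have "\<forall>\<^sub>F n in sequentially. - X n < rlimsup (\<lambda>n. - X n) + e"
    by (rule rlimsup_eventually_less[OF _ e, of _ K]) (simp add: b)
  ultimately have "\<forall>\<^sub>F n in sequentially. norm (X n - rlimsup X) < e"
    by eventually_elim (use le in auto)
  then show "\<exists>no. \<forall>n\<ge>no. norm (X n - rlimsup X) < e" by (simp add: eventually_sequentially)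
qed

lemma rlimsup_mono:
  assumes "\<And>n. \<bar>X n\<bar> \<le> K" "\<And>n. \<bar>Y n\<bar> \<le> L" "\<And>n. X n \<le> Y n"
  shows "rlimsup X \<le> rlimsup Y"
proof (rule field_le_epsilon)
  fix e :: real assume e: "e > 0"
  show "rlimsup X \<le> rlimsup Y + e"
  proof (rule rlimsup_le[OF assms(1)])
    have "\<forall>\<^sub>F n in sequentially. Y n < rlimsup Y + e" by (rule rlimsup_eventually_less[OF assms(2) e])
    then show "\<forall>\<^sub>F n in sequentially. X n \<le> rlimsup Y + e"
      by eventually_elim (use assms(3) le_less_trans less_imp_le in metis)
  qed
qed

lemma borel_measurable_rlimsup [measurable]:
  "(\<And>n. f n \<in> borel_measurable M) \<Longrightarrow> (\<lambda>x. rlimsup (\<lambda>n. f n x)) \<in> borel_measurable M"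
  unfolding rlimsup_def by measurable

text \<open>The operator \<open>P\<close> below acts on functions on
  \<open>C \<times> space M\<close> by averaging over incoming arcs. \<open>stochastic\<close> makes
  it fix constants; \<open>stationary\<close> and measure preservation make the product of the
  weights \<open>m\<close> with \<open>M\<close> invariant.\<close>

locale markov_op =
  fixes M :: "'x measure" and C :: "'v set" and E :: "'e set"
    and src tgt :: "'e \<Rightarrow> 'v" and \<tau> :: "'e \<Rightarrow> 'x \<Rightarrow> 'x" and p :: "'e \<Rightarrow> real" and m :: "'v \<Rightarrow> real"
  assumes prob: "prob_space M" and finC: "finite C" and finE: "finite E"
    and src: "\<And>e. e \<in> E \<Longrightarrow> src e \<in> C" and tgt: "\<And>e. e \<in> E \<Longrightarrow> tgt e \<in> C"
    and meas: "\<And>e. e \<in> E \<Longrightarrow> \<tau> e \<in> M \<rightarrow>\<^sub>M M" and pres: "\<And>e. e \<in> E \<Longrightarrow> distr M M (\<tau> e) = M"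
    and p_nonneg: "\<And>e. e \<in> E \<Longrightarrow> 0 \<le> p e"
    and stochastic: "\<And>w. w \<in> C \<Longrightarrow> (\<Sum>e | e \<in> E \<and> tgt e = w. p e) = 1"
    and m_pos: "\<And>w. w \<in> C \<Longrightarrow> 0 < m w"
    and stationary: "\<And>v. v \<in> C \<Longrightarrow> (\<Sum>e | e \<in> E \<and> src e = v. p e * m (tgt e)) = m v"
begin

definition P :: "('v \<Rightarrow> 'x \<Rightarrow> real) \<Rightarrow> 'v \<Rightarrow> 'x \<Rightarrow> real" where
  "P f w x = (\<Sum>e | e \<in> E \<and> tgt e = w. p e * f (src e) (\<tau> e x))"

definition bnd :: "('v \<Rightarrow> 'x \<Rightarrow> real) \<Rightarrow> real \<Rightarrow> bool" where
  "bnd f K \<longleftrightarrow> (\<forall>w\<in>C. f w \<in> borel_measurable M \<and> (\<forall>x\<in>space M. \<bar>f w x\<bar> \<le> K))"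

text \<open>The integral over \<open>C \<times> space M\<close> against the
  \<open>P\<close>-invariant measure.\<close>

definition I :: "('v \<Rightarrow> 'x \<Rightarrow> real) \<Rightarrow> real" where
  "I f = (\<Sum>w\<in>C. m w * (\<integral>x. f w x \<partial>M))"

lemma finite_incoming [simp]: "finite {e \<in> E. tgt e = w}" "finite {e \<in> E. src e = w}"
  using finE by auto

lemma \<tau>_space: "e \<in> E \<Longrightarrow> x \<in> space M \<Longrightarrow> \<tau> e x \<in> space M"
  using measurable_space[OF meas] .

lemma bndD: "bnd f K \<Longrightarrow> w \<in> C \<Longrightarrow> f w \<in> borel_measurable M"
   "bnd f K \<Longrightarrow> w \<in> C \<Longrightarrow> x \<in> space M \<Longrightarrow> \<bar>f w x\<bar> \<le> K"
  by (auto simp: bnd_def)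

lemma bndI: "(\<And>w. w \<in> C \<Longrightarrow> f w \<in> borel_measurable M) \<Longrightarrow>
    (\<And>w x. w \<in> C \<Longrightarrow> x \<in> space M \<Longrightarrow> \<bar>f w x\<bar> \<le> K) \<Longrightarrow> bnd f K"
  by (auto simp: bnd_def)

lemma bnd_integrable: assumes "bnd f K" "w \<in> C" shows "integrable M (f w)"
proof -
  interpret prob_space M by (rule prob)
  show ?thesis
    by (rule integrable_const_bound[of _ K]) (use bndD[OF assms(1,2)] in auto)
qed

lemma P_mono:
  assumes "\<And>v x. v \<in> C \<Longrightarrow> x \<in> space M \<Longrightarrow> f v x \<le> g v x" "x \<in> space M"
  shows "P f w x \<le> P g w x"
  unfolding P_def by (intro sum_mono mult_left_mono) (use assms p_nonneg src \<tau>_space in auto)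

lemma P_cong:
  assumes "\<And>v x. v \<in> C \<Longrightarrow> x \<in> space M \<Longrightarrow> f v x = g v x" "x \<in> space M"
  shows "P f w x = P g w x"
  unfolding P_def by (intro sum.cong) (use assms src \<tau>_space in auto)

lemma P_add: "P (\<lambda>w x. f w x + g w x) = (\<lambda>w x. P f w x + P g w x)"
  by (auto simp: P_def fun_eq_iff distrib_left sum.distrib)

lemma P_scale: "P (\<lambda>w x. c * f w x) = (\<lambda>w x. c * P f w x)"
  by (auto simp: P_def fun_eq_iff sum_distrib_left mult_ac)

lemma P_diff: "P (\<lambda>w x. f w x - g w x) = (\<lambda>w x. P f w x - P g w x)"
  by (auto simp: P_def fun_eq_iff right_diff_distrib sum_subtractf)

lemma P_sum: "finite J \<Longrightarrow> P (\<lambda>w x. \<Sum>i\<in>J. f i w x) = (\<lambda>w x. \<Sum>i\<in>J. P (f i) w x)"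
proof (induction J rule: finite_induct)
  case empty show ?case by (simp add: P_def fun_eq_iff)
next
  case (insert i J) then show ?case by (simp add: P_add)
qed

lemma P_const: "w \<in> C \<Longrightarrow> P (\<lambda>w x. c) w x = c"
  using stochastic[of w] by (simp add: P_def sum_distrib_right[symmetric])

lemma funpow_const: "w \<in> C \<Longrightarrow> x \<in> space M \<Longrightarrow> (P ^^ n) (\<lambda>w x. c) w x = c"
proof (induction n arbitrary: w x)
  case (Suc n)
  have "P ((P ^^ n) (\<lambda>w x. c)) w x = P (\<lambda>w x. c) w x" by (rule P_cong) (use Suc in auto)
  then show ?case using P_const[OF Suc.prems(1)] by simp
qed simp

lemma bnd_P: assumes "bnd f K" shows "bnd (P f) K"
proof (rule bndI)
  fix w assume w: "w \<in> C"
  show "P f w \<in> borel_measurable M" unfolding P_def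
    by (intro borel_measurable_sum borel_measurable_times borel_measurable_const
        measurable_compose[OF meas bndD(1)[OF assms src]]) auto
  fix x assume x: "x \<in> space M"
  have "P f w x \<le> P (\<lambda>w x. K) w x" by (rule P_mono) (use bndD(2)[OF assms] x in \<open>auto simp: abs_le_iff\<close>)
  moreover have "P (\<lambda>w x. - K) w x \<le> P f w x"
    by (rule P_mono) (use bndD(2)[OF assms] x in \<open>auto simp: abs_le_iff minus_le_iff\<close>)
  ultimately show "\<bar>P f w x\<bar> \<le> K" using P_const[OF w] by (simp add: abs_le_iff)
qed

lemma bnd_funpow: "bnd f K \<Longrightarrow> bnd ((P ^^ n) f) K"
  by (induction n) (auto intro: bnd_P)

lemma bnd_add: "bnd f K \<Longrightarrow> bnd g L \<Longrightarrow> bnd (\<lambda>w x. f w x + g w x) (K + L)"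
  unfolding bnd_def by (auto intro!: borel_measurable_add borel_measurable_diff order_trans[OF abs_triangle_ineq add_mono])

lemma bnd_diff: "bnd f K \<Longrightarrow> bnd g L \<Longrightarrow> bnd (\<lambda>w x. f w x - g w x) (K + L)"
  unfolding bnd_def by (auto intro!: borel_measurable_add borel_measurable_diff order_trans[OF abs_triangle_ineq4 add_mono])

lemma bnd_scale: "bnd f K \<Longrightarrow> bnd (\<lambda>w x. c * f w x) (\<bar>c\<bar> * K)"
  unfolding bnd_def by (auto simp: abs_mult intro: mult_left_mono)

lemma bnd_const: "bnd (\<lambda>w x. c) \<bar>c\<bar>"
  unfolding bnd_def by auto

lemma bnd_rlimsup: "(\<And>n. bnd (f n) K) \<Longrightarrow> bnd (\<lambda>w x. rlimsup (\<lambda>n. f n w x)) K"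
  unfolding bnd_def by (auto intro!: abs_rlimsup_le borel_measurable_rlimsup)

lemma I_mono:
  assumes "bnd f K" "bnd g L" "\<And>w. w \<in> C \<Longrightarrow> AE x in M. f w x \<le> g w x"
  shows "I f \<le> I g"
  unfolding I_def
  by (intro sum_mono mult_left_mono integral_mono_AE bnd_integrable[OF assms(1)] bnd_integrable[OF assms(2)])
    (use assms m_pos less_imp_le in auto)

lemma I_add: "bnd f K \<Longrightarrow> bnd g L \<Longrightarrow> I (\<lambda>w x. f w x + g w x) = I f + I g"
  unfolding I_def by (simp add: bnd_integrable distrib_left sum.distrib)

lemma I_diff: "bnd f K \<Longrightarrow> bnd g L \<Longrightarrow> I (\<lambda>w x. f w x - g w x) = I f - I g"
  unfolding I_def by (simp add: bnd_integrable right_diff_distrib sum_subtractf)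

lemma I_scale: "I (\<lambda>w x. c * f w x) = c * I f"
  unfolding I_def by (simp add: sum_distrib_left mult_ac)

lemma I_P: assumes "bnd f K" shows "I (P f) = I f"
proof -
  have int: "integrable M (\<lambda>x. f (src e) (\<tau> e x))" "(\<integral>x. f (src e) (\<tau> e x) \<partial>M) = (\<integral>x. f (src e) x \<partial>M)" if "e \<in> E" for e
  proof -
    have "integrable (distr M M (\<tau> e)) (f (src e))"
      using bnd_integrable[OF assms src[OF that]] pres[OF that] by metis
    then show "integrable M (\<lambda>x. f (src e) (\<tau> e x))" by (rule integrable_distr[OF meas[OF that]])
    have "(\<integral>x. f (src e) x \<partial>distr M M (\<tau> e)) = (\<integral>x. f (src e) (\<tau> e x) \<partial>M)"
      by (rule integral_distr[OF meas[OF that] bndD(1)[OF assms src[OF that]]])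
    then show "(\<integral>x. f (src e) (\<tau> e x) \<partial>M) = (\<integral>x. f (src e) x \<partial>M)" using pres[OF that] by metis
  qed
  have "I (P f) = (\<Sum>w\<in>C. m w * (\<Sum>e | e \<in> E \<and> tgt e = w. p e * (\<integral>x. f (src e) x \<partial>M)))"
    unfolding I_def P_def by (intro sum.cong refl arg_cong2[where f="(*)"]) (simp add: int)
  also have "\<dots> = (\<Sum>w\<in>C. \<Sum>e | e \<in> E \<and> tgt e = w. p e * m (tgt e) * (\<integral>x. f (src e) x \<partial>M))"
    by (intro sum.cong refl) (auto simp: sum_distrib_left mult_ac intro!: sum.cong)
  \<comment> \<open>Arcs are regrouped from their targets to their sources; the weight collected at
    \<open>v\<close> is then the left side of \<open>stationary\<close>.\<close>
  also have "\<dots> = (\<Sum>e\<in>E. p e * m (tgt e) * (\<integral>x. f (src e) x \<partial>M))"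
    by (rule sum.group) (use finC finE tgt in auto)
  also have "\<dots> = (\<Sum>v\<in>C. \<Sum>e | e \<in> E \<and> src e = v. p e * m (tgt e) * (\<integral>x. f (src e) x \<partial>M))"
    by (rule sum.group[symmetric]) (use finC finE src in auto)
  also have "\<dots> = (\<Sum>v\<in>C. (\<Sum>e | e \<in> E \<and> src e = v. p e * m (tgt e)) * (\<integral>x. f v x \<partial>M))"
    by (intro sum.cong refl) (auto simp: sum_distrib_right intro!: sum.cong)
  also have "\<dots> = I f" unfolding I_def using stationary by simp
  finally show ?thesis .
qed

text \<open>The maps \<open>\<tau> e\<close> preserve the measure, so statements valid almost
  everywhere may be used inside \<open>P\<close>.\<close>

lemma AE_pullback:
  assumes "\<And>w. w \<in> C \<Longrightarrow> AE x in M. Q w x" "e \<in> E"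
  shows "AE x in M. Q (src e) (\<tau> e x)"
proof -
  have "AE x in distr M M (\<tau> e). Q (src e) x" by (subst pres) (use assms src in auto)
  then show ?thesis by (rule AE_distrD[OF meas[OF assms(2)]])
qed

lemma AE_incoming:
  assumes "\<And>w. w \<in> C \<Longrightarrow> AE x in M. Q w x"
  shows "AE x in M. \<forall>e\<in>E. Q (src e) (\<tau> e x)"
  using AE_pullback[OF assms] finE by (intro AE_finite_allI) auto

lemma P_AE_cong:
  assumes "\<And>w. w \<in> C \<Longrightarrow> AE x in M. f w x = g w x"
  shows "AE x in M. P f w x = P g w x"
proof -
  have "AE x in M. \<forall>e\<in>E. f (src e) (\<tau> e x) = g (src e) (\<tau> e x)" by (rule AE_incoming) (rule assms)
  then show ?thesis by eventually_elim (auto simp: P_def)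
qed

lemma funpow_fixed_AE:
  assumes "\<And>w. w \<in> C \<Longrightarrow> AE x in M. P g w x = g w x" "w \<in> C"
  shows "AE x in M. (P ^^ n) g w x = g w x"
  using assms(2)
proof (induction n arbitrary: w)
  case (Suc n)
  have "AE x in M. P ((P ^^ n) g) w x = P g w x" by (rule P_AE_cong) (rule Suc.IH)
  with assms(1)[OF Suc.prems] show ?case by eventually_elim simp
qed simp

lemma I_nonneg_zero:
  assumes b: "bnd f K" and nn: "\<And>w. w \<in> C \<Longrightarrow> AE x in M. 0 \<le> f w x" and le: "I f \<le> 0" and w: "w \<in> C"
  shows "AE x in M. f w x = 0"
proof -
  have n: "0 \<le> m w * (\<integral>x. f w x \<partial>M)" if "w \<in> C" for w
    using m_pos[OF that] integral_nonneg_AE[OF nn[OF that]] by simp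
  have "(\<Sum>w\<in>C. m w * (\<integral>x. f w x \<partial>M)) = 0"
    using le sum_nonneg[of C "\<lambda>w. m w * (\<integral>x. f w x \<partial>M)"] n unfolding I_def by force
  then have "\<forall>w\<in>C. m w * (\<integral>x. f w x \<partial>M) = 0"
    using sum_nonneg_eq_0_iff[OF finC, of "\<lambda>w. m w * (\<integral>x. f w x \<partial>M)"] n by simp
  then have "m w * (\<integral>x. f w x \<partial>M) = 0" using w by blast
  then have "(\<integral>x. f w x \<partial>M) = 0" using m_pos[OF w] by simp
  then show ?thesis using integral_nonneg_eq_0_iff_AE[OF bnd_integrable[OF b w] nn[OF w]] by simp
qed

text \<open>Garsia's proof of the maximal inequality, with the running maximum of the partial sums
  replaced by the recursion \<open>Q (n + 1) = max 0 (f + P (Q n))\<close>.\<close>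

lemma maximal_inequality:
  assumes b: "bnd f K"
    and pos: "\<And>w. w \<in> C \<Longrightarrow> AE x in M. \<exists>n. 0 < (\<Sum>i<n. (P ^^ i) f w x)"
  shows "0 \<le> I f"
proof -
  interpret prob_space M by (rule prob)
  define Q where "Q n = ((\<lambda>g w x. max 0 (f w x + P g w x)) ^^ n) (\<lambda>w x. 0)" for n
  have Q0: "Q 0 = (\<lambda>w x. 0)" and QS: "Q (Suc n) = (\<lambda>w x. max 0 (f w x + P (Q n) w x))" for n
    by (simp_all add: Q_def)
  \<comment> \<open>A bound \<open>K\<close> can be negative only vacuously, for empty
    \<open>C\<close>.\<close>
  have K0: "K \<ge> 0 \<or> C = {}"
  proof -
    obtain x where "x \<in> space M" using not_empty by blast
    then show ?thesis using bndD(2)[OF b] abs_ge_zero order_trans by blast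
  qed
  have bQ: "bnd (Q n) (real n * K)" for n
  proof (induction n)
    case 0 show ?case using bnd_const[of 0] by (simp add: Q0)
  next
    case (Suc n)
    have "bnd (\<lambda>w x. f w x + P (Q n) w x) (K + real n * K)" by (intro bnd_add b bnd_P Suc)
    then show ?case unfolding bnd_def QS by (force simp: algebra_simps max_def)
  qed
  have nn: "0 \<le> Q n w x" for n w x by (cases n) (auto simp: Q0 QS)
  have mono: "Q n w x \<le> Q (Suc n) w x" if "x \<in> space M" for n w x
    using that
  proof (induction n arbitrary: w x)
    case 0 show ?case by (simp add: Q0 QS)
  next
    case (Suc n)
    have "P (Q n) w x \<le> P (Q (Suc n)) w x" by (rule P_mono) (use Suc in auto)
    then show ?case unfolding QS[of n] QS[of "Suc n"] by (simp add: max_def)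
  qed
  have S: "(\<Sum>i<n. (P ^^ i) f w x) \<le> Q n w x" if "x \<in> space M" for n w x
    using that
  proof (induction n arbitrary: w x)
    case 0 show ?case by (simp add: Q0)
  next
    case (Suc n)
    have "(\<Sum>i<Suc n. (P ^^ i) f w x) = f w x + (\<Sum>i<n. P ((P ^^ i) f) w x)"
      by (subst sum.lessThan_Suc_shift) simp
    also have "(\<Sum>i<n. P ((P ^^ i) f) w x) = P (\<lambda>w x. \<Sum>i<n. (P ^^ i) f w x) w x" by (simp add: P_sum)
    also have "\<dots> \<le> P (Q n) w x" by (rule P_mono) (use Suc in auto)
    finally show ?case by (simp add: QS)
  qed
  \<comment> \<open>\<open>f\<close> restricted to the set where \<open>Q n\<close> is positive. By
    \<open>pos\<close> these sets exhaust almost the whole space, so it suffices that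
    \<open>I (g (Suc n))\<close> is nonnegative.\<close>
  define g where "g n w x = f w x * indicator {y. 0 < Q n w y} x" for n w x
  have gm: "g n w \<in> borel_measurable M" if "w \<in> C" for n w
  proof -
    have [measurable]: "f w \<in> borel_measurable M" "Q n w \<in> borel_measurable M"
      using bndD(1)[OF b that] bndD(1)[OF bQ that] .
    have "(\<lambda>x. f w x * (if 0 < Q n w x then 1 else 0)) \<in> borel_measurable M" by measurable
    then show ?thesis by (simp add: g_def[abs_def] indicator_def[abs_def] cong: if_cong)
  qed
  have bg: "bnd (g n) K" for n
    by (rule bndI) (use gm bndD(2)[OF b] K0 in \<open>auto simp: g_def indicator_def\<close>)
  have "0 \<le> I (g (Suc n))" for n
  proof -
    \<comment> \<open>Where \<open>Q (Suc n)\<close> is positive the difference is exactly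
      \<open>f\<close>; elsewhere it is \<open>- P (Q n)\<close>, at most 0. By invariance its
      integral is \<open>I (Q (Suc n)) - I (Q n)\<close>, which is nonnegative since
      \<open>Q\<close> increases.\<close>
    have "I (\<lambda>w x. Q (Suc n) w x - P (Q n) w x) \<le> I (g (Suc n))"
    proof (rule I_mono[OF bnd_diff[OF bQ bnd_P[OF bQ]] bg], rule AE_I2)
      fix w x assume x: "x \<in> space M"
      have "P (\<lambda>w x. 0) w x \<le> P (Q n) w x" by (rule P_mono) (use nn x in auto)
      moreover have "P (\<lambda>w x. 0) w x = 0" by (simp add: P_def)
      ultimately have PQ: "0 \<le> P (Q n) w x" by simp
      show "Q (Suc n) w x - P (Q n) w x \<le> g (Suc n) w x"
        using PQ by (auto simp: QS g_def indicator_def max_def)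
    qed
    moreover have "I (\<lambda>w x. Q (Suc n) w x - P (Q n) w x) = I (Q (Suc n)) - I (Q n)"
      by (simp add: I_diff[OF bQ bnd_P[OF bQ]] I_P[OF bQ])
    moreover have "I (Q n) \<le> I (Q (Suc n))"
      by (rule I_mono[OF bQ bQ]) (use mono in auto)
    ultimately show ?thesis by simp
  qed
  moreover have "(\<lambda>n. I (g (Suc n))) \<longlonglongrightarrow> I f"
    unfolding I_def
  proof (intro tendsto_sum tendsto_mult tendsto_const integral_dominated_convergence[where w="\<lambda>_. K"])
    fix w assume w: "w \<in> C"
    show "f w \<in> borel_measurable M" using bndD(1)[OF b w] .
    show "g (Suc n) w \<in> borel_measurable M" for n using gm w .
    show "AE x in M. (\<lambda>n. g (Suc n) w x) \<longlonglongrightarrow> f w x"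
      using pos[OF w] AE_space
    proof eventually_elim
      case (elim x)
      then obtain N where "0 < (\<Sum>i<N. (P ^^ i) f w x)" by blast
      also have "\<dots> \<le> Q N w x" by (rule S[OF elim(2)])
      finally have N: "0 < Q N w x" .
      have "0 < Q n w x" if "n \<ge> N" for n
        using lift_Suc_mono_le[of "\<lambda>n. Q n w x" N n] mono[OF elim(2)] that N by force
      then have "g (Suc n) w x = f w x" if "n \<ge> N" for n using that by (simp add: g_def)
      then have "\<forall>\<^sub>F n in sequentially. g (Suc n) w x = f w x" unfolding eventually_sequentially by blast
      then show ?case by (rule tendsto_eventually)
    qed
    show "AE x in M. norm (g (Suc n) w x) \<le> K" for n
      using bndD(2)[OF bg w] by auto
  qed simp
  ultimately show ?thesis by (meson LIMSEQ_le_const)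
qed

section \<open>Ergodic averages and their limit\<close>

definition mean :: "('v \<Rightarrow> 'x \<Rightarrow> real) \<Rightarrow> nat \<Rightarrow> 'v \<Rightarrow> 'x \<Rightarrow> real" where
  "mean f N w x = cesaro_mean (\<lambda>n. (P ^^ n) f w x) N"

text \<open>An upper limit is available before convergence is known;
  \<open>hopf_ergodic_theorem\<close> identifies it almost everywhere as the limit.\<close>

definition proj :: "('v \<Rightarrow> 'x \<Rightarrow> real) \<Rightarrow> 'v \<Rightarrow> 'x \<Rightarrow> real" where
  "proj f w x = rlimsup (\<lambda>N. mean f N w x)"

lemma bnd_mean: assumes "bnd f K" shows "bnd (mean f N) K"
proof (rule bndI)
  fix w assume w: "w \<in> C"
  show "mean f N w \<in> borel_measurable M"
    unfolding mean_def[abs_def] cesaro_mean_def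
    by (intro borel_measurable_divide borel_measurable_sum borel_measurable_const bndD(1)[OF bnd_funpow[OF assms] w])
  show "\<bar>mean f N w x\<bar> \<le> K" if "x \<in> space M" for x
    unfolding mean_def by (rule abs_cesaro_mean_le) (rule bndD(2)[OF bnd_funpow[OF assms] w that])
qed

lemma bnd_proj: "bnd f K \<Longrightarrow> bnd (proj f) K"
  unfolding proj_def[abs_def] by (intro bnd_rlimsup bnd_mean)

lemma P_mean:
  assumes "bnd f K" "w \<in> C" "x \<in> space M"
  shows "\<bar>P (mean f N) w x - mean f N w x\<bar> \<le> 2 * K / real N"
proof -
  have "P (mean f N) w x = (\<Sum>n<N. (P ^^ Suc n) f w x) / real N"
  proof -
    have "mean f N = (\<lambda>w x. (1 / real N) * (\<Sum>n<N. (P ^^ n) f w x))"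
      by (simp add: mean_def cesaro_mean_def fun_eq_iff)
    then show ?thesis by (simp only: P_scale P_sum[OF finite_lessThan]) simp
  qed
  also have "\<dots> - mean f N w x = ((\<Sum>n<N. (P ^^ Suc n) f w x) - (\<Sum>n<N. (P ^^ n) f w x)) / real N"
    by (simp add: mean_def cesaro_mean_def diff_divide_distrib)
  also have "(\<Sum>n<N. (P ^^ Suc n) f w x) - (\<Sum>n<N. (P ^^ n) f w x) = (P ^^ N) f w x - f w x"
    by (induction N) auto
  finally have "\<bar>P (mean f N) w x - mean f N w x\<bar> = \<bar>(P ^^ N) f w x - f w x\<bar> / real N" by simp
  also have "\<dots> \<le> 2 * K / real N"
    using bndD(2)[OF bnd_funpow[OF assms(1)] assms(2,3), of N] bndD(2)[OF assms]
    by (intro divide_right_mono) linarith+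
  finally show ?thesis .
qed

text \<open>At a fixed \<open>x\<close> only finitely many arcs matter, so \<open>a N\<close> is
  eventually below its upper limit plus \<open>d\<close> along all of them at once, and
  \<open>P\<close> preserves this. The shift \<open>s\<close> is 0 for ergodic averages and 1 for
  the contraction argument.\<close>

lemma rlimsup_le_P_rlimsup:
  assumes b: "\<And>N. bnd (a N) K" and w: "w \<in> C" and x: "x \<in> space M" and k: "0 \<le> k"
    and le: "\<forall>\<^sub>F N in sequentially. a (N + s) w x \<le> k * P (a N) w x + y N" and y: "y \<longlonglongrightarrow> L"
  shows "rlimsup (\<lambda>N. a N w x) \<le> k * P (\<lambda>w x. rlimsup (\<lambda>N. a N w x)) w x + L"
proof (rule field_le_epsilon)
  fix e :: real assume e: "e > 0"
  \<comment> \<open>Chosen so that \<open>k * d \<le> e / 2\<close>; the \<open>+ 1\<close> covers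
    \<open>k = 0\<close>. The other half of \<open>e\<close> pays for \<open>y\<close>.\<close>
  define d where "d = e / (2 * (k + 1))"
  have d: "d > 0" using e k by (simp add: d_def)
  have "\<forall>\<^sub>F N in sequentially. \<forall>f\<in>E. a N (src f) (\<tau> f x) < rlimsup (\<lambda>N. a N (src f) (\<tau> f x)) + d"
    using finE
    by (rule eventually_ball_finite) (use b d bndD(2) src \<tau>_space x in \<open>intro ballI rlimsup_eventually_less[where K=K], auto\<close>)
  moreover have "\<forall>\<^sub>F N in sequentially. y N < L + e / 2"
    using order_tendstoD(2)[OF y, of "L + e/2"] e by simp
  ultimately have "\<forall>\<^sub>F N in sequentially. a (N + s) w x \<le> k * P (\<lambda>w x. rlimsup (\<lambda>N. a N w x)) w x + L + e"
    using le
  proof eventually_elim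
    case (elim N)
    have "P (a N) w x \<le> P (\<lambda>w x. rlimsup (\<lambda>N. a N w x) + d) w x"
      unfolding P_def by (intro sum_mono mult_left_mono) (use elim(1) p_nonneg less_imp_le in auto)
    also have "\<dots> = P (\<lambda>w x. rlimsup (\<lambda>N. a N w x)) w x + d"
      using P_const[OF w, of d x] by (simp add: P_add)
    finally have "k * P (a N) w x \<le> k * P (\<lambda>w x. rlimsup (\<lambda>N. a N w x)) w x + k * d"
      using k by (simp add: distrib_left[symmetric] mult_left_mono)
    moreover have "k * d \<le> e / 2" using e k by (simp add: d_def field_simps)
    ultimately show ?case using elim by linarith
  qed
  then have "\<forall>\<^sub>F N in sequentially. a N w x \<le> k * P (\<lambda>w x. rlimsup (\<lambda>N. a N w x)) w x + L + e"
    using eventually_sequentially_seg[of "\<lambda>N. a N w x \<le> k * P (\<lambda>w x. rlimsup (\<lambda>N. a N w x)) w x + L + e" s] by simp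
  then show "rlimsup (\<lambda>N. a N w x) \<le> k * P (\<lambda>w x. rlimsup (\<lambda>N. a N w x)) w x + L + e"
    by (rule rlimsup_le[OF bndD(2)[OF b w x]])
qed

lemma proj_le_P_proj:
  assumes "bnd f K" "w \<in> C" "x \<in> space M"
  shows "proj f w x \<le> P (proj f) w x"
proof -
  have y: "(\<lambda>N. 2 * K / real N) \<longlonglongrightarrow> 0" by real_asymp
  have "\<forall>\<^sub>F N in sequentially. mean f (N + 0) w x \<le> 1 * P (mean f N) w x + 2 * K / real N"
    using P_mean[OF assms] by (intro always_eventually allI) (simp add: abs_le_iff, smt (verit))
  from rlimsup_le_P_rlimsup[OF bnd_mean[OF assms(1)] assms(2,3) _ this y]
  show ?thesis by (simp add: proj_def[abs_def])
qed

lemma P_proj: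
  assumes b: "bnd f K" and w: "w \<in> C"
  shows "AE x in M. P (proj f) w x = proj f w x"
proof -
  have bb: "bnd (\<lambda>w x. P (proj f) w x - proj f w x) (K + K)"
    by (intro bnd_diff bnd_P bnd_proj b)
  have "I (\<lambda>w x. P (proj f) w x - proj f w x) \<le> 0"
    using I_diff[OF bnd_P[OF bnd_proj[OF b]] bnd_proj[OF b]] I_P[OF bnd_proj[OF b]] by simp
  from I_nonneg_zero[OF bb _ this w] proj_le_P_proj[OF b] show ?thesis by simp
qed

text \<open>The maximal inequality is applied to \<open>f - proj f\<close> plus a small constant.
  Since \<open>P\<close> fixes \<open>proj f\<close> almost everywhere, the sum of the first
  \<open>N\<close> iterates is \<open>N\<close> times \<open>mean f N - proj f\<close> plus the
  constant, which is positive for arbitrarily large \<open>N\<close> because \<open>proj f\<close>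
  is the upper limit.\<close>

lemma I_proj_le: assumes b: "bnd f K" shows "I (proj f) \<le> I f"
proof (rule field_le_epsilon)
  fix e :: real assume e: "e > 0"
  interpret prob_space M by (rule prob)
  \<comment> \<open>Exceeds the total mass of the invariant measure, so the constant
    \<open>e / s\<close> has integral at most \<open>e\<close>; the 1 keeps \<open>s\<close>
    positive for empty \<open>C\<close>.\<close>
  define s where "s = sum m C + 1"
  have s: "s > 0" using m_pos by (simp add: s_def add_nonneg_pos sum_nonneg less_imp_le)
  define h where "h w x = (f w x - proj f w x) + e / s" for w x
  have bd: "bnd (\<lambda>w x. f w x - proj f w x) (K + K)" by (intro bnd_diff b bnd_proj)
  have bh: "bnd h (K + K + \<bar>e / s\<bar>)"
    unfolding h_def[abs_def] by (intro bnd_add[OF bd] bnd_const)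
  have hn: "(P ^^ n) h w x = ((P ^^ n) f w x - (P ^^ n) (proj f) w x) + (P ^^ n) (\<lambda>w x. e / s) w x" for n w x
  proof -
    have "(P ^^ n) h = (\<lambda>w x. ((P ^^ n) f w x - (P ^^ n) (proj f) w x) + (P ^^ n) (\<lambda>w x. e / s) w x)"
      by (induction n) (simp_all add: h_def[abs_def] P_add P_diff)
    then show ?thesis by simp
  qed
  have "0 \<le> I h"
  proof (rule maximal_inequality[OF bh])
    fix w assume w: "w \<in> C"
    have 1: "AE x in M. \<forall>n. (P ^^ n) (proj f) w x = proj f w x"
      unfolding AE_all_countable using funpow_fixed_AE[OF P_proj[OF b] w] by blast
    show "AE x in M. \<exists>n. 0 < (\<Sum>i<n. (P ^^ i) h w x)"
      using 1 AE_space
    proof eventually_elim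
      case (elim x)
      have "\<exists>\<^sub>F N in sequentially. mean f N w x > proj f w x - e / s"
        unfolding proj_def
        by (rule rlimsup_frequently_greater[OF bndD(2)[OF bnd_mean[OF b] w elim(2)]]) (use e s in simp)
      then obtain N where N: "mean f N w x > proj f w x - e / s" "N > 0"
        using frequently_sequentially[of "\<lambda>N. mean f N w x > proj f w x - e / s"]
        by (metis Suc_le_eq)
      have "(\<Sum>i<N. (P ^^ i) h w x) = (\<Sum>i<N. (P ^^ i) f w x) - real N * proj f w x + real N * (e / s)"
        using elim(1) by (simp add: hn funpow_const[OF w elim(2)] sum.distrib sum_subtractf)
      also have "\<dots> = real N * (mean f N w x - proj f w x + e / s)"
        using N(2) by (simp add: mean_def cesaro_mean_def distrib_left right_diff_distrib)
      also have "\<dots> > 0" using N by simp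
      finally show ?case by blast
    qed
  qed
  also have "I h = I f - I (proj f) + I (\<lambda>w x. e / s)"
    unfolding h_def[abs_def] by (simp add: I_add[OF bd bnd_const] I_diff[OF b bnd_proj[OF b]])
  also have "I (\<lambda>w x. e / s) \<le> e"
  proof -
    have "I (\<lambda>w x. e / s) = (s - 1) * (e / s)"
      by (simp add: I_def prob_space s_def sum_divide_distrib sum_distrib_right)
    also have "\<dots> \<le> s * (e / s)" using e s by (intro mult_right_mono) auto
    finally show ?thesis using s by simp
  qed
  finally show "I (proj f) \<le> I f + e" by simp
qed

text \<open>With \<open>I_proj_le\<close> for \<open>f\<close> and for \<open>- f\<close>, the
  oscillation of the averages is nonnegative and has integral at most \<open>I f - I f\<close>, so
  it is zero almost everywhere.\<close>

theorem hopf_ergodic_theorem: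
  assumes b: "bnd f K"
  shows "w \<in> C \<Longrightarrow> AE x in M. (\<lambda>N. mean f N w x) \<longlonglongrightarrow> proj f w x"
    and "I (proj f) = I f"
proof -
  have b': "bnd (\<lambda>w x. - f w x) K" using bnd_scale[OF b, of "-1"] by simp
  have neg: "(P ^^ n) (\<lambda>w x. - f w x) = (\<lambda>w x. - (P ^^ n) f w x)" for n
    by (induction n) (simp_all add: P_def sum_negf)
  have mneg: "mean (\<lambda>w x. - f w x) N w x = - mean f N w x" for N w x
    by (simp add: mean_def cesaro_mean_def neg sum_negf)
  have p: "I (proj f) \<le> I f" by (rule I_proj_le[OF b])
  have n: "I (proj (\<lambda>w x. - f w x)) \<le> - I f"
    using I_proj_le[OF b'] I_scale[of "-1" f] by simp
  have nn: "0 \<le> proj f w x + proj (\<lambda>w x. - f w x) w x" if "w \<in> C" "x \<in> space M" for w x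
    unfolding proj_def mneg by (rule rlimsup_uminus_ge[OF bndD(2)[OF bnd_mean[OF b] that]])
  have bs: "bnd (\<lambda>w x. proj f w x + proj (\<lambda>w x. - f w x) w x) (K + K)"
    by (intro bnd_add bnd_proj b b')
  have Is: "I (\<lambda>w x. proj f w x + proj (\<lambda>w x. - f w x) w x) = I (proj f) + I (proj (\<lambda>w x. - f w x))"
    by (rule I_add[OF bnd_proj[OF b] bnd_proj[OF b']])
  have z: "AE x in M. proj f w x + proj (\<lambda>w x. - f w x) w x = 0" if "w \<in> C" for w
    by (rule I_nonneg_zero[OF bs _ _ that]) (use nn Is p n in auto)
  show "AE x in M. (\<lambda>N. mean f N w x) \<longlonglongrightarrow> proj f w x" if w: "w \<in> C"
    using z[OF w] AE_space
  proof eventually_elim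
    case (elim x)
    show ?case unfolding proj_def
      by (rule rlimsup_tendsto[OF bndD(2)[OF bnd_mean[OF b] w elim(2)]])
        (use elim(1) in \<open>simp add: proj_def mneg\<close>)
  qed
  have "0 \<le> I (\<lambda>w x. proj f w x + proj (\<lambda>w x. - f w x) w x)"
  proof -
    have "I (\<lambda>w x. 0) \<le> I (\<lambda>w x. proj f w x + proj (\<lambda>w x. - f w x) w x)"
      by (rule I_mono[OF bnd_const bs]) (use nn in auto)
    then show ?thesis by (simp add: I_def)
  qed
  with p n Is show "I (proj f) = I f" by simp
qed

end

section \<open>Convolutions with powers of a Markov operator\<close>

text \<open>The binomial expansion of \<open>(N - m) ^ j\<close> reduces the reversed weights to the
  weights \<open>m ^ i\<close>; the factors \<open>N ^ (j - i)\<close> supply exactly the missing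
  normalisation.\<close>

lemma convergent_reversed_power_weighted_sum:
  fixes x :: "nat \<Rightarrow> real"
  assumes "convergent (cesaro_mean x)"
  shows "convergent (\<lambda>N. (\<Sum>m<N. real (N - m) ^ j * x m) / real N ^ Suc j)"
proof -
  have "convergent (\<lambda>N. \<Sum>i\<le>j. real (j choose i) * (-1) ^ i * ((\<Sum>m<N. real m ^ i * x m) / real N ^ Suc i))"
    by (intro convergent_sum convergent_mult convergent_const convergent_power_weighted_sum assms)
  then obtain L where L: "(\<lambda>N. \<Sum>i\<le>j. real (j choose i) * (-1) ^ i * ((\<Sum>m<N. real m ^ i * x m) / real N ^ Suc i)) \<longlonglongrightarrow> L"
    by (auto simp: convergent_def)
  have "\<forall>\<^sub>F N in sequentially. (\<Sum>i\<le>j. real (j choose i) * (-1) ^ i * ((\<Sum>m<N. real m ^ i * x m) / real N ^ Suc i))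
     = (\<Sum>m<N. real (N - m) ^ j * x m) / real N ^ Suc j"
    using eventually_gt_at_top[of 0]
  proof eventually_elim
    case (elim N)
    have "(\<Sum>m<N. real (N - m) ^ j * x m) = (\<Sum>m<N. \<Sum>i\<le>j. real (j choose i) * (-1) ^ i * (real m ^ i * x m) * real N ^ (j - i))"
    proof (intro sum.cong refl)
      fix m assume m: "m \<in> {..<N}"
      then have "real (N - m) ^ j = (- real m + real N) ^ j" by (simp add: of_nat_diff)
      also have "\<dots> = (\<Sum>i\<le>j. real (j choose i) * (- real m) ^ i * real N ^ (j - i))" by (rule binomial_ring)
      finally show "real (N - m) ^ j * x m = (\<Sum>i\<le>j. real (j choose i) * (-1) ^ i * (real m ^ i * x m) * real N ^ (j - i))"
        by (simp add: sum_distrib_right sum_distrib_left power_minus[of "real m"] mult_ac)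
    qed
    also have "\<dots> = (\<Sum>i\<le>j. real (j choose i) * (-1) ^ i * (\<Sum>m<N. real m ^ i * x m) * real N ^ (j - i))"
      by (subst sum.swap) (simp add: sum_distrib_left sum_distrib_right)
    also have "\<dots> / real N ^ Suc j = (\<Sum>i\<le>j. real (j choose i) * (-1) ^ i * ((\<Sum>m<N. real m ^ i * x m) / real N ^ Suc i))"
    proof (subst sum_divide_distrib, intro sum.cong refl)
      fix i assume "i \<in> {..j}"
      then have "real N ^ Suc j = real N ^ (j - i) * real N ^ Suc i" by (simp flip: power_add)
      then show "real (j choose i) * (-1) ^ i * (\<Sum>m<N. real m ^ i * x m) * real N ^ (j - i) / real N ^ Suc j
         = real (j choose i) * (-1) ^ i * ((\<Sum>m<N. real m ^ i * x m) / real N ^ Suc i)"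
        using elim by simp
    qed
    finally show ?case by simp
  qed
  with L have "(\<lambda>N. (\<Sum>m<N. real (N - m) ^ j * x m) / real N ^ Suc j) \<longlonglongrightarrow> L"
    by (rule Lim_transform_eventually)
  then show ?thesis by (rule convergentI)
qed

text \<open>The converse of \<open>convergent_cesaro_mean_power_divide\<close>; it feeds the Cesaro
  information about an input into statements on its partial sums.\<close>

lemma convergent_sum_of_cesaro_mean_power:
  fixes y :: "nat \<Rightarrow> real"
  assumes "convergent (cesaro_mean (\<lambda>n. y n / real n ^ k))"
  shows "convergent (\<lambda>N. (\<Sum>n<N. y n) / real N ^ Suc k)"
proof -
  define d where "d = y 0 - 0 ^ k * (y 0 / 0 ^ k)"
  have s: "(\<Sum>n<N. y n) = (\<Sum>n<N. real n ^ k * (y n / real n ^ k)) + (if N = 0 then 0 else d)" for N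
  proof (induction N)
    case (Suc N)
    then show ?case by (cases "N = 0") (auto simp: d_def)
  qed simp
  obtain L where L: "(\<lambda>N. (\<Sum>n<N. real n ^ k * (y n / real n ^ k)) / real N ^ Suc k) \<longlonglongrightarrow> L"
    using convergent_power_weighted_sum[OF assms, of k] unfolding convergent_def by blast
  have "(\<lambda>N. (\<Sum>n<N. real n ^ k * (y n / real n ^ k)) / real N ^ Suc k + d * (1 / real N) ^ Suc k) \<longlonglongrightarrow> L + d * 0 ^ Suc k"
    by (intro tendsto_intros L lim_1_over_n)
  moreover have "\<forall>\<^sub>F N in sequentially. (\<Sum>n<N. real n ^ k * (y n / real n ^ k)) / real N ^ Suc k + d * (1 / real N) ^ Suc k
      = (\<Sum>n<N. y n) / real N ^ Suc k"
    using eventually_gt_at_top[of 0] by eventually_elim (subst s, simp add: add_divide_distrib power_divide)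
  ultimately have "(\<lambda>N. (\<Sum>n<N. y n) / real N ^ Suc k) \<longlonglongrightarrow> L + d * 0 ^ Suc k"
    by (rule Lim_transform_eventually)
  then show ?thesis by (rule convergentI)
qed

context markov_op
begin

lemma funpow_plus: "(P ^^ n) (\<lambda>w x. f w x + g w x) = (\<lambda>w x. (P ^^ n) f w x + (P ^^ n) g w x)"
  by (induction n) (simp_all add: P_add)

lemma funpow_scale: "(P ^^ n) (\<lambda>w x. c * f w x) = (\<lambda>w x. c * (P ^^ n) f w x)"
  by (induction n) (simp_all add: P_scale)

lemma funpow_mono:
  assumes "\<And>v x. v \<in> C \<Longrightarrow> x \<in> space M \<Longrightarrow> f v x \<le> g v x" "w \<in> C" "x \<in> space M"
  shows "(P ^^ n) f w x \<le> (P ^^ n) g w x"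
  using assms(2,3)
proof (induction n arbitrary: w x)
  case (Suc n)
  then show ?case by (auto intro: P_mono)
qed (use assms(1) in simp)

lemma abs_funpow_le:
  assumes "\<And>v x. v \<in> C \<Longrightarrow> x \<in> space M \<Longrightarrow> \<bar>f v x\<bar> \<le> g v x" "w \<in> C" "x \<in> space M"
  shows "\<bar>(P ^^ n) f w x\<bar> \<le> (P ^^ n) g w x"
proof -
  have "(P ^^ n) f w x \<le> (P ^^ n) g w x" by (rule funpow_mono) (use assms abs_le_D1 in blast)+
  moreover have "(P ^^ n) (\<lambda>w x. (-1) * f w x) w x \<le> (P ^^ n) g w x"
    by (rule funpow_mono) (use assms abs_le_D2 in auto)
  ultimately show ?thesis unfolding funpow_scale by simp
qed

text \<open>A Maker-type ergodic theorem: the function under \<open>P ^^ m\<close> varies with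
  \<open>N - m\<close>. Replacing \<open>Z n / n ^ j\<close> by its limit \<open>\<psi>\<close>
  gives a main term, settled by Hopf's theorem with reversed weights. Convergence to
  \<open>\<psi>\<close> is not uniform, so the error is bounded by ergodic averages of tail
  suprema.\<close>

lemma convolution_convergent:
  assumes bZ: "\<And>n. bnd (Z n) (K * real n ^ j)" and K0: "0 \<le> K"
    and conv: "\<And>w. w \<in> C \<Longrightarrow> AE x in M. convergent (\<lambda>n. Z n w x / real n ^ j)"
    and w: "w \<in> C"
  shows "AE x in M. convergent (\<lambda>N. (\<Sum>m<N. (P ^^ m) (Z (N - m)) w x) / real N ^ Suc j)"
proof -
  interpret prob_space M by (rule prob)
  define z where "z n w x = Z n w x / real n ^ j" for n w x
  have bz: "bnd (z n) K" for n
  proof (rule bndI)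
    show "z n w \<in> borel_measurable M" if "w \<in> C" for w
      unfolding z_def[abs_def] by (intro borel_measurable_divide borel_measurable_const bndD(1)[OF bZ that])
    show "\<bar>z n w x\<bar> \<le> K" if "w \<in> C" "x \<in> space M" for w x
      unfolding z_def using bndD(2)[OF bZ that, of n] K0 by (intro abs_quotient_le) auto
  qed
  define \<psi> where "\<psi> w x = rlimsup (\<lambda>n. z n w x)" for w x
  have b\<psi>: "bnd \<psi> K" unfolding \<psi>_def[abs_def] by (rule bnd_rlimsup[OF bz])
  have lim: "AE x in M. (\<lambda>n. z n w x) \<longlonglongrightarrow> \<psi> w x" if "w \<in> C" for w
    using conv[OF that] AE_space
  proof eventually_elim
    case (elim x)
    then obtain L where L: "(\<lambda>n. z n w x) \<longlonglongrightarrow> L" by (auto simp: convergent_def z_def)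
    have "\<psi> w x = L" unfolding \<psi>_def by (rule rlimsup_tendsto_eq[OF _ L]) (rule bndD(2)[OF bz that elim(2)])
    with L show ?case by simp
  qed
  have be: "bnd (\<lambda>w x. z n w x - \<psi> w x) (K + K)" for n by (intro bnd_diff bz b\<psi>)
  \<comment> \<open>The tail supremum bounds the distance to \<open>\<psi>\<close> for all
    \<open>n \<ge> k\<close> by one function, which can be averaged and which tends to 0 almost
    everywhere as \<open>k\<close> grows.\<close>
  define r where "r k w x = (SUP n. \<bar>z (k + n) w x - \<psi> w x\<bar>)" for k :: nat and w x
  have bdd: "bdd_above (range (\<lambda>n. \<bar>z (k + n) w x - \<psi> w x\<bar>))" if "w \<in> C" "x \<in> space M" for k w x
    by (rule bdd_aboveI[of _ "K + K"]) (use bndD(2)[OF be that] in auto)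
  have rge: "\<bar>z n w x - \<psi> w x\<bar> \<le> r k w x" if "w \<in> C" "x \<in> space M" "k \<le> n" for k n w x
  proof -
    have "\<bar>z (k + (n - k)) w x - \<psi> w x\<bar> \<le> r k w x" unfolding r_def
      by (rule cSUP_upper[OF UNIV_I bdd[OF that(1,2)]])
    then show ?thesis using that(3) by simp
  qed
  have rnn: "0 \<le> r k w x" if "w \<in> C" "x \<in> space M" for k w x
    using rge[OF that order_refl] abs_ge_zero order_trans by blast
  have br: "bnd (r k) (K + K)" for k
  proof (rule bndI)
    show "r k w \<in> borel_measurable M" if "w \<in> C" for w
      unfolding r_def[abs_def]
      by (intro borel_measurable_cSUP borel_measurable_abs bndD(1)[OF be that] bdd that) auto
    show "\<bar>r k w x\<bar> \<le> K + K" if "w \<in> C" "x \<in> space M" for w x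
    proof -
      have "r k w x \<le> K + K" unfolding r_def by (rule cSUP_least) (use bndD(2)[OF be that] in auto)
      then show ?thesis using rnn[OF that, of k] by simp
    qed
  qed
  define err where "err N w x = (\<Sum>m<N. (P ^^ m) (\<lambda>w x. real (N - m) ^ j * (z (N - m) w x - \<psi> w x)) w x) / real N ^ Suc j" for N w x
  \<comment> \<open>For \<open>N - m \<ge> k\<close> the difference is dominated by
    \<open>r k\<close>; each of the at most \<open>k\<close> other indices costs
    \<open>2 * K\<close>.\<close>
  have err_le: "\<bar>err N w x\<bar> \<le> mean (r k) N w x + (2 * K * real k) / real N"
    if "w \<in> C" "x \<in> space M" for N k w x
  proof (cases "N = 0")
    case True then show ?thesis by (simp add: err_def mean_def cesaro_mean_def)
  next
    case False
    have t: "\<bar>(P ^^ m) (\<lambda>w x. real (N - m) ^ j * (z (N - m) w x - \<psi> w x)) w x\<bar>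
       \<le> real N ^ j * ((P ^^ m) (r k) w x + (if N < m + k then 2 * K else 0))" for m
    proof -
      have "\<bar>(P ^^ m) (\<lambda>w x. real (N - m) ^ j * (z (N - m) w x - \<psi> w x)) w x\<bar>
        \<le> (P ^^ m) (\<lambda>w x. real N ^ j * (r k w x + (if N < m + k then 2 * K else 0))) w x"
      proof (rule abs_funpow_le[OF _ that])
        fix v y assume v: "v \<in> C" "y \<in> space M"
        have "\<bar>z (N - m) v y - \<psi> v y\<bar> \<le> r k v y + (if N < m + k then 2 * K else 0)"
        proof (cases "N < m + k")
          case True then show ?thesis using bndD(2)[OF be v, of "N - m"] rnn[OF v, of k] by simp
        next
          case False then show ?thesis using rge[OF v, of k "N - m"] by simp
        qed
        then show "\<bar>real (N - m) ^ j * (z (N - m) v y - \<psi> v y)\<bar> \<le> real N ^ j * (r k v y + (if N < m + k then 2 * K else 0))"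
          unfolding abs_mult by (intro mult_mono) (auto intro!: power_mono)
      qed
      also have "\<dots> = real N ^ j * ((P ^^ m) (r k) w x + (if N < m + k then 2 * K else 0))"
        by (simp only: funpow_scale funpow_plus funpow_const[OF that])
      finally show ?thesis .
    qed
    have "\<bar>\<Sum>m<N. (P ^^ m) (\<lambda>w x. real (N - m) ^ j * (z (N - m) w x - \<psi> w x)) w x\<bar>
      \<le> (\<Sum>m<N. real N ^ j * ((P ^^ m) (r k) w x + (if N < m + k then 2 * K else 0)))"
      by (rule order_trans[OF sum_abs sum_mono[OF t]])
    also have "\<dots> = real N ^ j * ((\<Sum>m<N. (P ^^ m) (r k) w x) + (\<Sum>m<N. if N < m + k then 2 * K else 0))"
      by (simp only: sum.distrib sum_distrib_left[symmetric])
    also have "(\<Sum>m<N. if N < m + k then 2 * K else 0) \<le> 2 * K * real k"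
    proof -
      have "(\<Sum>m<N. if N < m + k then 2 * K else 0) = real (card {m\<in>{..<N}. N < m + k}) * (2 * K)"
        by (simp add: sum.If_cases Int_def)
      moreover have "card {m\<in>{..<N}. N < m + k} \<le> card {N - k..<N}"
        by (rule card_mono) auto
      then have "real (card {m\<in>{..<N}. N < m + k}) \<le> real k" by simp
      ultimately show ?thesis using K0 mult_right_mono[of "real (card {m\<in>{..<N}. N < m + k})" "real k" "2 * K"] by (simp add: mult_ac)
    qed
    finally have "\<bar>\<Sum>m<N. (P ^^ m) (\<lambda>w x. real (N - m) ^ j * (z (N - m) w x - \<psi> w x)) w x\<bar>
       \<le> real N ^ j * ((\<Sum>m<N. (P ^^ m) (r k) w x) + 2 * K * real k)" by (simp add: mult_left_mono)
    then have "\<bar>err N w x\<bar> \<le> real N ^ j * ((\<Sum>m<N. (P ^^ m) (r k) w x) + 2 * K * real k) / real N ^ Suc j"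
      unfolding err_def abs_divide abs_of_nonneg[OF zero_le_power[OF of_nat_0_le_iff]]
      by (rule divide_right_mono) simp
    also have "\<dots> = mean (r k) N w x + (2 * K * real k) / real N"
      using False by (simp add: mean_def cesaro_mean_def add_divide_distrib)
    finally show ?thesis .
  qed
  have errb: "\<bar>err N w x\<bar> \<le> K + K" if "w \<in> C" "x \<in> space M" for N w x
    using err_le[OF that, of N 0] bndD(2)[OF bnd_mean[OF br] that, of 0 N] by simp
  have berr: "bnd (err N) (K + K)" for N
  proof (rule bndI[OF _ errb])
    fix w assume "w \<in> C"
    show "err N w \<in> borel_measurable M" unfolding err_def[abs_def]
      by (intro borel_measurable_divide borel_measurable_const borel_measurable_sum
          bndD(1)[OF bnd_funpow[OF bnd_scale[OF be]] \<open>w \<in> C\<close>])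
  qed
  define L where "L w x = rlimsup (\<lambda>N. \<bar>err N w x\<bar>)" for w x
  have bL: "bnd L (K + K)" unfolding L_def[abs_def]
    by (rule bnd_rlimsup) (use berr in \<open>auto simp: bnd_def intro!: borel_measurable_abs\<close>)
  have Lnn: "0 \<le> L w x" if "w \<in> C" "x \<in> space M" for w x
  proof (rule ccontr)
    assume "\<not> 0 \<le> L w x"
    then have "\<forall>\<^sub>F N in sequentially. \<bar>err N w x\<bar> < L w x + (- L w x)"
      unfolding L_def by (intro rlimsup_eventually_less[where K="K+K"]) (use errb[OF that] in auto)
    then show False by (auto simp: eventually_sequentially)
  qed
  have Lle: "L w x \<le> proj (r k) w x" if "w \<in> C" "x \<in> space M" for w x k
  proof (rule field_le_epsilon)
    fix e :: real assume e: "e > 0"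
    have "\<forall>\<^sub>F N in sequentially. mean (r k) N w x < proj (r k) w x + e / 2"
      unfolding proj_def by (rule rlimsup_eventually_less[OF bndD(2)[OF bnd_mean[OF br] that]]) (use e in simp)
    moreover have "(\<lambda>N. (2 * K * real k) / real N) \<longlonglongrightarrow> 0" by real_asymp
    then have "\<forall>\<^sub>F N in sequentially. (2 * K * real k) / real N < e / 2"
      by (rule order_tendstoD) (use e in simp)
    ultimately have "\<forall>\<^sub>F N in sequentially. \<bar>err N w x\<bar> \<le> proj (r k) w x + e"
    proof eventually_elim
      case (elim N) then show ?case using err_le[OF that, of N k] by linarith
    qed
    then show "L w x \<le> proj (r k) w x + e" unfolding L_def
      by (intro rlimsup_le[where K="K+K"]) (use errb[OF that] in auto)
  qed
  \<comment> \<open>Hopf's theorem preserves the integral, so \<open>proj (r k)\<close> has the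
    integral of \<open>r k\<close>. These integrals tend to 0 by dominated convergence, while
    \<open>L\<close> does not depend on \<open>k\<close>.\<close>
  have ILr: "I L \<le> I (r k)" for k
    using I_mono[OF bL bnd_proj[OF br[of k]]] Lle hopf_ergodic_theorem(2)[OF br[of k]] by simp
  have "(\<lambda>k. I (r k)) \<longlonglongrightarrow> (\<Sum>w\<in>C. m w * (\<integral>x. 0 \<partial>M))"
    unfolding I_def
  proof (intro tendsto_sum tendsto_mult tendsto_const integral_dominated_convergence[where w="\<lambda>_. K + K"])
    fix w assume w: "w \<in> C"
    show "r k w \<in> borel_measurable M" for k using bndD(1)[OF br w] .
    show "AE x in M. norm (r k w x) \<le> K + K" for k using bndD(2)[OF br w] by auto
    show "AE x in M. (\<lambda>k. r k w x) \<longlonglongrightarrow> 0"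
      using lim[OF w] AE_space
    proof eventually_elim
      case (elim x)
      show ?case
      proof (rule LIMSEQ_I)
        fix e :: real assume e: "e > 0"
        obtain k where k: "\<And>n. n \<ge> k \<Longrightarrow> \<bar>z n w x - \<psi> w x\<bar> < e / 2"
          using LIMSEQ_D[OF elim(1), of "e/2"] e by auto
        have "r i w x \<le> e / 2" if "i \<ge> k" for i unfolding r_def
          by (rule cSUP_least, simp, rule less_imp_le[OF k]) (use that in simp)
        then have "norm (r i w x - 0) < e" if "i \<ge> k" for i
          using rnn[OF w elim(2), of i] e that by force
        then show "\<exists>no. \<forall>n\<ge>no. norm (r n w x - 0) < e" by blast
      qed
    qed
  qed simp_all
  then have "I L \<le> 0" using LIMSEQ_le_const[of "\<lambda>k. I (r k)" 0 "I L"] ILr by simp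
  then have "AE x in M. L w x = 0" by (intro I_nonneg_zero[OF bL _ _ w]) (use Lnn in auto)
  then have errlim: "AE x in M. (\<lambda>N. err N w x) \<longlonglongrightarrow> 0"
    using AE_space
  proof eventually_elim
    case (elim x)
    show ?case
    proof (rule LIMSEQ_I)
      fix e :: real assume e: "e > 0"
      have "\<forall>\<^sub>F N in sequentially. \<bar>err N w x\<bar> < L w x + e"
        unfolding L_def by (rule rlimsup_eventually_less[where K="K+K"]) (use errb[OF w elim(2)] e in auto)
      then show "\<exists>no. \<forall>n\<ge>no. norm (err n w x - 0) < e" using elim(1) by (simp add: eventually_sequentially)
    qed
  qed
  show ?thesis
    using errlim hopf_ergodic_theorem(1)[OF b\<psi> w] AE_space
  proof eventually_elim
    case (elim x)
    have "convergent (cesaro_mean (\<lambda>n. (P ^^ n) \<psi> w x))"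
      using convergentI[OF elim(2)] by (simp add: mean_def)
    then have "convergent (\<lambda>N. (\<Sum>m<N. real (N - m) ^ j * (P ^^ m) \<psi> w x) / real N ^ Suc j)"
      by (rule convergent_reversed_power_weighted_sum)
    then have "convergent (\<lambda>N. err N w x + (\<Sum>m<N. real (N - m) ^ j * (P ^^ m) \<psi> w x) / real N ^ Suc j)"
      using convergentI[OF elim(1)] by (intro convergent_add)
    also have "(\<lambda>N. err N w x + (\<Sum>m<N. real (N - m) ^ j * (P ^^ m) \<psi> w x) / real N ^ Suc j)
      = (\<lambda>N. (\<Sum>m<N. (P ^^ m) (Z (N - m)) w x) / real N ^ Suc j)"
    proof (rule ext)
      fix N
      have "(P ^^ m) (Z (N - m)) w x = (P ^^ m) (\<lambda>w x. real (N - m) ^ j * (z (N - m) w x - \<psi> w x)) w x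
         + real (N - m) ^ j * (P ^^ m) \<psi> w x" if "m < N" for m
      proof -
        have "Z (N - m) = (\<lambda>w x. real (N - m) ^ j * (z (N - m) w x - \<psi> w x) + real (N - m) ^ j * \<psi> w x)"
          using that by (auto simp: z_def fun_eq_iff right_diff_distrib)
        then have "(P ^^ m) (Z (N - m)) = (P ^^ m) (\<lambda>w x. real (N - m) ^ j * (z (N - m) w x - \<psi> w x) + real (N - m) ^ j * \<psi> w x)"
          by simp
        then show ?thesis by (simp only: funpow_plus funpow_scale[of _ _ \<psi>])
      qed
      then show "err N w x + (\<Sum>m<N. real (N - m) ^ j * (P ^^ m) \<psi> w x) / real N ^ Suc j
        = (\<Sum>m<N. (P ^^ m) (Z (N - m)) w x) / real N ^ Suc j"
        by (simp add: err_def add_divide_distrib[symmetric] sum.distrib[symmetric])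
    qed
    finally show ?case .
  qed
qed

text \<open>The limit of \<open>a (N + 1) - k * P (a N)\<close> enters the upper limits of
  \<open>a\<close> and of \<open>- a\<close> with opposite signs and cancels in the oscillation
  \<open>D\<close>. Integration of \<open>D \<le> k * P D\<close> against the invariant measure then
  leaves \<open>(1 - k) * I D \<le> 0\<close>.\<close>

lemma contraction_convergent:
  assumes b: "\<And>N. bnd (a N) K" and k: "0 \<le> k" "k < 1"
    and conv: "\<And>w. w \<in> C \<Longrightarrow> AE x in M. convergent (\<lambda>N. a (N + 1) w x - k * P (a N) w x)"
    and w: "w \<in> C"
  shows "AE x in M. convergent (\<lambda>N. a N w x)"
proof -
  have b': "bnd (\<lambda>w x. - a N w x) K" for N using bnd_scale[OF b[of N], of "-1"] by simp
  have neg: "P (\<lambda>w x. - a N w x) w x = - P (a N) w x" for N w x by (simp add: P_def sum_negf)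
  define D where "D w x = rlimsup (\<lambda>N. a N w x) + rlimsup (\<lambda>N. - a N w x)" for w x
  have bD: "bnd D (K + K)" unfolding D_def[abs_def] by (intro bnd_add bnd_rlimsup b b')
  have Dnn: "0 \<le> D w x" if "w \<in> C" "x \<in> space M" for w x
    unfolding D_def by (rule rlimsup_uminus_ge[OF bndD(2)[OF b that]])
  have "AE x in M. D w x \<le> k * P D w x" if w: "w \<in> C" for w
    using conv[OF w] AE_space
  proof eventually_elim
    case (elim x)
    then obtain L where L: "(\<lambda>N. a (N + 1) w x - k * P (a N) w x) \<longlonglongrightarrow> L" by (auto simp: convergent_def)
    have 1: "rlimsup (\<lambda>N. a N w x) \<le> k * P (\<lambda>w x. rlimsup (\<lambda>N. a N w x)) w x + L"
      by (rule rlimsup_le_P_rlimsup[OF b w elim(2) k(1) _ L, where s=1]) simp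
    have 2: "rlimsup (\<lambda>N. - a N w x) \<le> k * P (\<lambda>w x. rlimsup (\<lambda>N. - a N w x)) w x + - L"
      by (rule rlimsup_le_P_rlimsup[OF b' w elim(2) k(1) _ tendsto_minus[OF L], where s=1]) (simp add: neg)
    have "P D w x = P (\<lambda>w x. rlimsup (\<lambda>N. a N w x)) w x + P (\<lambda>w x. rlimsup (\<lambda>N. - a N w x)) w x"
      unfolding D_def[abs_def] by (simp add: P_add)
    then show ?case using 1 2 by (simp add: D_def distrib_left)
  qed
  then have "I D \<le> I (\<lambda>w x. k * P D w x)" by (rule I_mono[OF bD bnd_scale[OF bnd_P[OF bD]]])
  also have "\<dots> = k * I D" by (simp add: I_scale I_P[OF bD])
  finally have "(1 - k) * I D \<le> 0" by (simp add: algebra_simps)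
  then have "I D \<le> 0" using k by (simp add: mult_le_0_iff)
  then have "AE x in M. D w x = 0" by (intro I_nonneg_zero[OF bD _ _ w]) (use Dnn in auto)
  then show ?thesis using AE_space
  proof eventually_elim
    case (elim x)
    show ?case
      by (rule convergentI[OF rlimsup_tendsto[OF bndD(2)[OF b w elim(2)]]]) (use elim(1) in \<open>simp add: D_def\<close>)
  qed
qed

end

section \<open>Markov operators satisfying a Doeblin condition\<close>

text \<open>\<open>F / b\<close> is \<open>F\<close> over the explicit scale times the inverse of
  \<open>b\<close> over that scale, and the second factor converges because
  \<open>c > 0\<close>.\<close>

lemma cesaro_regular_of_scale:
  assumes nn: "\<And>n. 0 \<le> b n" and meas: "\<And>n. F n \<in> borel_measurable M"
    and le: "\<And>n x. x \<in> space M \<Longrightarrow> \<bar>F n x\<bar> \<le> K * b n" and K0: "0 \<le> K"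
    and a: "0 < a" and c: "0 < c" and lim: "(\<lambda>n. b n / (a ^ n * real n ^ k)) \<longlonglongrightarrow> c"
    and conv: "AE x in M. convergent (cesaro_mean (\<lambda>n. F n x / (a ^ n * real n ^ k)))"
  shows "cesaro_regular M b F"
proof (rule cesaro_regularI[OF nn _ meas le])
  show "exp_poly_growth b" unfolding exp_poly_growth_def using a c lim by blast
  let ?s = "\<lambda>n. a ^ n * real n ^ k"
  obtain B where B: "\<And>n. \<bar>b n / ?s n\<bar> \<le> B"
    using convergent_imp_Bseq[OF convergentI[OF lim]] unfolding Bseq_def by auto
  show "AE x in M. convergent (cesaro_mean (\<lambda>n. F n x / b n))"
    using conv AE_space
  proof eventually_elim
    case (elim x)
    have "\<bar>F n x / ?s n\<bar> \<le> K * B" for n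
    proof -
      have "\<bar>F n x / ?s n\<bar> \<le> K * b n / \<bar>?s n\<bar>" using le[OF elim(2)] by (simp only: abs_divide) (simp add: divide_right_mono)
      also have "\<dots> = K * \<bar>b n / ?s n\<bar>" using nn by simp
      also have "\<dots> \<le> K * B" using B K0 by (rule mult_left_mono)
      finally show ?thesis .
    qed
    moreover have "(\<lambda>n. inverse (b n / ?s n)) \<longlonglongrightarrow> inverse c" using lim c by (intro tendsto_inverse) auto
    ultimately have "convergent (cesaro_mean (\<lambda>n. F n x / ?s n * inverse (b n / ?s n)))"
      using elim(1) by (intro convergent_cesaro_mean_mult)
    \<comment> \<open>The scale cancels only where it is nonzero, which may fail at
      \<open>n = 0\<close>; hence the shift.\<close>
    then have "convergent (cesaro_mean (\<lambda>n. F (Suc n) x / ?s (Suc n) * inverse (b (Suc n) / ?s (Suc n))))"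
      by (simp only: convergent_cesaro_mean_Suc_iff[of "\<lambda>n. F n x / ?s n * inverse (b n / ?s n)"])
    moreover have "F (Suc n) x / ?s (Suc n) * inverse (b (Suc n) / ?s (Suc n)) = F (Suc n) x / b (Suc n)" for n
      using a by simp
    ultimately have "convergent (cesaro_mean (\<lambda>n. F (Suc n) x / b (Suc n)))" by (simp only:)
    then show ?case by (simp only: convergent_cesaro_mean_Suc_iff[of "\<lambda>n. F n x / b n"])
  qed
qed

text \<open>Puts several inputs on the common scale of a majorant \<open>\<Gamma>\<close>, later
  their sum. An input of smaller order than \<open>\<Gamma>\<close> gets
  \<open>c' = 0\<close>.\<close>

lemma cesaro_regular_scaled:
  assumes reg: "cesaro_regular M b F" and le: "\<And>n. b n \<le> \<Gamma> n"
    and a: "0 < a" and c: "0 < c" and lim: "(\<lambda>n. \<Gamma> n / (a ^ n * real n ^ k)) \<longlonglongrightarrow> c"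
  obtains c' where "0 \<le> c'" "(\<lambda>n. b n / (a ^ n * real n ^ k)) \<longlonglongrightarrow> c'"
    "AE x in M. convergent (cesaro_mean (\<lambda>n. F n x / (a ^ n * real n ^ k)))"
proof -
  obtain K where K: "K \<ge> 0" "\<And>n. 0 \<le> b n" "exp_poly_growth b" "\<And>n. F n \<in> borel_measurable M"
    "\<And>n x. x \<in> space M \<Longrightarrow> \<bar>F n x\<bar> \<le> K * b n"
    "AE x in M. convergent (cesaro_mean (\<lambda>n. F n x / b n))" by (rule cesaro_regularE[OF reg]) blast
  have g: "exp_poly_growth \<Gamma>" unfolding exp_poly_growth_def using a c lim by blast
  obtain q where q: "(\<lambda>n. b n / \<Gamma> n) \<longlonglongrightarrow> q"
    using exp_poly_growth_ratio[OF K(3) g K(2) order_trans[OF K(2) le], of 1] le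
    by (auto simp: convergent_def)
  let ?s = "\<lambda>n. a ^ n * real n ^ k"
  have eq: "b n / \<Gamma> n * (\<Gamma> n / ?s n) = b n / ?s n" for n
    using K(2)[of n] le[of n] by (cases "\<Gamma> n = 0") auto
  have lim': "(\<lambda>n. b n / ?s n) \<longlonglongrightarrow> q * c" using tendsto_mult[OF q lim] by (simp only: eq)
  have "0 \<le> b n / ?s n" for n using K(2) a by (simp add: less_imp_le)
  then have "0 \<le> q * c" using lim' by (meson LIMSEQ_le_const)
  moreover have "AE x in M. convergent (cesaro_mean (\<lambda>n. F n x / ?s n))"
    using K(6) AE_space
  proof eventually_elim
    case (elim x)
    have "convergent (cesaro_mean (\<lambda>n. F n x / b n * (b n / ?s n)))"
      by (rule convergent_cesaro_mean_mult[OF elim(1) _ lim', where K=K])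
        (use K(1,2) K(5)[OF elim(2)] in \<open>intro abs_quotient_le, auto\<close>)
    moreover have "F n x / b n * (b n / ?s n) = F n x / ?s n" for n
      using K(5)[OF elim(2), of n] by (cases "b n = 0") auto
    ultimately show ?case by (simp only:)
  qed
  ultimately show ?thesis using that lim' by blast
qed

text \<open>Minorisation: after \<open>q\<close> steps every vertex carries at least the fraction
  \<open>\<delta>\<close> of the stationary mean of a nonnegative function. It makes the values at
  all vertices follow this mean.\<close>

locale doeblin_op = markov_op M C E src tgt \<tau> p m
  for M :: "'x measure" and C :: "'v set" and E :: "'e set"
    and src tgt :: "'e \<Rightarrow> 'v" and \<tau> :: "'e \<Rightarrow> 'x \<Rightarrow> 'x" and p :: "'e \<Rightarrow> real" and m :: "'v \<Rightarrow> real" +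
  fixes q :: nat and \<delta> :: real
  assumes sum_m: "sum m C = 1" and \<delta>_pos: "0 < \<delta>"
    and doeblin: "\<And>f w. (\<And>v. v \<in> C \<Longrightarrow> 0 \<le> f v) \<Longrightarrow> w \<in> C \<Longrightarrow>
      \<delta> * (\<Sum>v\<in>C. m v * f v) \<le> ((\<lambda>f w. \<Sum>e | e \<in> E \<and> tgt e = w. p e * f (src e)) ^^ q) f w"
begin

text \<open>\<open>P\<close> on functions that do not depend on the point of \<open>M\<close>; it
  governs the counts.\<close>

definition P0 :: "('v \<Rightarrow> real) \<Rightarrow> 'v \<Rightarrow> real" where
  "P0 f w = (\<Sum>e | e \<in> E \<and> tgt e = w. p e * f (src e))"

lemma P0_eq_P: "P0 f w = P (\<lambda>w x. f w) w x"
  by (simp add: P0_def P_def)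

lemma doeblin_P0: "(\<And>v. v \<in> C \<Longrightarrow> 0 \<le> f v) \<Longrightarrow> w \<in> C \<Longrightarrow> \<delta> * (\<Sum>v\<in>C. m v * f v) \<le> (P0 ^^ q) f w"
  using doeblin[of f w] by (simp add: P0_def[abs_def])

lemma P0_diff: "P0 (\<lambda>w. f w - g w) w = P0 f w - P0 g w"
  by (simp add: P0_def right_diff_distrib sum_subtractf)

lemma P0_divide: "P0 (\<lambda>w. f w / c) w = P0 f w / c"
  by (simp add: P0_def sum_divide_distrib)

lemma P0_const: "w \<in> C \<Longrightarrow> P0 (\<lambda>w. c) w = c"
  using stochastic[of w] by (simp add: P0_def sum_distrib_right[symmetric])

lemma P0_mono: "(\<And>v. v \<in> C \<Longrightarrow> f v \<le> g v) \<Longrightarrow> P0 f w \<le> P0 g w"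
  unfolding P0_def by (intro sum_mono mult_left_mono) (use p_nonneg src in auto)

lemma P0_cong: "(\<And>v. v \<in> C \<Longrightarrow> f v = g v) \<Longrightarrow> P0 f w = P0 g w"
  unfolding P0_def by (intro sum.cong) (use src in auto)

lemma P0_tendsto: "(\<And>v. v \<in> C \<Longrightarrow> (\<lambda>n. f n v) \<longlonglongrightarrow> g v) \<Longrightarrow> (\<lambda>n. P0 (f n) w) \<longlonglongrightarrow> P0 g w"
  unfolding P0_def by (intro tendsto_intros) (use src in auto)

lemma P0_abs_le: "(\<And>v. v \<in> C \<Longrightarrow> \<bar>f v\<bar> \<le> K) \<Longrightarrow> w \<in> C \<Longrightarrow> \<bar>P0 f w\<bar> \<le> K"
  using P0_mono[of f "\<lambda>_. K" w] P0_mono[of "\<lambda>_. - K" f w] P0_const[of w K] P0_const[of w "- K"]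
  by (auto simp: abs_le_iff minus_le_iff)

lemma const_bnd: "\<exists>K. bnd (\<lambda>w x. f w) K"
proof (intro exI bndI)
  fix w x assume "w \<in> C"
  then show "\<bar>f w\<bar> \<le> (\<Sum>w\<in>C. \<bar>f w\<bar>)" using finC by (intro member_le_sum) auto
qed simp

lemma I_const: "I (\<lambda>w x. f w) = (\<Sum>w\<in>C. m w * f w)"
proof -
  interpret prob_space M by (rule prob)
  show ?thesis by (simp add: I_def prob_space)
qed

lemma m_P0: "(\<Sum>w\<in>C. m w * P0 f w) = (\<Sum>w\<in>C. m w * f w)"
proof -
  obtain K where "bnd (\<lambda>w x. f w) K" using const_bnd by blast
  from I_P[OF this] show ?thesis
    using I_const[of f] I_const[of "P0 f"] P0_eq_P[of f] by (simp add: P0_def[abs_def] P_def[abs_def])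
qed

lemma nonempty: "C \<noteq> {}"
  using sum_m by auto

text \<open>Consider a vertex where the upper limit attains its maximum \<open>T\<close>. The
  minorisation of \<open>T + e - u n\<close>, nonnegative for large \<open>n\<close>, puts the value
  \<open>q\<close> steps later below \<open>T + e\<close> by about
  \<open>\<delta> * (T + e - \<mu>)\<close>. For small \<open>e\<close> this contradicts the choice
  of \<open>T\<close> unless \<open>T \<le> \<mu>\<close>.\<close>

lemma doeblin_upper:
  assumes bd: "\<And>n w. w \<in> C \<Longrightarrow> \<bar>u n w\<bar> \<le> K"
    and step: "\<And>w. w \<in> C \<Longrightarrow> (\<lambda>n. u (Suc n) w - P0 (u n) w) \<longlonglongrightarrow> 0"
    and mean: "(\<lambda>n. \<Sum>v\<in>C. m v * u n v) \<longlonglongrightarrow> \<mu>" and w: "w \<in> C"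
  shows "rlimsup (\<lambda>n. u n w) \<le> \<mu>"
proof -
  have steps: "(\<lambda>n. u (n + i) w - (P0 ^^ i) (u n) w) \<longlonglongrightarrow> 0" if "w \<in> C" for i w
    using that
  proof (induction i arbitrary: w)
    case (Suc i)
    have "(\<lambda>n. P0 (\<lambda>v. u (n + i) v - (P0 ^^ i) (u n) v) w) \<longlonglongrightarrow> P0 (\<lambda>v. 0) w"
      by (rule P0_tendsto) (rule Suc.IH)
    then have "(\<lambda>n. (u (Suc (n + i)) w - P0 (u (n + i)) w) + P0 (\<lambda>v. u (n + i) v - (P0 ^^ i) (u n) v) w) \<longlonglongrightarrow> 0 + P0 (\<lambda>v. 0) w"
      by (intro tendsto_add LIMSEQ_ignore_initial_segment[OF step[OF Suc.prems]])
    then show ?case by (simp add: P0_diff P0_def[of "\<lambda>v. 0"])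
  qed simp
  define S where "S w = rlimsup (\<lambda>n. u n w)" for w
  define T where "T = Max (S ` C)"
  have ST: "S w \<le> T" if "w \<in> C" for w unfolding T_def using finC that by simp
  have "T \<in> S ` C" unfolding T_def by (rule Max_in) (use finC nonempty in auto)
  then obtain v where v: "v \<in> C" "S v = T" by auto
  have key: "\<delta> * (T + e - \<mu>) \<le> e" if e: "e > 0" for e
  proof -
    have iter_diff: "(P0 ^^ i) (\<lambda>v. c - f v) x = c - (P0 ^^ i) f x" if "x \<in> C" for i c f x
      using that
    proof (induction i arbitrary: x)
      case (Suc i)
      have "P0 ((P0 ^^ i) (\<lambda>v. c - f v)) x = P0 (\<lambda>x. c - (P0 ^^ i) f x) x" by (rule P0_cong) (rule Suc.IH)
      also have "\<dots> = c - P0 ((P0 ^^ i) f) x" using P0_diff[of "\<lambda>_. c" _ x] P0_const[OF Suc.prems] by simp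
      finally show ?case by simp
    qed simp
    have "\<forall>\<^sub>F n in sequentially. \<forall>x\<in>C. u n x < S x + e"
      using finC by (rule eventually_ball_finite) (auto simp: S_def intro!: rlimsup_eventually_less[OF bd e])
    then have le: "\<forall>\<^sub>F n in sequentially. u (n + q) v \<le> (u (n + q) v - (P0 ^^ q) (u n) v) + (T + e) - \<delta> * (T + e - (\<Sum>v\<in>C. m v * u n v))"
    proof eventually_elim
      case (elim n)
      have "\<delta> * (\<Sum>x\<in>C. m x * (T + e - u n x)) \<le> (P0 ^^ q) (\<lambda>x. T + e - u n x) v"
        by (rule doeblin_P0[OF _ v(1)]) (use elim ST in force)
      moreover have "(\<Sum>x\<in>C. m x * (T + e - u n x)) = (T + e) - (\<Sum>v\<in>C. m v * u n v)"
        by (simp add: right_diff_distrib sum_subtractf sum_distrib_right[symmetric] sum_m)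
      ultimately show ?case using iter_diff[OF v(1), of q "T + e" "u n"] by simp
    qed
    have l: "(\<lambda>n. (u (n + q) v - (P0 ^^ q) (u n) v) + (T + e) - \<delta> * (T + e - (\<Sum>v\<in>C. m v * u n v)))
       \<longlonglongrightarrow> 0 + (T + e) - \<delta> * (T + e - \<mu>)"
      by (intro tendsto_intros steps v mean)
    have ub: "T \<le> 0 + (T + e) - \<delta> * (T + e - \<mu>) + d" if d: "d > 0" for d
    proof -
      have "\<forall>\<^sub>F n in sequentially. (u (n + q) v - (P0 ^^ q) (u n) v) + (T + e) - \<delta> * (T + e - (\<Sum>v\<in>C. m v * u n v)) < 0 + (T + e) - \<delta> * (T + e - \<mu>) + d"
        by (rule order_tendstoD(2)[OF l]) (use d in simp)
      with le have "\<forall>\<^sub>F n in sequentially. u (n + q) v \<le> 0 + (T + e) - \<delta> * (T + e - \<mu>) + d"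
        by eventually_elim linarith
      then have "\<forall>\<^sub>F n in sequentially. u n v \<le> 0 + (T + e) - \<delta> * (T + e - \<mu>) + d"
        using eventually_sequentially_seg[of "\<lambda>n. u n v \<le> 0 + (T + e) - \<delta> * (T + e - \<mu>) + d" q] by simp
      then have "rlimsup (\<lambda>n. u n v) \<le> 0 + (T + e) - \<delta> * (T + e - \<mu>) + d"
        by (rule rlimsup_le[OF bd[OF v(1)]])
      then show ?thesis using v(2) by (simp add: S_def)
    qed
    have "T \<le> 0 + (T + e) - \<delta> * (T + e - \<mu>)" by (rule field_le_epsilon) (rule ub)
    then show ?thesis by simp
  qed
  have "T \<le> \<mu>"
  proof (rule ccontr)
    assume "\<not> T \<le> \<mu>"
    then have d: "T - \<mu> > 0" by simp
    \<comment> \<open>\<open>key\<close> bounds \<open>\<delta> * (T - \<mu>)\<close> by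
      \<open>e\<close>, so half of that quantity is contradictory.\<close>
    define e where "e = \<delta> * (T - \<mu>) / 2"
    have e: "e > 0" using d \<delta>_pos by (simp add: e_def)
    have "\<delta> * (T - \<mu>) \<le> \<delta> * (T + e - \<mu>)" using e \<delta>_pos by (intro mult_left_mono) auto
    also have "\<dots> \<le> e" by (rule key[OF e])
    finally show False using e by (simp add: e_def)
  qed
  then show ?thesis using ST[OF w] unfolding S_def by simp
qed

lemma doeblin_tendsto:
  assumes bd: "\<And>n w. w \<in> C \<Longrightarrow> \<bar>u n w\<bar> \<le> K"
    and step: "\<And>w. w \<in> C \<Longrightarrow> (\<lambda>n. u (Suc n) w - P0 (u n) w) \<longlonglongrightarrow> 0"
    and mean: "(\<lambda>n. \<Sum>v\<in>C. m v * u n v) \<longlonglongrightarrow> \<mu>" and w: "w \<in> C"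
  shows "(\<lambda>n. u n w) \<longlonglongrightarrow> \<mu>"
proof -
  have 1: "rlimsup (\<lambda>n. u n w) \<le> \<mu>" by (rule doeblin_upper[OF bd step mean w])
  have 2: "rlimsup (\<lambda>n. - u n w) \<le> - \<mu>"
  proof (rule doeblin_upper[where K=K, OF _ _ _ w])
    show "(\<lambda>n. - u (Suc n) w - P0 (\<lambda>w. - u n w) w) \<longlonglongrightarrow> 0" if "w \<in> C" for w
      using tendsto_minus[OF step[OF that]] by (simp add: P0_def sum_negf)
    show "(\<lambda>n. \<Sum>v\<in>C. m v * - u n v) \<longlonglongrightarrow> - \<mu>" using tendsto_minus[OF mean] by (simp add: sum_negf)
  qed (use bd in auto)
  have l: "(\<lambda>n. u n w) \<longlonglongrightarrow> rlimsup (\<lambda>n. u n w)"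
    by (rule rlimsup_tendsto[OF bd[OF w]]) (use 1 2 in simp)
  moreover have "0 \<le> rlimsup (\<lambda>n. u n w) + rlimsup (\<lambda>n. - u n w)"
    by (rule rlimsup_uminus_ge[OF bd[OF w]])
  then have "rlimsup (\<lambda>n. u n w) = \<mu>" using 1 2 by simp
  ultimately show ?thesis by simp
qed

end

section \<open>Linear recursions with an input on one normalised component\<close>

context doeblin_op
begin

lemma m_nonneg: "w \<in> C \<Longrightarrow> 0 \<le> m w"
  using m_pos less_imp_le by blast

context
  fixes \<theta> z :: "nat \<Rightarrow> 'v \<Rightarrow> real" and \<eta> \<zeta> :: "nat \<Rightarrow> 'v \<Rightarrow> 'x \<Rightarrow> real" and K :: real
  assumes K0: "0 \<le> K"
    and z_nonneg: "\<And>n w. w \<in> C \<Longrightarrow> 0 \<le> z n w"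
    and \<theta>_init: "\<And>w. w \<in> C \<Longrightarrow> 0 \<le> \<theta> 0 w"
    and \<theta>_rec: "\<And>n w. w \<in> C \<Longrightarrow> \<theta> (Suc n) w = P0 (\<theta> n) w + z n w"
    and \<zeta>_meas: "\<And>n w. w \<in> C \<Longrightarrow> \<zeta> n w \<in> borel_measurable M"
    and \<zeta>_le: "\<And>n w x. w \<in> C \<Longrightarrow> x \<in> space M \<Longrightarrow> \<bar>\<zeta> n w x\<bar> \<le> K * z n w"
    and \<eta>_init_meas: "\<And>w. w \<in> C \<Longrightarrow> \<eta> 0 w \<in> borel_measurable M"
    and \<eta>_init_le: "\<And>w x. w \<in> C \<Longrightarrow> x \<in> space M \<Longrightarrow> \<bar>\<eta> 0 w x\<bar> \<le> K * \<theta> 0 w"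
    and \<eta>_rec: "\<And>n w x. w \<in> C \<Longrightarrow> x \<in> space M \<Longrightarrow> \<eta> (Suc n) w x = P (\<eta> n) w x + \<zeta> n w x"
begin

text \<open>\<open>P0\<close> preserves the mean with the stationary weights, so \<open>T\<close>
  changes only through the input and records all mass fed in so far.\<close>

definition T :: "nat \<Rightarrow> real" where
  "T n = (\<Sum>v\<in>C. m v * \<theta> n v)"

lemma \<theta>_nonneg: "w \<in> C \<Longrightarrow> 0 \<le> \<theta> n w"
proof (induction n arbitrary: w)
  case (Suc n)
  have "P0 (\<lambda>_. 0) w \<le> P0 (\<theta> n) w" by (rule P0_mono) (rule Suc.IH)
  then show ?case using P0_const[OF Suc.prems, of 0] z_nonneg[OF Suc.prems] \<theta>_rec[OF Suc.prems] by simp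
qed (rule \<theta>_init)

lemma \<eta>_meas: "w \<in> C \<Longrightarrow> \<eta> n w \<in> borel_measurable M"
proof (induction n arbitrary: w)
  case (Suc n)
  have "(\<lambda>x. P (\<eta> n) w x + \<zeta> n w x) \<in> borel_measurable M"
    unfolding P_def
    by (intro borel_measurable_add \<zeta>_meas[OF Suc.prems] borel_measurable_sum borel_measurable_times
        borel_measurable_const measurable_compose[OF meas Suc.IH[OF src]]) auto
  then show ?case by (subst measurable_cong[OF \<eta>_rec[OF Suc.prems]])
qed (rule \<eta>_init_meas)

lemma \<eta>_le: "w \<in> C \<Longrightarrow> x \<in> space M \<Longrightarrow> \<bar>\<eta> n w x\<bar> \<le> K * \<theta> n w"
proof (induction n arbitrary: w x)
  case (Suc n)
  have "\<bar>P (\<eta> n) w x\<bar> \<le> K * P0 (\<theta> n) w"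
  proof -
    have "\<bar>(P ^^ 1) (\<eta> n) w x\<bar> \<le> (P ^^ 1) (\<lambda>w x. K * \<theta> n w) w x"
      by (rule abs_funpow_le[OF Suc.IH Suc.prems])
    then show ?thesis by (simp add: P_def P0_def sum_distrib_left mult_ac)
  qed
  then show ?case unfolding \<eta>_rec[OF Suc.prems] \<theta>_rec[OF Suc.prems(1)]
    using \<zeta>_le[OF Suc.prems, of n] by (simp add: distrib_left)
qed (rule \<eta>_init_le)

lemma T_Suc: "T (Suc n) = T n + (\<Sum>v\<in>C. m v * z n v)"
proof -
  have "T (Suc n) = (\<Sum>v\<in>C. m v * P0 (\<theta> n) v + m v * z n v)"
    unfolding T_def by (intro sum.cong refl) (simp add: \<theta>_rec distrib_left)
  then show ?thesis by (simp add: sum.distrib m_P0 T_def)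
qed

lemma mz_nonneg: "0 \<le> (\<Sum>v\<in>C. m v * z n v)"
  by (intro sum_nonneg mult_nonneg_nonneg) (use m_nonneg z_nonneg in auto)

lemma T_mono: "n \<le> n' \<Longrightarrow> T n \<le> T n'"
  by (rule lift_Suc_mono_le[of T]) (use T_Suc mz_nonneg in auto)

lemma T_eq: "T n = T 0 + (\<Sum>i<n. \<Sum>v\<in>C. m v * z i v)"
  by (induction n) (simp_all add: T_Suc)

lemma \<theta>_le_T: assumes "w \<in> C" shows "\<theta> n w \<le> T n / m w"
proof -
  have "m w * \<theta> n w \<le> T n" unfolding T_def
    by (rule member_le_sum[OF assms _ finC]) (use m_nonneg \<theta>_nonneg in auto)
  then show ?thesis using m_pos[OF assms] by (simp add: le_divide_eq mult.commute)
qed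

lemma T_nonneg: "0 \<le> T n"
  unfolding T_def by (intro sum_nonneg mult_nonneg_nonneg) (use m_nonneg \<theta>_nonneg in auto)

text \<open>\<open>T n\<close> collects the inputs of all vertices with positive weights
  \<open>m\<close>, so up to the factor \<open>m w\<close> it dominates the accumulated input of one
  vertex.\<close>

lemma partial_input_le:
  assumes "w \<in> C" "x \<in> space M"
  shows "\<bar>\<eta> 0 w x + (\<Sum>i<n. \<zeta> i w x)\<bar> \<le> K * (T n / m w)"
proof -
  have "\<bar>\<eta> 0 w x + (\<Sum>i<n. \<zeta> i w x)\<bar> \<le> \<bar>\<eta> 0 w x\<bar> + (\<Sum>i<n. \<bar>\<zeta> i w x\<bar>)"
    by (rule order_trans[OF abs_triangle_ineq add_left_mono[OF sum_abs]])
  also have "\<dots> \<le> K * \<theta> 0 w + (\<Sum>i<n. K * z i w)"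
    by (intro add_mono sum_mono \<eta>_init_le \<zeta>_le assms)
  also have "\<dots> = K * (\<theta> 0 w + (\<Sum>i<n. z i w))" by (simp add: distrib_left sum_distrib_left)
  also have "\<dots> \<le> K * (T n / m w)"
  proof (rule mult_left_mono[OF _ K0])
    have "m w * z i w \<le> (\<Sum>v\<in>C. m v * z i v)" for i
      by (rule member_le_sum[OF assms(1) _ finC]) (use m_nonneg z_nonneg in auto)
    then have "m w * (\<Sum>i<n. z i w) \<le> (\<Sum>i<n. \<Sum>v\<in>C. m v * z i v)"
      unfolding sum_distrib_left by (rule sum_mono)
    moreover have "m w * \<theta> 0 w \<le> T 0"
      using \<theta>_le_T[OF assms(1), of 0] m_pos[OF assms(1)] by (simp add: le_divide_eq mult.commute)
    ultimately have "m w * (\<theta> 0 w + (\<Sum>i<n. z i w)) \<le> T n" by (simp add: T_eq[of n] distrib_left)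
    then show "\<theta> 0 w + (\<Sum>i<n. z i w) \<le> T n / m w" using m_pos[OF assms(1)] by (simp add: le_divide_eq mult.commute)
  qed
  finally show ?thesis .
qed

text \<open>The input of one step is negligible against the accumulated mass. After division by
  \<open>n ^ j\<close> the counts nearly satisfy the homogeneous recursion, so the Doeblin condition
  transfers the limit of the mean to each vertex. For \<open>\<eta>\<close> only sums over time are
  accessible; they are convolutions of powers of \<open>P\<close> with the accumulated
  input.\<close>

lemma regular_polynomial_growth:
  assumes lim: "(\<lambda>n. T n / real n ^ j) \<longlonglongrightarrow> \<mu>" and \<mu>: "0 < \<mu>"
    and z_small: "\<And>w. w \<in> C \<Longrightarrow> (\<lambda>n. z n w / real n ^ j) \<longlonglongrightarrow> 0"
    and conv: "\<And>w. w \<in> C \<Longrightarrow> AE x in M. convergent (\<lambda>N. (\<Sum>i<N. \<zeta> i w x) / real N ^ j)"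
    and w: "w \<in> C"
  shows "cesaro_regular M (\<lambda>n. \<theta> n w) (\<lambda>n. \<eta> n w)"
proof -
  obtain B where B: "\<And>n. \<bar>T n / real n ^ j\<bar> \<le> B"
    using convergent_imp_Bseq[OF convergentI[OF lim]] unfolding Bseq_def by auto
  have B0: "0 \<le> B" using B[of 0] by linarith
  have TB: "T n \<le> B * real n ^ j" if "n > 0" for n
    using B[of n] T_nonneg[of n] that by (simp add: divide_le_eq)
  define b where "b = (\<Sum>w\<in>C. B / m w)"
  have bw: "B / m w \<le> b" if "w \<in> C" for w
    unfolding b_def by (rule member_le_sum[OF that _ finC]) (use B0 m_nonneg in auto)
  have b0: "0 \<le> b" using bw[OF w] B0 m_pos[OF w] by (meson divide_nonneg_pos order_trans)
  define u where "u n w = \<theta> n w / real n ^ j" for n w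
  have ub: "\<bar>u n w\<bar> \<le> b" if "w \<in> C" for n w
  proof -
    have "\<bar>u n w\<bar> = \<theta> n w / real n ^ j" using \<theta>_nonneg[OF that] by (simp add: u_def)
    also have "\<dots> \<le> (T n / m w) / real n ^ j" using \<theta>_le_T[OF that] by (intro divide_right_mono) auto
    also have "\<dots> = (T n / real n ^ j) / m w" by simp
    also have "\<dots> \<le> B / m w" using abs_le_D1[OF B[of n]] m_pos[OF that] by (intro divide_right_mono) auto
    finally show ?thesis using bw[OF that] by simp
  qed
  have rl: "(\<lambda>n. (real n / real (Suc n)) ^ j) \<longlonglongrightarrow> 1 ^ j"
    by (intro tendsto_power) real_asymp
  have \<theta>lim: "(\<lambda>n. \<theta> n w / real n ^ j) \<longlonglongrightarrow> \<mu>" if "w \<in> C" for w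
  proof -
    have "(\<lambda>n. u n w) \<longlonglongrightarrow> \<mu>"
    proof (rule doeblin_tendsto[OF ub _ _ that])
      fix w assume w: "w \<in> C"
      have rl0: "(\<lambda>n. (real n / real (Suc n)) ^ j - 1) \<longlonglongrightarrow> 0" using rl by (simp add: LIM_zero)
      have "(\<lambda>n. P0 (u n) w * ((real n / real (Suc n)) ^ j - 1)) \<longlonglongrightarrow> 0"
        by (rule lim_null_mult_left_bounded[where B=b, OF _ rl0])
          (use P0_abs_le[OF ub w] in auto)
      then have "(\<lambda>n. P0 (u n) w * ((real n / real (Suc n)) ^ j - 1) + z n w / real n ^ j * (real n / real (Suc n)) ^ j) \<longlonglongrightarrow> 0 + 0 * 1 ^ j"
        by (intro tendsto_add tendsto_mult z_small w rl)
      then have "(\<lambda>n. P0 (u n) w * ((real n / real (Suc n)) ^ j - 1) + z n w / real n ^ j * (real n / real (Suc n)) ^ j) \<longlonglongrightarrow> 0"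
        by simp
      moreover have "\<forall>\<^sub>F n in sequentially. P0 (u n) w * ((real n / real (Suc n)) ^ j - 1) + z n w / real n ^ j * (real n / real (Suc n)) ^ j
         = u (Suc n) w - P0 (u n) w"
        using eventually_gt_at_top[of 0]
      proof eventually_elim
        case (elim n)
        have "P0 (u n) w * (real n / real (Suc n)) ^ j = P0 (\<theta> n) w / real (Suc n) ^ j"
          using elim by (simp add: u_def[abs_def] P0_divide power_divide del: of_nat_Suc)
        moreover have "z n w / real n ^ j * (real n / real (Suc n)) ^ j = z n w / real (Suc n) ^ j"
          using elim by (simp add: power_divide del: of_nat_Suc)
        ultimately show ?case
          by (simp add: u_def[of "Suc n"] \<theta>_rec[OF w] add_divide_distrib right_diff_distrib del: of_nat_Suc)
      qed
      ultimately show "(\<lambda>n. u (Suc n) w - P0 (u n) w) \<longlonglongrightarrow> 0" by (rule Lim_transform_eventually)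
    next
      show "(\<lambda>n. \<Sum>v\<in>C. m v * u n v) \<longlonglongrightarrow> \<mu>"
        using lim by (simp add: T_def u_def sum_divide_distrib)
    qed
    then show ?thesis by (simp add: u_def)
  qed
  \<comment> \<open>The initial value and all inputs that have entered before time \<open>N\<close>;
    since \<open>\<zeta> i\<close> enters at time \<open>i + 1\<close>, the range is
    \<open>i < N - 1\<close>. The value 0 at \<open>N = 0\<close> keeps the bound by
    \<open>N ^ j\<close> valid there.\<close>
  define Z where "Z N w x = (if N = 0 then 0 else \<eta> 0 w x + (\<Sum>i<N - 1. \<zeta> i w x))" for N w x
  have bZ: "bnd (Z N) (K * b * real N ^ j)" for N
  proof (cases "N = 0")
    case True
    have "Z N = (\<lambda>w x. 0)" using True by (simp add: Z_def fun_eq_iff)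
    then show ?thesis using K0 b0 by (auto intro!: bndI)
  next
    case False
    show ?thesis
    proof (rule bndI)
      show "Z N w \<in> borel_measurable M" if "w \<in> C" for w
        unfolding Z_def[abs_def] using False
        by (simp add: borel_measurable_add borel_measurable_sum \<eta>_init_meas[OF that] \<zeta>_meas[OF that])
      show "\<bar>Z N w x\<bar> \<le> K * b * real N ^ j" if wx: "w \<in> C" "x \<in> space M" for w x
      proof -
        have "\<bar>Z N w x\<bar> \<le> K * (T (N - 1) / m w)" using partial_input_le[OF wx, of "N - 1"] False by (simp add: Z_def)
        also have "\<dots> \<le> K * (b * real N ^ j)"
        proof (rule mult_left_mono[OF _ K0])
          have "T (N - 1) \<le> T N" by (rule T_mono) simp
          also have "\<dots> \<le> B * real N ^ j" using TB False by simp
          finally have "T (N - 1) / m w \<le> B * real N ^ j / m w" using m_pos[OF wx(1)] by (simp add: divide_right_mono)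
          also have "\<dots> = (B / m w) * real N ^ j" by simp
          also have "\<dots> \<le> b * real N ^ j" using bw[OF wx(1)] by (intro mult_right_mono) auto
          finally show "T (N - 1) / m w \<le> b * real N ^ j" .
        qed
        finally show ?thesis by (simp add: mult_ac)
      qed
    qed
  qed
  have Zconv: "AE x in M. convergent (\<lambda>N. Z N w x / real N ^ j)" if "w \<in> C" for w
    using conv[OF that]
  proof eventually_elim
    case (elim x)
    then obtain L where L: "(\<lambda>N. (\<Sum>i<N. \<zeta> i w x) / real N ^ j) \<longlonglongrightarrow> L" by (auto simp: convergent_def)
    have i: "(\<lambda>N. 1 / real (Suc N)) \<longlonglongrightarrow> 0" by real_asymp
    have "(\<lambda>N. \<eta> 0 w x * (1 / real (Suc N)) ^ j + (\<Sum>i<N. \<zeta> i w x) / real N ^ j * (real N / real (Suc N)) ^ j) \<longlonglongrightarrow> \<eta> 0 w x * 0 ^ j + L * 1 ^ j"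
      by (intro tendsto_add tendsto_mult tendsto_const tendsto_power i L rl)
    moreover have "\<forall>\<^sub>F N in sequentially. \<eta> 0 w x * (1 / real (Suc N)) ^ j + (\<Sum>i<N. \<zeta> i w x) / real N ^ j * (real N / real (Suc N)) ^ j
       = Z (Suc N) w x / real (Suc N) ^ j"
      using eventually_gt_at_top[of 0]
      by eventually_elim (simp add: Z_def power_divide add_divide_distrib del: of_nat_Suc)
    ultimately have "(\<lambda>N. Z (Suc N) w x / real (Suc N) ^ j) \<longlonglongrightarrow> \<eta> 0 w x * 0 ^ j + L * 1 ^ j"
      by (rule Lim_transform_eventually)
    then have "(\<lambda>N. Z N w x / real N ^ j) \<longlonglongrightarrow> \<eta> 0 w x * 0 ^ j + L * 1 ^ j" by (rule LIMSEQ_imp_Suc)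
    then show ?case by (rule convergentI)
  qed
  \<comment> \<open>Every quantity that enters is afterwards transported by \<open>P\<close>;
    summing over time groups the contributions by their age \<open>m\<close>.\<close>
  have Y: "(\<Sum>n<N. \<eta> n w x) = (\<Sum>m<N. (P ^^ m) (Z (N - m)) w x)" if "w \<in> C" "x \<in> space M" for N w x
    using that
  proof (induction N arbitrary: w x)
    case (Suc N)
    have "(\<Sum>n<Suc N. \<eta> n w x) = \<eta> 0 w x + (\<Sum>n<N. P (\<eta> n) w x + \<zeta> n w x)"
      by (subst sum.lessThan_Suc_shift) (simp add: \<eta>_rec Suc.prems)
    also have "\<dots> = Z (Suc N) w x + P (\<lambda>w x. \<Sum>n<N. \<eta> n w x) w x"
      by (simp add: Z_def sum.distrib P_sum)
    also have "P (\<lambda>w x. \<Sum>n<N. \<eta> n w x) w x = P (\<lambda>w x. \<Sum>m<N. (P ^^ m) (Z (N - m)) w x) w x"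
      by (rule P_cong[OF Suc.IH Suc.prems(2)])
    also have "\<dots> = (\<Sum>m<N. (P ^^ Suc m) (Z (Suc N - Suc m)) w x)" by (simp add: P_sum)
    finally show ?case by (subst sum.lessThan_Suc_shift) simp
  qed simp
  have Yconv: "AE x in M. convergent (\<lambda>N. (\<Sum>m<N. (P ^^ m) (Z (N - m)) w x) / real N ^ Suc j)"
    by (rule convolution_convergent[OF bZ _ Zconv w]) (use K0 b0 in auto)
  show ?thesis
  proof (rule cesaro_regular_of_scale[where a=1 and k=j and c=\<mu> and K=K])
    show "AE x in M. convergent (cesaro_mean (\<lambda>n. \<eta> n w x / (1 ^ n * real n ^ j)))"
      using Yconv AE_space
    proof eventually_elim
      case (elim x)
      have "convergent (\<lambda>N. (\<Sum>n<N. \<eta> n w x) / real N ^ Suc j)"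
        unfolding Y[OF w elim(2)] by (rule elim(1))
      from convergent_cesaro_mean_power_divide[OF this] show ?case by simp
    qed
  qed (use \<theta>_nonneg \<eta>_meas \<eta>_le \<theta>lim \<mu> w K0 in auto)
qed

text \<open>The input outgrows the component, whose normalised rate is 1. Division by
  \<open>s\<close> puts a factor tending to \<open>1 / a\<close> in front of \<open>P\<close>, and
  \<open>contraction_convergent\<close> applies twice: to the counts, as functions constant in
  \<open>x\<close>, and to the Cesaro means of the rescaled \<open>\<eta>\<close>.\<close>

lemma regular_exponential_growth:
  assumes a: "1 < a" and z_lim: "\<And>w. w \<in> C \<Longrightarrow> (\<lambda>n. z n w / (a ^ n * real n ^ k)) \<longlonglongrightarrow> c w"
    and c: "\<And>w. w \<in> C \<Longrightarrow> 0 \<le> c w" and v: "v \<in> C" "0 < c v"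
    and conv: "\<And>w. w \<in> C \<Longrightarrow> AE x in M. convergent (cesaro_mean (\<lambda>n. \<zeta> n w x / (a ^ n * real n ^ k)))"
    and w: "w \<in> C"
  shows "cesaro_regular M (\<lambda>n. \<theta> n w) (\<lambda>n. \<eta> n w)"
proof -
  interpret prob_space M by (rule prob)
  define s where "s n = a ^ n * real n ^ k" for n
  \<comment> \<open>Indices start at 1, because \<open>s 0 = 0\<close> for
    \<open>k > 0\<close>.\<close>
  have s_pos: "0 < s (Suc n)" for n using a by (simp add: s_def)
  define r where "r n = s (Suc n) / s (Suc (Suc n))" for n
  have rlim: "r \<longlonglongrightarrow> 1 / a"
  proof -
    have "(\<lambda>n. (1 / a) * (real (Suc n) / real (Suc (Suc n))) ^ k) \<longlonglongrightarrow> (1 / a) * 1 ^ k"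
      by (intro tendsto_mult tendsto_const tendsto_power) real_asymp
    moreover have "(1 / a) * (real (Suc n) / real (Suc (Suc n))) ^ k = r n" for n
      using a by (simp add: r_def s_def power_divide del: of_nat_Suc)
    ultimately show ?thesis by simp
  qed
  have mz: "(\<lambda>n. (\<Sum>v\<in>C. m v * z n v) / s n) \<longlonglongrightarrow> (\<Sum>v\<in>C. m v * c v)"
  proof -
    have "(\<lambda>n. \<Sum>v\<in>C. m v * (z n v / s n)) \<longlonglongrightarrow> (\<Sum>v\<in>C. m v * c v)"
      unfolding s_def by (intro tendsto_sum tendsto_mult tendsto_const z_lim)
    then show ?thesis by (simp add: sum_divide_distrib)
  qed
  obtain B where B: "\<And>n. \<bar>(\<Sum>v\<in>C. m v * z n v) / s n\<bar> \<le> B"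
    using convergent_imp_Bseq[OF convergentI[OF mz]] unfolding Bseq_def by auto
  have B0: "0 \<le> B" using B[of 0] by linarith
  \<comment> \<open>The first entry starts the induction for
    \<open>T (Suc n) \<le> D * s (Suc n)\<close>; the second gives \<open>D + B \<le> a * D\<close>,
    which carries it one step further.\<close>
  define D where "D = max (T 1 / s 1) (B / (a - 1))"
  have D1: "T 1 \<le> D * s 1"
  proof -
    have "T 1 / s 1 \<le> D" by (simp add: D_def)
    then show ?thesis using s_pos[of 0] by (simp add: divide_le_eq)
  qed
  have D2: "D + B \<le> a * D"
  proof -
    have "B / (a - 1) \<le> D" by (simp add: D_def)
    then show ?thesis using a by (simp add: divide_le_eq algebra_simps)
  qed
  have D0: "0 \<le> D" using B0 a by (simp add: D_def le_max_iff_disj)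
  have TD: "T (Suc n) \<le> D * s (Suc n)" for n
  proof (induction n)
    case 0 then show ?case using D1 by simp
  next
    case (Suc n)
    have "(\<Sum>v\<in>C. m v * z (Suc n) v) \<le> B * s (Suc n)"
      using B[of "Suc n"] mz_nonneg[of "Suc n"] s_pos[of n] by (simp add: divide_le_eq)
    then have "T (Suc (Suc n)) \<le> (D + B) * s (Suc n)" using Suc by (simp add: T_Suc[of "Suc n"] distrib_right)
    also have "\<dots> \<le> (a * D) * s (Suc n)" using D2 s_pos[of n] by (intro mult_right_mono) auto
    also have "\<dots> = D * (a * s (Suc n))" by simp
    also have "a * s (Suc n) \<le> s (Suc (Suc n))"
    proof -
      have "a * s (Suc n) = a ^ Suc (Suc n) * real (Suc n) ^ k" by (simp add: s_def)
      also have "\<dots> \<le> a ^ Suc (Suc n) * real (Suc (Suc n)) ^ k" using a by (intro mult_left_mono power_mono) auto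
      finally show ?thesis by (simp add: s_def)
    qed
    then have "D * (a * s (Suc n)) \<le> D * s (Suc (Suc n))" using D0 by (intro mult_left_mono)
    finally show ?case .
  qed
  define b where "b = (\<Sum>w\<in>C. D / m w)"
  have bw: "D / m w \<le> b" if "w \<in> C" for w
    unfolding b_def by (rule member_le_sum[OF that _ finC]) (use D0 m_nonneg in auto)
  define u where "u n w = \<theta> (Suc n) w / s (Suc n)" for n w
  have u0: "0 \<le> u n w" if "w \<in> C" for n w
    using \<theta>_nonneg[OF that] s_pos[of n] by (simp add: u_def)
  have ub: "\<bar>u n w\<bar> \<le> b" if "w \<in> C" for n w
  proof -
    have "u n w \<le> (T (Suc n) / m w) / s (Suc n)" unfolding u_def
      using \<theta>_le_T[OF that] s_pos[of n] by (intro divide_right_mono) auto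
    also have "\<dots> = (T (Suc n) / s (Suc n)) / m w" by simp
    also have "\<dots> \<le> D / m w" using TD[of n] s_pos[of n] m_pos[OF that] by (intro divide_right_mono) (auto simp: divide_le_eq)
    finally show ?thesis using bw[OF that] u0[OF that] by simp
  qed
  have u_rec: "u (Suc n) w = r n * (P0 (u n) w + z (Suc n) w / s (Suc n))" if "w \<in> C" for n w
  proof -
    have "P0 (u n) w = P0 (\<theta> (Suc n)) w / s (Suc n)" by (simp add: P0_def u_def sum_divide_distrib)
    then show ?thesis using s_pos[of n]
      by (simp add: u_def[of "Suc n"] r_def \<theta>_rec[OF that, of "Suc n"] add_divide_distrib distrib_left)
  qed
  have a1: "0 \<le> 1 / a" "1 / a < 1" using a by auto
  have rlim0: "(\<lambda>n. r n - 1 / a) \<longlonglongrightarrow> 0" using rlim by (simp add: LIM_zero)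
  have u_conv: "\<exists>l. (\<lambda>n. u n w) \<longlonglongrightarrow> l" if "w \<in> C" for w
  proof -
    have "AE x in M. convergent (\<lambda>N. u N w)"
    proof (rule contraction_convergent[where a="\<lambda>N w x. u N w" and K=b and k="1/a", OF _ a1 _ that])
      show "bnd (\<lambda>w x. u N w) b" for N by (rule bndI) (use ub in auto)
      fix w assume w: "w \<in> C"
      have "(\<lambda>N. P0 (u N) w * (r N - 1 / a)) \<longlonglongrightarrow> 0"
        by (rule lim_null_mult_left_bounded[where B=b, OF _ rlim0])
          (use P0_abs_le[OF ub w] in auto)
      then have "(\<lambda>N. P0 (u N) w * (r N - 1 / a) + r N * (z (Suc N) w / s (Suc N))) \<longlonglongrightarrow> 0 + 1 / a * c w"
        using z_lim[OF w] unfolding s_def[symmetric]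
        by (intro tendsto_add tendsto_mult rlim LIMSEQ_Suc[of "\<lambda>N. z N w / s N"])
      then have "convergent (\<lambda>N. P0 (u N) w * (r N - 1 / a) + r N * (z (Suc N) w / s (Suc N)))" by (rule convergentI)
      moreover have "P0 (u N) w * (r N - 1 / a) + r N * (z (Suc N) w / s (Suc N)) = u (N + 1) w - 1 / a * P (\<lambda>w x. u N w) w x" for N x
        using u_rec[OF w, of N] by (simp add: P0_eq_P[of _ _ x, symmetric] algebra_simps)
      ultimately show "AE x in M. convergent (\<lambda>N. u (N + 1) w - 1 / a * P (\<lambda>w x. u N w) w x)" by simp
    qed
    then show ?thesis by (simp add: convergent_def)
  qed
  then obtain l where l: "\<And>w. w \<in> C \<Longrightarrow> (\<lambda>n. u n w) \<longlonglongrightarrow> l w" by metis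
  have l0: "0 \<le> l w" if "w \<in> C" for w using l[OF that] u0[OF that] by (meson LIMSEQ_le_const)
  have l_eq: "l w = 1 / a * (P0 l w + c w)" if "w \<in> C" for w
  proof (rule LIMSEQ_unique[OF LIMSEQ_Suc[OF l[OF that]]])
    show "(\<lambda>n. u (Suc n) w) \<longlonglongrightarrow> 1 / a * (P0 l w + c w)"
      unfolding u_rec[OF that]
      using z_lim[OF that] unfolding s_def[symmetric]
      by (intro tendsto_add tendsto_mult rlim P0_tendsto l LIMSEQ_Suc[of "\<lambda>N. z N w / s N"])
  qed
  \<comment> \<open>From \<open>a * l = P0 l + c\<close> and \<open>c \<ge> 0\<close>, one
    application of \<open>P0\<close> multiplies \<open>l\<close> by at most \<open>a\<close>. With
    the minorisation, positivity of \<open>l\<close> at \<open>v\<close> therefore reaches every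
    vertex.\<close>
  have l_iter: "(P0 ^^ i) l w \<le> a ^ i * l w" if "w \<in> C" for i w
    using that
  proof (induction i arbitrary: w)
    case (Suc i)
    have "P0 ((P0 ^^ i) l) w \<le> P0 (\<lambda>w. a ^ i * l w) w" by (rule P0_mono) (rule Suc.IH)
    also have "\<dots> = a ^ i * P0 l w" by (simp add: P0_def sum_distrib_left mult_ac)
    also have "\<dots> \<le> a ^ i * (a * l w)"
    proof (rule mult_left_mono)
      have "a * l w = P0 l w + c w" using l_eq[OF Suc.prems] a by simp
      then show "P0 l w \<le> a * l w" using c[OF Suc.prems] by simp
    qed (use a in auto)
    finally show ?case by (simp add: mult_ac)
  qed simp
  have lv: "0 < l v"
  proof -
    have "P0 (\<lambda>_. 0) v \<le> P0 l v" by (rule P0_mono) (rule l0)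
    then have "0 \<le> P0 l v" using P0_const[OF v(1), of 0] by simp
    then have "0 < 1 / a * (P0 l v + c v)" using v(2) a by (intro mult_pos_pos) auto
    then show ?thesis using l_eq[OF v(1)] by simp
  qed
  have lw: "0 < l w"
  proof -
    have "0 < m v * l v" using m_pos[OF v(1)] lv by simp
    also have "\<dots> \<le> (\<Sum>v\<in>C. m v * l v)"
      by (rule member_le_sum[OF v(1) _ finC]) (use m_nonneg l0 in auto)
    finally have "0 < \<delta> * (\<Sum>v\<in>C. m v * l v)" using \<delta>_pos by simp
    also have "\<dots> \<le> (P0 ^^ q) l w" by (rule doeblin_P0[OF l0 w])
    also have "\<dots> \<le> a ^ q * l w" by (rule l_iter[OF w])
    finally show ?thesis using a by (simp add: zero_less_mult_iff)
  qed
  define h where "h n w x = \<eta> (Suc n) w x / s (Suc n)" for n w x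
  have hb: "bnd (h n) (K * b)" for n
  proof (rule bndI)
    show "h n w \<in> borel_measurable M" if "w \<in> C" for w
      unfolding h_def[abs_def] by (intro borel_measurable_divide borel_measurable_const \<eta>_meas that)
    show "\<bar>h n w x\<bar> \<le> K * b" if "w \<in> C" "x \<in> space M" for w x
    proof -
      have "\<bar>h n w x\<bar> \<le> K * \<theta> (Suc n) w / s (Suc n)"
        unfolding h_def abs_divide using \<eta>_le[OF that] s_pos[of n] by (simp add: divide_right_mono)
      also have "\<dots> = K * u n w" by (simp add: u_def)
      also have "\<dots> \<le> K * b" using ub[OF that(1), of n] K0 by (intro mult_left_mono) auto
      finally show ?thesis .
    qed
  qed
  \<comment> \<open>Only Cesaro means of the input are known to converge, so the contraction is
    applied to averages of \<open>h\<close>, not to \<open>h\<close>.\<close>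
  define A where "A N w x = cesaro_mean (\<lambda>n. h n w x) N" for N w x
  have Ab: "bnd (A N) (K * b)" for N
  proof (rule bndI)
    show "A N w \<in> borel_measurable M" if "w \<in> C" for w
      unfolding A_def[abs_def] cesaro_mean_def
      by (intro borel_measurable_divide borel_measurable_const borel_measurable_sum bndD(1)[OF hb that])
    show "\<bar>A N w x\<bar> \<le> K * b" if "w \<in> C" "x \<in> space M" for w x
      unfolding A_def by (rule abs_cesaro_mean_le) (rule bndD(2)[OF hb that])
  qed
  have "AE x in M. convergent (\<lambda>N. A N w x)"
  proof (rule contraction_convergent[OF Ab a1 _ w])
    fix w assume w: "w \<in> C"
    show "AE x in M. convergent (\<lambda>N. A (N + 1) w x - 1 / a * P (A N) w x)"
      using conv[OF w] AE_space
    proof eventually_elim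
      case (elim x)
      define y where "y n = \<zeta> (Suc n) w x / s (Suc n)" for n
      have h_rec: "h (Suc n) w x = r n * (P (h n) w x + y n)" for n
      proof -
        have "P (h n) w x = P (\<eta> (Suc n)) w x / s (Suc n)"
          by (simp add: h_def P_def sum_divide_distrib)
        then show ?thesis using s_pos[of n]
          by (simp add: h_def[of "Suc n"] y_def r_def \<eta>_rec[OF w elim(2), of "Suc n"] add_divide_distrib distrib_left)
      qed
      have Phb: "\<bar>P (h n) w x\<bar> \<le> K * b" for n by (rule bndD(2)[OF bnd_P[OF hb] w elim(2)])
      have 1: "(\<lambda>n. P (h n) w x * (r n - 1 / a)) \<longlonglongrightarrow> 0"
        by (rule lim_null_mult_left_bounded[where B="K * b", OF _ rlim0]) (use Phb in auto)
      have yb: "\<exists>B. \<forall>n. \<bar>y n\<bar> \<le> B"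
      proof -
        have zl: "(\<lambda>n. z (Suc n) w / s (Suc n)) \<longlonglongrightarrow> c w"
          using z_lim[OF w] unfolding s_def[symmetric] by (rule LIMSEQ_Suc[of "\<lambda>N. z N w / s N"])
        obtain B where B: "\<And>n. \<bar>z (Suc n) w / s (Suc n)\<bar> \<le> B"
          using convergent_imp_Bseq[OF convergentI[OF zl]] unfolding Bseq_def by auto
        have "\<bar>y n\<bar> \<le> K * B" for n
        proof -
          have "\<bar>y n\<bar> \<le> K * z (Suc n) w / s (Suc n)"
            unfolding y_def abs_divide using \<zeta>_le[OF w elim(2)] s_pos[of n] by (simp add: divide_right_mono)
          also have "\<dots> \<le> K * \<bar>z (Suc n) w / s (Suc n)\<bar>" using K0 by (simp add: mult_left_mono flip: times_divide_eq_right del: abs_divide)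
          also have "\<dots> \<le> K * B" using B K0 by (rule mult_left_mono)
          finally show ?thesis .
        qed
        then show ?thesis by blast
      qed
      then obtain B where B: "\<And>n. \<bar>y n\<bar> \<le> B" by blast
      have yc: "convergent (cesaro_mean y)"
        using elim(1) unfolding y_def s_def[symmetric]
        by (simp only: convergent_cesaro_mean_Suc_iff[of "\<lambda>n. \<zeta> n w x / s n"])
      have "convergent (cesaro_mean (\<lambda>n. P (h n) w x * (r n - 1 / a) + y n * r n))"
        by (intro convergent_cesaro_mean_add convergentI[OF cesaro_mean_tendsto[OF 1]] convergent_cesaro_mean_mult[OF yc B rlim])
      then obtain L where L: "cesaro_mean (\<lambda>n. P (h n) w x * (r n - 1 / a) + y n * r n) \<longlonglongrightarrow> L"
        by (auto simp: convergent_def)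
      \<comment> \<open>Averaging \<open>N + 1\<close> terms of \<open>h\<close> instead of the
        \<open>N\<close> shifted ones introduces a factor \<open>N / (N + 1)\<close> and the term
        \<open>h 0\<close>; both corrections vanish.\<close>
      have 2: "(\<lambda>N. cesaro_mean (\<lambda>n. h (Suc n) w x) N * (real N / real (Suc N) - 1)) \<longlonglongrightarrow> 0"
      proof (rule lim_null_mult_left_bounded[where B="K * b"])
        show "(\<lambda>N. real N / real (Suc N) - 1) \<longlonglongrightarrow> 0" by real_asymp
        show "\<forall>\<^sub>F N in sequentially. norm (cesaro_mean (\<lambda>n. h (Suc n) w x) N) \<le> K * b"
          using abs_cesaro_mean_le[OF bndD(2)[OF hb w elim(2)]] by (intro always_eventually allI) simp
      qed
      have 3: "(\<lambda>N. h 0 w x / real (Suc N)) \<longlonglongrightarrow> 0" by real_asymp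
      have "(\<lambda>N. cesaro_mean (\<lambda>n. P (h n) w x * (r n - 1 / a) + y n * r n) N + cesaro_mean (\<lambda>n. h (Suc n) w x) N * (real N / real (Suc N) - 1)
        + h 0 w x / real (Suc N)) \<longlonglongrightarrow> L + 0 + 0"
        by (intro tendsto_add L 2 3)
      moreover have "cesaro_mean (\<lambda>n. P (h n) w x * (r n - 1 / a) + y n * r n) N + cesaro_mean (\<lambda>n. h (Suc n) w x) N * (real N / real (Suc N) - 1)
        + h 0 w x / real (Suc N) = A (N + 1) w x - 1 / a * P (A N) w x" if N: "N > 0" for N
      proof -
        have "A N = (\<lambda>w x. (1 / real N) * (\<Sum>n<N. h n w x))"
          by (simp add: A_def cesaro_mean_def fun_eq_iff)
        then have "P (A N) w x = cesaro_mean (\<lambda>n. P (h n) w x) N"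
          by (simp only: P_scale P_sum[OF finite_lessThan]) (simp add: cesaro_mean_def)
        moreover have "cesaro_mean (\<lambda>n. P (h n) w x * (r n - 1 / a) + y n * r n) N
           = cesaro_mean (\<lambda>n. h (Suc n) w x) N - 1 / a * cesaro_mean (\<lambda>n. P (h n) w x) N"
        proof -
          have "(\<lambda>n. P (h n) w x * (r n - 1 / a) + y n * r n) = (\<lambda>n. h (Suc n) w x - 1 / a * P (h n) w x)"
            by (simp add: fun_eq_iff h_rec algebra_simps)
          then show ?thesis by (simp add: cesaro_mean_def sum_subtractf diff_divide_distrib flip: sum_divide_distrib)
        qed
        moreover have "A (N + 1) w x = h 0 w x / real (Suc N) + cesaro_mean (\<lambda>n. h (Suc n) w x) N * (real N / real (Suc N))"
        proof -
          have "(\<Sum>n<Suc N. h n w x) = h 0 w x + (\<Sum>n<N. h (Suc n) w x)" by (rule sum.lessThan_Suc_shift)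
          then show ?thesis using N
            by (simp add: A_def cesaro_mean_def add_divide_distrib del: sum.lessThan_Suc of_nat_Suc)
        qed
        ultimately show ?thesis by (simp add: right_diff_distrib)
      qed
      then have "\<forall>\<^sub>F N in sequentially. cesaro_mean (\<lambda>n. P (h n) w x * (r n - 1 / a) + y n * r n) N + cesaro_mean (\<lambda>n. h (Suc n) w x) N * (real N / real (Suc N) - 1)
        + h 0 w x / real (Suc N) = A (N + 1) w x - 1 / a * P (A N) w x"
        by (rule eventually_mono[OF eventually_gt_at_top[of 0]])
      ultimately have "(\<lambda>N. A (N + 1) w x - 1 / a * P (A N) w x) \<longlonglongrightarrow> L + 0 + 0" by (rule Lim_transform_eventually)
      then show ?case by (rule convergentI)
    qed
  qed
  then have fin: "AE x in M. convergent (cesaro_mean (\<lambda>n. \<eta> n w x / s n))"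
    unfolding A_def h_def by (simp only: convergent_cesaro_mean_Suc_iff[of "\<lambda>n. \<eta> n _ _ / s n"])
  have \<theta>lim: "(\<lambda>n. \<theta> n w / s n) \<longlonglongrightarrow> l w"
    using l[OF w] unfolding u_def by (rule LIMSEQ_imp_Suc)
  show ?thesis
    by (rule cesaro_regular_of_scale[where a=a and k=k and c="l w" and K=K])
      (use \<theta>_nonneg \<eta>_meas \<eta>_le w K0 a lw fin \<theta>lim in \<open>auto simp: s_def\<close>)
qed

text \<open>A summable input lets \<open>T\<close> increase to a finite limit. If the limit is
  positive, this is polynomial growth with \<open>j = 0\<close>; if it is 0, all values
  vanish.\<close>

lemma regular_summable_input:
  assumes sm: "summable (\<lambda>n. \<Sum>v\<in>C. z n v)" and w: "w \<in> C"
  shows "cesaro_regular M (\<lambda>n. \<theta> n w) (\<lambda>n. \<eta> n w)"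
proof -
  have zs: "summable (\<lambda>n. z n w)" if "w \<in> C" for w
    by (rule summable_comparison_test'[OF sm, of 0])
      (use z_nonneg that in \<open>auto intro!: member_le_sum finC\<close>)
  have "summable (\<lambda>n. \<Sum>v\<in>C. m v * z n v)"
    by (intro summable_sum summable_mult zs)
  then have "(\<lambda>n. \<Sum>i<n. \<Sum>v\<in>C. m v * z i v) \<longlonglongrightarrow> (\<Sum>i. \<Sum>v\<in>C. m v * z i v)" by (rule summable_LIMSEQ)
  then have "(\<lambda>n. T 0 + (\<Sum>i<n. \<Sum>v\<in>C. m v * z i v)) \<longlonglongrightarrow> T 0 + (\<Sum>i. \<Sum>v\<in>C. m v * z i v)"
    by (intro tendsto_add tendsto_const)
  then obtain \<mu> where \<mu>: "T \<longlonglongrightarrow> \<mu>" unfolding T_eq[symmetric] by blast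
  have T\<mu>: "T n \<le> \<mu>" for n by (rule incseq_le[OF _ \<mu>]) (simp add: incseq_def T_mono)
  show ?thesis
  proof (cases "\<mu> > 0")
    case True
    show ?thesis
    proof (rule regular_polynomial_growth[where j=0, OF _ True _ _ w])
      show "(\<lambda>n. T n / real n ^ 0) \<longlonglongrightarrow> \<mu>" using \<mu> by simp
      show "(\<lambda>n. z n w / real n ^ 0) \<longlonglongrightarrow> 0" if "w \<in> C" for w
        using summable_LIMSEQ_zero[OF zs[OF that]] by simp
      show "AE x in M. convergent (\<lambda>N. (\<Sum>i<N. \<zeta> i w x) / real N ^ 0)" if w: "w \<in> C" for w
        using AE_space
      proof eventually_elim
        case (elim x)
        have "summable (\<lambda>i. \<zeta> i w x)"
          by (rule summable_comparison_test'[OF summable_mult[OF zs[OF w], of K], of 0])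
            (use \<zeta>_le[OF w elim] in auto)
        then show ?case by (simp add: summable_iff_convergent)
      qed
    qed
  next
    case False
    have \<theta>z: "\<theta> n w = 0" for n
    proof -
      have "T n = 0" using T\<mu>[of n] T_nonneg[of n] False by simp
      then show ?thesis using \<theta>_le_T[OF w, of n] \<theta>_nonneg[OF w, of n] by simp
    qed
    have \<eta>z: "\<eta> n w x = 0" if "x \<in> space M" for n x using \<eta>_le[OF w that, of n] \<theta>z by simp
    show ?thesis
    proof (rule cesaro_regularI[where K=0])
      show "exp_poly_growth (\<lambda>n. \<theta> n w)" by (simp add: exp_poly_growth_def \<theta>z)
      show "AE x in M. convergent (cesaro_mean (\<lambda>n. \<eta> n w x / \<theta> n w))"
        by (simp add: \<theta>z cesaro_mean_def[abs_def] convergent_const)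
    qed (use \<theta>z \<eta>z \<eta>_meas[OF w] in auto)
  qed
qed

text \<open>The rate \<open>a\<close> of the total input is compared with the rate 1 of the
  component: decay means a summable input, equality gains one power of \<open>n\<close>, and growth
  leads to the contraction argument.\<close>

lemma recursion_regular_bounded:
  assumes reg: "\<And>w. w \<in> C \<Longrightarrow> cesaro_regular M (\<lambda>n. z n w) (\<lambda>n. \<zeta> n w)" and w: "w \<in> C"
  shows "cesaro_regular M (\<lambda>n. \<theta> n w) (\<lambda>n. \<eta> n w)"
proof -
  define \<Gamma> where "\<Gamma> n = (\<Sum>v\<in>C. z n v)" for n
  have "cesaro_regular M (\<lambda>n. \<Sum>v\<in>C. z n v) (\<lambda>n x. \<Sum>v\<in>C. \<zeta> n v x)"
    by (rule cesaro_regular_sum[OF finC reg])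
  then have g: "exp_poly_growth \<Gamma>" by (simp add: cesaro_regular_def \<Gamma>_def[abs_def])
  have z\<Gamma>: "z n w \<le> \<Gamma> n" if "w \<in> C" for n w
    unfolding \<Gamma>_def by (rule member_le_sum[OF that _ finC]) (use z_nonneg in auto)
  show ?thesis
  proof (cases "\<forall>\<^sub>F n in sequentially. \<Gamma> n = 0")
    case True
    then obtain N where N: "\<And>n. n \<ge> N \<Longrightarrow> \<Gamma> n = 0" by (auto simp: eventually_sequentially)
    have "summable \<Gamma>" by (rule summable_finite[of "{..<N}"]) (use N in auto)
    then show ?thesis unfolding \<Gamma>_def by (rule regular_summable_input[OF _ w])
  next
    case False
    obtain a k c where a: "a > 0" and c: "c > 0" and lim: "(\<lambda>n. \<Gamma> n / (a ^ n * real n ^ k)) \<longlonglongrightarrow> c"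
      by (rule exp_poly_growthE[OF g False])
    have "\<exists>c'. 0 \<le> c' \<and> (\<lambda>n. z n w / (a ^ n * real n ^ k)) \<longlonglongrightarrow> c' \<and>
        (AE x in M. convergent (cesaro_mean (\<lambda>n. \<zeta> n w x / (a ^ n * real n ^ k))))" if "w \<in> C" for w
      by (rule cesaro_regular_scaled[OF reg[OF that] z\<Gamma>[OF that] a c lim]) blast
    then have "\<forall>w\<in>C. \<exists>c'. 0 \<le> c' \<and> (\<lambda>n. z n w / (a ^ n * real n ^ k)) \<longlonglongrightarrow> c' \<and>
        (AE x in M. convergent (cesaro_mean (\<lambda>n. \<zeta> n w x / (a ^ n * real n ^ k))))" by blast
    from bchoice[OF this] obtain c' where c': "\<And>w. w \<in> C \<Longrightarrow> 0 \<le> c' w"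
        "\<And>w. w \<in> C \<Longrightarrow> (\<lambda>n. z n w / (a ^ n * real n ^ k)) \<longlonglongrightarrow> c' w"
        "\<And>w. w \<in> C \<Longrightarrow> AE x in M. convergent (cesaro_mean (\<lambda>n. \<zeta> n w x / (a ^ n * real n ^ k)))"
      by blast
    have "(\<lambda>n. \<Sum>v\<in>C. z n v / (a ^ n * real n ^ k)) \<longlonglongrightarrow> (\<Sum>v\<in>C. c' v)" by (intro tendsto_sum c')
    then have "(\<Sum>v\<in>C. c' v) = c"
      using LIMSEQ_unique[OF lim] by (simp add: \<Gamma>_def sum_divide_distrib)
    then obtain v where v: "v \<in> C" "0 < c' v"
      using c sum_nonpos[of C c'] by force
    consider "a < 1" | "a = 1" | "a > 1" by linarith
    then show ?thesis
    proof cases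
      case 1
      \<comment> \<open>A rate strictly between \<open>a\<close> and 1 absorbs the factor
        \<open>n ^ k\<close>.\<close>
      define d where "d = (a + 1) / 2"
      have d: "a < d" "d < 1" using 1 by (auto simp: d_def)
      have "(\<lambda>n. (\<Gamma> n / (a ^ n * real n ^ k)) * ((a ^ n * real n ^ k) / (d ^ n * real n ^ 0))) \<longlonglongrightarrow> c * 0"
        by (intro tendsto_mult lim exp_poly_compare[OF a]) (use d in simp)
      then have "(\<lambda>n. (\<Gamma> n / (a ^ n * real n ^ k)) * ((a ^ n * real n ^ k) / (d ^ n * real n ^ 0))) \<longlonglongrightarrow> 0" by simp
      then have "\<forall>\<^sub>F n in sequentially. (\<Gamma> n / (a ^ n * real n ^ k)) * ((a ^ n * real n ^ k) / (d ^ n * real n ^ 0)) < 1"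
        by (rule order_tendstoD) simp
      then have "\<forall>\<^sub>F n in sequentially. norm (\<Gamma> n) \<le> d ^ n"
        using eventually_gt_at_top[of 0]
      proof eventually_elim
        case (elim n)
        have "0 \<le> \<Gamma> n" unfolding \<Gamma>_def by (intro sum_nonneg z_nonneg)
        moreover have "\<Gamma> n / d ^ n < 1" using elim a by simp
        ultimately show ?case using a d by (simp add: divide_less_eq)
      qed
      then have "summable \<Gamma>"
        by (rule summable_comparison_test_ev) (use a d in \<open>auto intro!: summable_geometric\<close>)
      then show ?thesis unfolding \<Gamma>_def by (rule regular_summable_input[OF _ w])
    next
      case 2
      have zl: "(\<lambda>n. z n w / real n ^ k) \<longlonglongrightarrow> c' w" if "w \<in> C" for w using c'(2)[OF that] 2 by simp
      define \<mu> where "\<mu> = (\<Sum>v\<in>C. m v * c' v)"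
      have \<mu>: "0 < \<mu>"
      proof -
        have "0 < m v * c' v" using v m_pos by simp
        also have "\<dots> \<le> \<mu>" unfolding \<mu>_def
          by (rule member_le_sum[OF v(1) _ finC]) (use c' m_nonneg in auto)
        finally show ?thesis .
      qed
      have "(\<lambda>n. \<Sum>v\<in>C. m v * (z n v / real n ^ k)) \<longlonglongrightarrow> \<mu>"
        unfolding \<mu>_def by (intro tendsto_sum tendsto_mult tendsto_const zl)
      then have "(\<lambda>n. (\<Sum>v\<in>C. m v * z n v) / real n ^ k) \<longlonglongrightarrow> \<mu>" by (simp add: sum_divide_distrib)
      then have S: "(\<lambda>N. (\<Sum>i<N. \<Sum>v\<in>C. m v * z i v) / real N ^ Suc k) \<longlonglongrightarrow> \<mu> / real (Suc k)"
        by (rule sum_asymp_power)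
      have "(\<lambda>N. T 0 * (1 / real N) ^ Suc k + (\<Sum>i<N. \<Sum>v\<in>C. m v * z i v) / real N ^ Suc k) \<longlonglongrightarrow> T 0 * 0 ^ Suc k + \<mu> / real (Suc k)"
        by (intro tendsto_add tendsto_mult tendsto_const tendsto_power lim_1_over_n S)
      moreover have "T 0 * (1 / real N) ^ Suc k + (\<Sum>i<N. \<Sum>v\<in>C. m v * z i v) / real N ^ Suc k = T N / real N ^ Suc k" for N
        by (simp add: T_eq[of N] power_divide add_divide_distrib)
      ultimately have TL: "(\<lambda>N. T N / real N ^ Suc k) \<longlonglongrightarrow> \<mu> / real (Suc k)" by simp
      show ?thesis
      \<comment> \<open>Accumulating an input of order \<open>n ^ k\<close> gives order
        \<open>n ^ (k + 1)\<close>, hence \<open>j = Suc k\<close>.\<close>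
      proof (rule regular_polynomial_growth[OF TL _ _ _ w])
        show "(\<lambda>n. z n w / real n ^ Suc k) \<longlonglongrightarrow> 0" if "w \<in> C" for w
        proof -
          have "(\<lambda>n. z n w / real n ^ k * (1 / real n)) \<longlonglongrightarrow> c' w * 0"
            by (intro tendsto_mult zl[OF that] lim_1_over_n)
          then show ?thesis by (simp add: mult.commute)
        qed
        show "AE x in M. convergent (\<lambda>N. (\<Sum>i<N. \<zeta> i w x) / real N ^ Suc k)" if "w \<in> C" for w
          using c'(3)[OF that]
        proof eventually_elim
          case (elim x)
          then have "convergent (cesaro_mean (\<lambda>n. \<zeta> n w x / real n ^ k))" using 2 by simp
          then show ?case by (rule convergent_sum_of_cesaro_mean_power)
        qed
      qed (use \<mu> in simp)
    next
      case 3
      show ?thesis by (rule regular_exponential_growth[OF 3 c'(2,1) v c'(3) w])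
    qed
  qed
qed

end

theorem recursion_regular:
  assumes reg: "\<And>w. w \<in> C \<Longrightarrow> cesaro_regular M (\<lambda>n. z n w) (\<lambda>n. \<zeta> n w)"
    and \<theta>_init: "\<And>w. w \<in> C \<Longrightarrow> 0 \<le> \<theta> 0 w"
    and \<theta>_rec: "\<And>n w. w \<in> C \<Longrightarrow> \<theta> (Suc n) w = P0 (\<theta> n) w + z n w"
    and \<eta>_init_meas: "\<And>w. w \<in> C \<Longrightarrow> \<eta> 0 w \<in> borel_measurable M"
    and \<eta>_init_le: "\<And>w x. w \<in> C \<Longrightarrow> x \<in> space M \<Longrightarrow> \<bar>\<eta> 0 w x\<bar> \<le> K * \<theta> 0 w"
    and \<eta>_rec: "\<And>n w x. w \<in> C \<Longrightarrow> x \<in> space M \<Longrightarrow> \<eta> (Suc n) w x = P (\<eta> n) w x + \<zeta> n w x"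
    and w: "w \<in> C"
  shows "cesaro_regular M (\<lambda>n. \<theta> n w) (\<lambda>n. \<eta> n w)"
proof -
  have "\<exists>k\<ge>0. \<forall>n. \<forall>x\<in>space M. \<bar>\<zeta> n w x\<bar> \<le> k * z n w" if "w \<in> C" for w
    by (rule cesaro_regularE[OF reg[OF that]]) blast
  then obtain k where k: "\<And>w. w \<in> C \<Longrightarrow> 0 \<le> k w"
      "\<And>n w x. w \<in> C \<Longrightarrow> x \<in> space M \<Longrightarrow> \<bar>\<zeta> n w x\<bar> \<le> k w * z n w" by metis
  have zn: "0 \<le> z n w" if "w \<in> C" for n w using reg[OF that] by (simp add: cesaro_regular_def)
  define L where "L = sum k C + \<bar>K\<bar>"
  have kL: "k w \<le> L" if "w \<in> C" for w
    using member_le_sum[OF that _ finC, of k] k(1) by (force simp: L_def)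
  have L0: "0 \<le> L" unfolding L_def by (intro add_nonneg_nonneg sum_nonneg k) auto
  have KL: "K \<le> L" unfolding L_def using sum_nonneg[of C k] k(1) by force
  show ?thesis
  proof (rule recursion_regular_bounded[of L z \<theta> \<zeta> \<eta>, OF L0 zn \<theta>_init \<theta>_rec _ _ \<eta>_init_meas _ \<eta>_rec reg w])
    show "\<bar>\<zeta> n w x\<bar> \<le> L * z n w" if "w \<in> C" "x \<in> space M" for n w x
      using k(2)[OF that, of n] mult_right_mono[OF kL[OF that(1)] zn[OF that(1), of n]] by linarith
    show "\<bar>\<eta> 0 w x\<bar> \<le> L * \<theta> 0 w" if "w \<in> C" "x \<in> space M" for w x
      using \<eta>_init_le[OF that] mult_right_mono[OF KL \<theta>_init[OF that(1)]] by linarith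
    show "\<zeta> n w \<in> borel_measurable M" if "w \<in> C" for n w
      using reg[OF that] by (simp add: cesaro_regular_def)
  qed
qed

end

section \<open>Components and graphs\<close>

lemma cesaro_regular_cong:
  assumes "cesaro_regular M b F" "\<And>n x. x \<in> space M \<Longrightarrow> F' n x = F n x"
  shows "cesaro_regular M b F'"
proof -
  have "F' n \<in> borel_measurable M \<longleftrightarrow> F n \<in> borel_measurable M" for n
    by (rule measurable_cong) (rule assms(2))
  moreover have "(AE x in M. convergent (cesaro_mean (\<lambda>n. F' n x / b n))) \<longleftrightarrow> (AE x in M. convergent (cesaro_mean (\<lambda>n. F n x / b n)))"
    by (rule AE_cong) (simp add: assms(2))
  ultimately show ?thesis using assms unfolding cesaro_regular_def by simp
qed

section \<open>Finite graphs: adjacency operators and Perron eigenvectors\<close>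

definition edge_op :: "'e set \<Rightarrow> ('e \<Rightarrow> 'v) \<Rightarrow> ('e \<Rightarrow> 'v) \<Rightarrow> ('v \<Rightarrow> real) \<Rightarrow> 'v \<Rightarrow> real" where
  "edge_op E src tgt f w = (\<Sum>e | e \<in> E \<and> tgt e = w. f (src e))"

definition edge_rel :: "'e set \<Rightarrow> ('e \<Rightarrow> 'v) \<Rightarrow> ('e \<Rightarrow> 'v) \<Rightarrow> ('v \<times> 'v) set" where
  "edge_rel E src tgt = (\<lambda>e. (src e, tgt e)) ` E"

lemma edge_relI: "e \<in> E \<Longrightarrow> (src e, tgt e) \<in> edge_rel E src tgt"
  by (auto simp: edge_rel_def)

lemma edge_relE:
  assumes "(v, w) \<in> edge_rel E src tgt"
  obtains e where "e \<in> E" "src e = v" "tgt e = w"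
  using assms by (auto simp: edge_rel_def)

lemma edge_rel_converse: "edge_rel E tgt src = (edge_rel E src tgt)\<inverse>"
  by (auto simp: edge_rel_def)

lemma finite_pointwise_convergent_subsequence:
  fixes y :: "nat \<Rightarrow> 'v \<Rightarrow> real"
  assumes "finite C" "\<And>n v. v \<in> C \<Longrightarrow> \<bar>y n v\<bar> \<le> K"
  shows "\<exists>r l. strict_mono (r :: nat \<Rightarrow> nat) \<and> (\<forall>v\<in>C. (\<lambda>n. y (r n) v) \<longlonglongrightarrow> l v)"
  using assms
proof (induction C rule: finite_induct)
  case empty
  show ?case by (intro exI[of _ id]) (simp add: strict_mono_id[unfolded id_def] id_def)
next
  case (insert a C)
  have "\<exists>r l. strict_mono (r :: nat \<Rightarrow> nat) \<and> (\<forall>v\<in>C. (\<lambda>n. y (r n) v) \<longlonglongrightarrow> l v)"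
    by (rule insert.IH) (use insert.prems in simp)
  then obtain r l where r: "strict_mono (r :: nat \<Rightarrow> nat)" "\<And>v. v \<in> C \<Longrightarrow> (\<lambda>n. y (r n) v) \<longlonglongrightarrow> l v" by blast
  have "bounded (range (\<lambda>n. y (r n) a))"
    unfolding bounded_iff using insert.prems by (intro exI[of _ K]) auto
  from bounded_imp_convergent_subsequence[OF this]
  obtain l' r' where r': "strict_mono r'" "((\<lambda>n. y (r n) a) \<circ> r') \<longlonglongrightarrow> l'" by blast
  have "(\<lambda>n. y (r (r' n)) v) \<longlonglongrightarrow> (l(a := l')) v" if "v \<in> insert a C" for v
  proof (cases "v = a")
    case True then show ?thesis using r'(2) by (simp add: o_def)
  next
    case False
    then have "(\<lambda>n. y (r n) v) \<longlonglongrightarrow> l v" using r(2) that by blast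
    from LIMSEQ_subseq_LIMSEQ[OF this r'(1)] show ?thesis using False by (simp add: o_def)
  qed
  moreover have "strict_mono (r \<circ> r')" using r(1) r'(1) by (rule strict_mono_o)
  ultimately show ?case by (intro exI[of _ "r \<circ> r'"] exI[of _ "l(a := l')"]) (simp add: o_def)
qed

locale edge_graph =
  fixes C :: "'v set" and E :: "'e set" and src tgt :: "'e \<Rightarrow> 'v"
  assumes finC: "finite C" and finE: "finite E"
    and src: "\<And>e. e \<in> E \<Longrightarrow> src e \<in> C" and tgt: "\<And>e. e \<in> E \<Longrightarrow> tgt e \<in> C"
begin

abbreviation "B \<equiv> edge_op E src tgt"

lemma finite_in [simp]: "finite {e \<in> E. tgt e = w}" using finE by simp

lemma B_diff: "B (\<lambda>v. f v - g v) = (\<lambda>w. B f w - B g w)"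
  by (simp add: edge_op_def sum_subtractf fun_eq_iff)

lemma B_scale: "B (\<lambda>v. c * f v) = (\<lambda>w. c * B f w)"
  by (simp add: edge_op_def sum_distrib_left fun_eq_iff)

lemma B_nonneg: "(\<And>v. v \<in> C \<Longrightarrow> 0 \<le> f v) \<Longrightarrow> 0 \<le> B f w"
  unfolding edge_op_def by (intro sum_nonneg) (use src in auto)

lemma Bn_nonneg: "(\<And>v. v \<in> C \<Longrightarrow> 0 \<le> f v) \<Longrightarrow> w \<in> C \<Longrightarrow> 0 \<le> (B ^^ n) f w"
proof (induction n arbitrary: w)
  case (Suc n) then show ?case by (auto intro: B_nonneg)
qed simp

lemma Bn_diff: "(B ^^ n) (\<lambda>v. f v - g v) = (\<lambda>w. (B ^^ n) f w - (B ^^ n) g w)"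
  by (induction n) (simp_all add: B_diff)

lemma Bn_scale: "(B ^^ n) (\<lambda>v. c * f v) = (\<lambda>w. c * (B ^^ n) f w)"
  by (induction n) (simp_all add: B_scale)

lemma B_cong: "(\<And>v. v \<in> C \<Longrightarrow> f v = g v) \<Longrightarrow> B f w = B g w"
  unfolding edge_op_def by (intro sum.cong) (use src in auto)

lemma Bn_ge:
  assumes "\<And>v. v \<in> C \<Longrightarrow> 0 \<le> f v" "v \<in> C" "(v, w) \<in> (edge_rel E src tgt) ^^ n"
  shows "f v \<le> (B ^^ n) f w"
  using assms(3)
proof (induction n arbitrary: w)
  case (Suc n)
  then obtain e where e: "e \<in> E" "tgt e = w" "(v, src e) \<in> (edge_rel E src tgt) ^^ n"
    by (auto elim!: edge_relE)
  have "f v \<le> (B ^^ n) f (src e)" by (rule Suc.IH[OF e(3)])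
  also have "\<dots> \<le> B ((B ^^ n) f) w" unfolding edge_op_def[of E src tgt "(B ^^ n) f"]
    by (rule member_le_sum) (use e Bn_nonneg[OF assms(1)] src in auto)
  finally show ?case by simp
qed simp

text \<open>A loop at the end vertex prolongs a path by one, so the sum of the finitely many
  connecting lengths, plus 1, serves all pairs.\<close>

lemma uniform_path_length:
  assumes loops: "\<And>w. w \<in> C \<Longrightarrow> (w, w) \<in> edge_rel E src tgt"
    and conn: "\<And>v w. v \<in> C \<Longrightarrow> w \<in> C \<Longrightarrow> (v, w) \<in> (edge_rel E src tgt)\<^sup>*"
  shows "\<exists>q>0. \<forall>v\<in>C. \<forall>w\<in>C. (v, w) \<in> (edge_rel E src tgt) ^^ q"
proof -
  let ?r = "edge_rel E src tgt"
  have "\<forall>p\<in>C \<times> C. \<exists>n. p \<in> ?r ^^ n" using conn by (auto simp: rtrancl_power)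
  from bchoice[OF this] obtain N where N: "\<And>p. p \<in> C \<times> C \<Longrightarrow> p \<in> ?r ^^ N p" by blast
  define q where "q = Suc (\<Sum>p\<in>C \<times> C. N p)"
  have pad: "(v, w) \<in> ?r ^^ (n + k)" if "(v, w) \<in> ?r ^^ n" "w \<in> C" for v w n k
  proof (induction k)
    case (Suc k)
    then have "(v, w) \<in> ?r ^^ Suc (n + k)" using loops[OF that(2)] by (rule relpow_Suc_I)
    then show ?case by simp
  qed (use that in simp)
  have "(v, w) \<in> ?r ^^ q" if "v \<in> C" "w \<in> C" for v w
  proof -
    have "N (v, w) \<le> (\<Sum>p\<in>C \<times> C. N p)" using that finC by (intro member_le_sum) auto
    then have "N (v, w) \<le> q" by (simp add: q_def)
    then show ?thesis using pad[OF N[of "(v, w)"], of "q - N (v, w)"] that by simp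
  qed
  then show ?thesis by (intro exI[of _ q]) (simp add: q_def)
qed

text \<open>The Perron eigenvalue is the largest \<open>t\<close> admitting a probability vector \<open>y\<close> with \<open>t y \<le> B y\<close>
  (Collatz--Wielandt).\<close>

lemma perron_eigenvector:
  assumes ne: "C \<noteq> {}" and q: "q > 0"
    and conn: "\<And>v w. v \<in> C \<Longrightarrow> w \<in> C \<Longrightarrow> (v, w) \<in> (edge_rel E src tgt) ^^ q"
  shows "\<exists>a>0. \<exists>h. (\<forall>w\<in>C. h w > 0) \<and> (\<forall>w\<in>C. B h w = a * h w)"
proof -
  define A where "A = {t. \<exists>y. (\<forall>v\<in>C. 0 \<le> y v) \<and> sum y C = 1 \<and> (\<forall>w\<in>C. t * y w \<le> B y w)}"
  have pos: "0 < (B ^^ q) f w" if "\<And>v. v \<in> C \<Longrightarrow> 0 \<le> f v" "v \<in> C" "0 < f v" "w \<in> C" for f v w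
  proof -
    have "f v \<le> (B ^^ q) f w" by (rule Bn_ge) (use that conn in auto)
    then show ?thesis using that(3) by simp
  qed
  have le1: "y v \<le> 1" if "\<forall>v\<in>C. 0 \<le> y v" "sum y C = 1" "v \<in> C" for y :: "'v \<Rightarrow> real" and v
    using member_le_sum[OF that(3) _ finC, of y] that by auto
  have bdd: "t \<le> real (card E)" if "t \<in> A" for t
  proof -
    obtain y where y: "\<forall>v\<in>C. 0 \<le> y v" "sum y C = 1" "\<forall>w\<in>C. t * y w \<le> B y w" using \<open>t \<in> A\<close> by (auto simp: A_def)
    have "t = (\<Sum>w\<in>C. t * y w)" using y(2) by (simp add: sum_distrib_left[symmetric])
    also have "\<dots> \<le> (\<Sum>w\<in>C. B y w)" using y(3) by (intro sum_mono) auto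
    also have "\<dots> = (\<Sum>e\<in>E. y (src e))" unfolding edge_op_def by (rule sum.group) (use finC finE tgt in auto)
    also have "\<dots> \<le> (\<Sum>e\<in>E. 1)" by (intro sum_mono le1[OF y(1,2)] src)
    finally show ?thesis by simp
  qed
  have A0: "0 \<in> A"
  proof -
    obtain v where v: "v \<in> C" using ne by blast
    have s: "sum (\<lambda>u. if u = v then 1 else 0 :: real) C = 1" using finC v by simp
    show ?thesis unfolding A_def
      by (rule CollectI, rule exI[of _ "\<lambda>u. if u = v then 1 else 0"]) (use s in \<open>auto intro!: B_nonneg\<close>)
  qed
  define a where "a = Sup A"
  have bA: "bdd_above A" using bdd by (meson bdd_aboveI)
  have "a \<in> closure A" unfolding a_def by (rule closure_contains_Sup) (use A0 bA in auto)
  then obtain t where t: "\<And>n. t n \<in> A" "t \<longlonglongrightarrow> a" unfolding closure_sequential by blast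
  have "\<forall>n. \<exists>y. (\<forall>v\<in>C. 0 \<le> y v) \<and> sum y C = 1 \<and> (\<forall>w\<in>C. t n * y w \<le> B y w)" using t(1) by (auto simp: A_def)
  from choice[OF this] obtain y where y: "\<And>n v. v \<in> C \<Longrightarrow> 0 \<le> y n v" "\<And>n. sum (y n) C = 1" "\<And>n w. w \<in> C \<Longrightarrow> t n * y n w \<le> B (y n) w"
    by blast
  \<comment> \<open>Compactness of the simplex turns the near-optimal vectors into an optimal
    one.\<close>
  obtain r h where r: "strict_mono (r :: nat \<Rightarrow> nat)" and hl: "\<And>v. v \<in> C \<Longrightarrow> (\<lambda>n. y (r n) v) \<longlonglongrightarrow> h v"
    using finite_pointwise_convergent_subsequence[OF finC, of y 1] le1 y(1,2) by force
  have h0: "0 \<le> h v" if "v \<in> C" for v using hl[OF that] y(1)[OF that] by (meson LIMSEQ_le_const)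
  have h1: "sum h C = 1"
  proof (rule LIMSEQ_unique)
    show "(\<lambda>n. sum (y (r n)) C) \<longlonglongrightarrow> sum h C" by (intro tendsto_sum hl)
    show "(\<lambda>n. sum (y (r n)) C) \<longlonglongrightarrow> 1" by (simp add: y(2))
  qed
  have Bl: "(\<lambda>n. B (y (r n)) w) \<longlonglongrightarrow> B h w" for w
    unfolding edge_op_def by (intro tendsto_sum hl) (use src in auto)
  have tl: "(\<lambda>n. t (r n)) \<longlonglongrightarrow> a" using LIMSEQ_subseq_LIMSEQ[OF t(2) r] by (simp add: o_def)
  have ah: "a * h w \<le> B h w" if "w \<in> C" for w
    by (rule LIMSEQ_le[OF tendsto_mult[OF tl hl[OF that]] Bl]) (use y(3)[OF that] in auto)
  obtain v0 where v0: "v0 \<in> C" "0 < h v0"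
    using h1 sum_nonpos[of C h] by force
  have zpos: "0 < (B ^^ q) h w" if "w \<in> C" for w by (rule pos[of h v0]) (use h0 v0 that in auto)
  have eq: "B h w = a * h w" if w: "w \<in> C" for w
  proof (rule ccontr)
    assume "B h w \<noteq> a * h w"
    then have w0: "0 < B h w - a * h w" using ah[OF w] by simp
    \<comment> \<open>A defect at one vertex becomes positive everywhere under
      \<open>B ^^ q\<close>, so \<open>z = (B ^^ q) h\<close> satisfies
      \<open>(a + \<epsilon>) * z \<le> B z\<close> for some positive \<open>\<epsilon>\<close>,
      against the maximality of \<open>a\<close>.\<close>
    define d where "d v = B h v - a * h v" for v
    have dpos: "0 < (B ^^ q) d v" if "v \<in> C" for v
      by (rule pos[of d w]) (use w ah w0 that in \<open>auto simp: d_def\<close>)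
    define z where "z = (B ^^ q) h"
    have comm: "B z v - a * z v = (B ^^ q) d v" for v
    proof -
      have "(B ^^ q) d = (\<lambda>v. (B ^^ q) (B h) v - a * (B ^^ q) h v)"
        unfolding d_def[abs_def] by (simp only: Bn_diff Bn_scale)
      moreover have "(B ^^ q) (B h) = B ((B ^^ q) h)" by (simp add: funpow_swap1)
      ultimately show ?thesis by (simp add: z_def)
    qed
    define \<epsilon> where "\<epsilon> = Min ((\<lambda>v. (B ^^ q) d v / z v) ` C)"
    have \<epsilon>: "0 < \<epsilon>" unfolding \<epsilon>_def using finC ne dpos zpos by (subst Min_gr_iff) (auto simp: z_def)
    have \<epsilon>le: "\<epsilon> * z v \<le> (B ^^ q) d v" if "v \<in> C" for v
    proof -
      have "\<epsilon> \<le> (B ^^ q) d v / z v" unfolding \<epsilon>_def using finC that by (intro Min_le) auto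
      then show ?thesis using zpos[OF that] by (simp add: z_def le_divide_eq)
    qed
    have sz: "0 < sum z C" using finC ne zpos by (intro sum_pos) (auto simp: z_def)
    have "a + \<epsilon> \<in> A" unfolding A_def
    proof (intro CollectI exI[of _ "\<lambda>v. (1 / sum z C) * z v"] conjI ballI)
      show "0 \<le> (1 / sum z C) * z v" if "v \<in> C" for v
        using sz zpos[OF that] by (simp add: z_def)
      show "(\<Sum>v\<in>C. (1 / sum z C) * z v) = 1" using sz by (simp add: sum_divide_distrib[symmetric])
      fix v assume v: "v \<in> C"
      have "(a + \<epsilon>) * z v \<le> B z v" using \<epsilon>le[OF v] comm[of v] by (simp add: distrib_right)
      then have "(1 / sum z C) * ((a + \<epsilon>) * z v) \<le> (1 / sum z C) * B z v" using sz by (intro mult_left_mono) auto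
      then show "(a + \<epsilon>) * ((1 / sum z C) * z v) \<le> B (\<lambda>v. (1 / sum z C) * z v) v"
        by (simp only: B_scale) (simp add: mult_ac)
    qed
    then have "a + \<epsilon> \<le> a" unfolding a_def by (rule cSup_upper[OF _ bA])
    then show False using \<epsilon> by simp
  qed
  have a0: "0 \<le> a" unfolding a_def by (rule cSup_upper[OF A0 bA])
  have iter: "(B ^^ n) h w = a ^ n * h w" if "w \<in> C" for n w
    using that
  proof (induction n arbitrary: w)
    case (Suc n)
    have "B ((B ^^ n) h) w = B (\<lambda>v. a ^ n * h v) w" by (rule B_cong) (rule Suc.IH)
    also have "\<dots> = a ^ n * (a * h w)" by (simp only: B_scale eq[OF Suc.prems])
    finally show ?case by (simp add: mult_ac)
  qed simp
  have hp: "0 < h w" "0 < a" if "w \<in> C" for w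
  proof -
    have *: "0 < a ^ q * h w" using zpos[OF that] iter[OF that] by simp
    then show "0 < h w" using a0 by (simp add: zero_less_mult_iff)
    \<comment> \<open>This uses \<open>q > 0\<close>, since \<open>0 ^ 0 = 1\<close>.\<close>
    have "a \<noteq> 0" using * q by (auto simp: power_0_left)
    then show "0 < a" using a0 by simp
  qed
  show ?thesis using hp eq v0(1) by blast
qed

end

text \<open>Doob transform: conjugation by the Perron vector \<open>h\<close> and division by the
  eigenvalue make the adjacency operator Markov. The Perron vector \<open>l\<close> of the reversed
  graph, multiplied by \<open>h\<close>, gives the stationary weights.\<close>

lemma component_regular:
  fixes C :: "'v set" and E :: "'e set" and src tgt :: "'e \<Rightarrow> 'v" and \<tau> :: "'e \<Rightarrow> 'x \<Rightarrow> 'x"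
  assumes prob: "prob_space M" and G: "edge_graph C E src tgt" and ne: "C \<noteq> {}"
    and meas: "\<And>e. e \<in> E \<Longrightarrow> \<tau> e \<in> M \<rightarrow>\<^sub>M M" and pres: "\<And>e. e \<in> E \<Longrightarrow> distr M M (\<tau> e) = M"
    and loops: "\<And>w. w \<in> C \<Longrightarrow> (w, w) \<in> edge_rel E src tgt"
    and conn: "\<And>v w. v \<in> C \<Longrightarrow> w \<in> C \<Longrightarrow> (v, w) \<in> (edge_rel E src tgt)\<^sup>*"
    and reg: "\<And>w. w \<in> C \<Longrightarrow> cesaro_regular M (\<lambda>n. \<gamma> n w) (\<lambda>n. g n w)"
    and b_init: "\<And>w. w \<in> C \<Longrightarrow> 0 \<le> b 0 w"
    and b_rec: "\<And>n w. w \<in> C \<Longrightarrow> b (Suc n) w = (\<Sum>e | e \<in> E \<and> tgt e = w. b n (src e)) + \<gamma> n w"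
    and F_init_meas: "\<And>w. w \<in> C \<Longrightarrow> F 0 w \<in> borel_measurable M"
    and F_init_le: "\<And>w x. w \<in> C \<Longrightarrow> x \<in> space M \<Longrightarrow> \<bar>F 0 w x\<bar> \<le> K * b 0 w"
    and F_rec: "\<And>n w x. w \<in> C \<Longrightarrow> x \<in> space M \<Longrightarrow>
      F (Suc n) w x = (\<Sum>e | e \<in> E \<and> tgt e = w. F n (src e) (\<tau> e x)) + g n w x"
    and w: "w \<in> C"
  shows "cesaro_regular M (\<lambda>n. b n w) (\<lambda>n. F n w)"
proof -
  interpret G: edge_graph C E src tgt by (rule G)
  interpret G': edge_graph C E tgt src by unfold_locales (use G.finC G.finE G.src G.tgt in auto)
  have "\<exists>q>0. \<forall>v\<in>C. \<forall>w\<in>C. (v, w) \<in> (edge_rel E src tgt) ^^ q"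
    by (rule G.uniform_path_length[OF loops conn])
  then obtain q where q: "q > 0" "\<And>v w. v \<in> C \<Longrightarrow> w \<in> C \<Longrightarrow> (v, w) \<in> (edge_rel E src tgt) ^^ q" by auto
  have "\<exists>q>0. \<forall>v\<in>C. \<forall>w\<in>C. (v, w) \<in> (edge_rel E tgt src) ^^ q"
  proof (rule G'.uniform_path_length)
    show "(w, w) \<in> edge_rel E tgt src" if "w \<in> C" for w
      unfolding edge_rel_converse[of E tgt src] using loops[OF that] by simp
    show "(v, w) \<in> (edge_rel E tgt src)\<^sup>*" if "v \<in> C" "w \<in> C" for v w
      unfolding edge_rel_converse[of E tgt src] using conn[OF that(2,1)] by (simp add: rtrancl_converse)
  qed
  then obtain q' where q': "q' > 0" "\<And>v w. v \<in> C \<Longrightarrow> w \<in> C \<Longrightarrow> (v, w) \<in> (edge_rel E tgt src) ^^ q'" by auto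
  obtain a h where a: "a > 0" and h: "\<And>w. w \<in> C \<Longrightarrow> h w > 0" and ah: "\<And>w. w \<in> C \<Longrightarrow> G.B h w = a * h w"
    using G.perron_eigenvector[OF ne q] by blast
  obtain a' l where a': "a' > 0" and l: "\<And>w. w \<in> C \<Longrightarrow> l w > 0" and al: "\<And>w. w \<in> C \<Longrightarrow> G'.B l w = a' * l w"
    using G'.perron_eigenvector[OF ne q'] by blast
  define Z where "Z = (\<Sum>w\<in>C. l w * h w)"
  have Z: "0 < Z" unfolding Z_def using G.finC ne l h by (intro sum_pos) auto
  \<comment> \<open>Evaluating the pairing of \<open>l\<close> with \<open>B h\<close> in two ways
    shows that the graph and its reversal have the same eigenvalue.\<close>
  have "a * Z = (\<Sum>w\<in>C. l w * G.B h w)" unfolding Z_def sum_distrib_left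
    by (intro sum.cong refl) (simp add: ah)
  also have "\<dots> = (\<Sum>w\<in>C. \<Sum>e | e \<in> E \<and> tgt e = w. l (tgt e) * h (src e))"
    unfolding edge_op_def sum_distrib_left by (intro sum.cong refl) auto
  also have "\<dots> = (\<Sum>e\<in>E. l (tgt e) * h (src e))"
    by (rule sum.group) (use G.finC G.finE G.tgt in auto)
  also have "\<dots> = (\<Sum>v\<in>C. \<Sum>e | e \<in> E \<and> src e = v. l (tgt e) * h (src e))"
    by (rule sum.group[symmetric]) (use G.finC G.finE G.src in auto)
  also have "\<dots> = (\<Sum>v\<in>C. G'.B l v * h v)"
    unfolding edge_op_def sum_distrib_right by (intro sum.cong refl) auto
  also have "\<dots> = a' * Z" unfolding Z_def sum_distrib_left by (intro sum.cong refl) (simp add: al)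
  finally have aa: "a' = a" using Z by simp
  define p where "p e = h (src e) / (a * h (tgt e))" for e
  define m where "m w = l w * h w / Z" for w
  define Q where "Q = (\<lambda>f w. \<Sum>e | e \<in> E \<and> tgt e = w. p e * f (src e))"
  have Qn: "(Q ^^ n) f w = (G.B ^^ n) (\<lambda>v. h v * f v) w / (a ^ n * h w)" if "w \<in> C" for n f w
    using that
  proof (induction n arbitrary: w)
    case 0 then show ?case using h[OF 0] by simp
  next
    case (Suc n)
    have "Q ((Q ^^ n) f) w = (\<Sum>e | e \<in> E \<and> tgt e = w. (G.B ^^ n) (\<lambda>v. h v * f v) (src e) / (a ^ Suc n * h w))"
      unfolding Q_def
    proof (intro sum.cong refl)
      fix e assume e: "e \<in> {e. e \<in> E \<and> tgt e = w}"
      then have "h (src e) > 0" using h G.src by auto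
      then show "p e * ((\<lambda>f w. \<Sum>e | e \<in> E \<and> tgt e = w. p e * f (src e)) ^^ n) f (src e)
        = (G.B ^^ n) (\<lambda>v. h v * f v) (src e) / (a ^ Suc n * h w)"
        using e Suc.IH[of "src e"] G.src by (auto simp: p_def Q_def field_simps)
    qed
    then show ?case by (simp add: edge_op_def[of E src tgt "(G.B ^^ n) (\<lambda>v. h v * f v)"] sum_divide_distrib)
  qed
  \<comment> \<open>Origin of the Doeblin constant: a path of length \<open>q\<close> from each
    \<open>v\<close> gives \<open>(B ^^ q) (h f) w \<ge> h v * f v\<close>; weighting by
    \<open>l v / Z\<close> and summing produces \<open>R\<close>, and \<open>H\<close> bounds the
    \<open>h w\<close> in the denominator.\<close>
  define R where "R = (\<Sum>v\<in>C. l v / Z)"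
  define H where "H = (\<Sum>v\<in>C. h v)"
  have R: "0 < R" unfolding R_def using G.finC ne l Z by (intro sum_pos) auto
  have H: "0 < H" unfolding H_def using G.finC ne h by (intro sum_pos) auto
  have hH: "h w \<le> H" if "w \<in> C" for w
    unfolding H_def by (rule member_le_sum[OF that _ G.finC]) (use h less_imp_le in blast)
  interpret D: doeblin_op M C E src tgt \<tau> p m q "1 / (a ^ q * H * R)"
  proof (intro doeblin_op.intro markov_op.intro doeblin_op_axioms.intro)
    show "prob_space M" "finite C" "finite E" by (fact prob G.finC G.finE)+
    show "src e \<in> C" "tgt e \<in> C" "\<tau> e \<in> M \<rightarrow>\<^sub>M M" "distr M M (\<tau> e) = M" if "e \<in> E" for e
      by (rule G.src[OF that] G.tgt[OF that] meas[OF that] pres[OF that])+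
    show "0 \<le> p e" if "e \<in> E" for e
      using h[OF G.src[OF that]] h[OF G.tgt[OF that]] a by (simp add: p_def)
    show "(\<Sum>e | e \<in> E \<and> tgt e = w. p e) = 1" if "w \<in> C" for w
    proof -
      have "(\<Sum>e | e \<in> E \<and> tgt e = w. p e) = (\<Sum>e | e \<in> E \<and> tgt e = w. h (src e)) / (a * h w)"
        by (simp add: p_def sum_divide_distrib)
      then show ?thesis using ah[OF that] a h[OF that] by (simp add: edge_op_def)
    qed
    show "0 < m w" if "w \<in> C" for w using l[OF that] h[OF that] Z by (simp add: m_def mult.assoc)
    show "(\<Sum>e | e \<in> E \<and> src e = v. p e * m (tgt e)) = m v" if "v \<in> C" for v
    proof -
      have "(\<Sum>e | e \<in> E \<and> src e = v. p e * m (tgt e)) = (\<Sum>e | e \<in> E \<and> src e = v. l (tgt e) * (h v / (a * Z)))"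
      proof (intro sum.cong refl)
        fix e assume e: "e \<in> {e. e \<in> E \<and> src e = v}"
        then have "h (tgt e) > 0" using h G.tgt by auto
        then show "p e * m (tgt e) = l (tgt e) * (h v / (a * Z))" using e a Z by (simp add: p_def m_def field_simps)
      qed
      also have "\<dots> = G'.B l v * (h v / (a * Z))" unfolding edge_op_def sum_distrib_right by (rule refl)
      also have "\<dots> = m v" using a Z by (simp add: al[OF that] aa m_def)
      finally show ?thesis .
    qed
    show "sum m C = 1" using Z by (simp add: m_def[abs_def] sum_divide_distrib[symmetric] Z_def)
    show "0 < 1 / (a ^ q * H * R)" using a H R by simp
    fix f :: "'v \<Rightarrow> real" and w assume f: "\<And>v. v \<in> C \<Longrightarrow> 0 \<le> f v" and w: "w \<in> C"
    let ?S = "(G.B ^^ q) (\<lambda>v. h v * f v) w"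
    have hf: "0 \<le> h v * f v" if "v \<in> C" for v using f[OF that] h[OF that] by simp
    have S0: "0 \<le> ?S" by (rule G.Bn_nonneg[OF hf w])
    have "(\<Sum>v\<in>C. m v * f v) = (\<Sum>v\<in>C. l v / Z * (h v * f v))" by (simp add: m_def mult.assoc)
    also have "\<dots> \<le> (\<Sum>v\<in>C. l v / Z * ?S)"
      by (intro sum_mono mult_left_mono G.Bn_ge[OF hf] q(2) w) (use l Z less_imp_le in \<open>auto intro: divide_nonneg_pos\<close>)
    also have "\<dots> = R * ?S" by (simp add: R_def sum_distrib_right)
    finally have "1 / (a ^ q * H * R) * (\<Sum>v\<in>C. m v * f v) \<le> 1 / (a ^ q * H * R) * (R * ?S)"
      using a H R by (intro mult_left_mono) auto
    also have "\<dots> = ?S / (a ^ q * H)" using R by simp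
    also have "\<dots> \<le> ?S / (a ^ q * h w)"
      using S0 a h[OF w] hH[OF w] by (intro divide_left_mono mult_left_mono) (auto simp: H)
    also have "\<dots> = (Q ^^ q) f w" by (simp add: Qn[OF w])
    finally show "1 / (a ^ q * H * R) * (\<Sum>v\<in>C. m v * f v)
       \<le> ((\<lambda>f w. \<Sum>e | e \<in> E \<and> tgt e = w. p e * f (src e)) ^^ q) f w" by (simp add: Q_def)
  qed
  \<comment> \<open>Along an arc this factor changes by exactly the weight \<open>p e\<close>. The
    input of step \<open>n\<close> enters at time \<open>n + 1\<close> and so carries
    \<open>s (Suc n)\<close>.\<close>
  define s where "s n v = (1 / a) ^ n * (1 / h v)" for n v
  have s_step: "s (Suc n) v * y = p e * (s n (src e) * y)" if "e \<in> E" "tgt e = v" for n v e y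
    using h[OF G.src[OF that(1)]] a that by (simp add: s_def p_def)
  have "cesaro_regular M (\<lambda>n. s n w * b n w) (\<lambda>n x. s n w * F n w x)"
  proof (rule D.recursion_regular[where \<theta>="\<lambda>n w. s n w * b n w" and \<eta>="\<lambda>n w x. s n w * F n w x"
        and z="\<lambda>n w. s (Suc n) w * \<gamma> n w" and \<zeta>="\<lambda>n w x. s (Suc n) w * g n w x" and K=K, OF _ _ _ _ _ _ w])
    fix w assume w: "w \<in> C"
    show "cesaro_regular M (\<lambda>n. s (Suc n) w * \<gamma> n w) (\<lambda>n x. s (Suc n) w * g n w x)"
      using cesaro_regular_scale[OF reg[OF w], of "1 / a" "1 / a * (1 / h w)"] a h[OF w] by (simp add: s_def mult_ac)
    show "0 \<le> s 0 w * b 0 w" using b_init[OF w] h[OF w] by (simp add: s_def)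
    show "(\<lambda>x. s 0 w * F 0 w x) \<in> borel_measurable M"
      by (intro borel_measurable_times borel_measurable_const F_init_meas w)
    show "s (Suc n) w * b (Suc n) w = D.P0 (\<lambda>w. s n w * b n w) w + s (Suc n) w * \<gamma> n w" for n
      unfolding b_rec[OF w] D.P0_def distrib_left sum_distrib_left
      by (intro arg_cong2[where f="(+)"] sum.cong refl s_step) auto
    fix x assume x: "x \<in> space M"
    show "\<bar>s 0 w * F 0 w x\<bar> \<le> K * (s 0 w * b 0 w)"
      using F_init_le[OF w x] h[OF w] by (simp add: s_def divide_right_mono)
    show "s (Suc n) w * F (Suc n) w x = D.P (\<lambda>w x. s n w * F n w x) w x + s (Suc n) w * g n w x" for n
      unfolding F_rec[OF w x] D.P_def distrib_left sum_distrib_left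
      by (intro arg_cong2[where f="(+)"] sum.cong refl s_step) auto
  qed
  from cesaro_regular_scale[OF this a h[OF w]]
  have "cesaro_regular M (\<lambda>n. a ^ n * h w * (s n w * b n w)) (\<lambda>n x. a ^ n * h w * (s n w * F n w x))" .
  moreover have "a ^ n * h w * (s n w * y) = y" for n y
    using a h[OF w] by (simp add: s_def power_one_over)
  ultimately show ?thesis by (simp add: eta_contract_eq)
qed

text \<open>Induction on the number of vertices from which \<open>w\<close> is reachable. It is
  strictly smaller at a vertex that leads to \<open>w\<close> but cannot be reached from
  \<open>w\<close>, so every input from outside the component is already known to be
  regular.\<close>

theorem graph_regular:
  fixes V :: "'v set" and E :: "'e set" and src tgt :: "'e \<Rightarrow> 'v" and \<tau> :: "'e \<Rightarrow> 'x \<Rightarrow> 'x"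
  assumes prob: "prob_space M" and G: "edge_graph V E src tgt"
    and meas: "\<And>e. e \<in> E \<Longrightarrow> \<tau> e \<in> M \<rightarrow>\<^sub>M M" and pres: "\<And>e. e \<in> E \<Longrightarrow> distr M M (\<tau> e) = M"
    and loops: "\<And>w. (w, w) \<in> (edge_rel E src tgt)\<^sup>+ \<Longrightarrow> (w, w) \<in> edge_rel E src tgt"
    and b_init: "\<And>w. w \<in> V \<Longrightarrow> 0 \<le> b 0 w"
    and b_rec: "\<And>n w. w \<in> V \<Longrightarrow> b (Suc n) w = (\<Sum>e | e \<in> E \<and> tgt e = w. b n (src e))"
    and F_init_meas: "\<And>w. w \<in> V \<Longrightarrow> F 0 w \<in> borel_measurable M"
    and F_init_le: "\<And>w x. w \<in> V \<Longrightarrow> x \<in> space M \<Longrightarrow> \<bar>F 0 w x\<bar> \<le> K * b 0 w"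
    and F_rec: "\<And>n w x. w \<in> V \<Longrightarrow> x \<in> space M \<Longrightarrow> F (Suc n) w x = (\<Sum>e | e \<in> E \<and> tgt e = w. F n (src e) (\<tau> e x))"
    and w: "w \<in> V"
  shows "cesaro_regular M (\<lambda>n. b n w) (\<lambda>n. F n w)"
proof -
  interpret G: edge_graph V E src tgt by (rule G)
  let ?r = "edge_rel E src tgt"
  define pre where "pre w = {u \<in> V. (u, w) \<in> ?r\<^sup>*}" for w
  show ?thesis using w
  proof (induction "card (pre w)" arbitrary: w rule: less_induct)
    case less
    note w = less.prems
    have IH: "cesaro_regular M (\<lambda>n. b n u) (\<lambda>n. F n u)" if u: "u \<in> V" "(u, w) \<in> ?r\<^sup>*" "(w, u) \<notin> ?r\<^sup>*" for u
    proof (rule less.hyps[OF _ u(1)])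
      have "pre u \<subseteq> pre w" using u(2) by (auto simp: pre_def)
      moreover have "w \<in> pre w" "w \<notin> pre u" using u(3) w by (auto simp: pre_def)
      ultimately have "pre u \<subset> pre w" by blast
      then show "card (pre u) < card (pre w)" by (rule psubset_card_mono[rotated]) (simp add: pre_def G.finC)
    qed
    have edge: "(src e, tgt e) \<in> ?r" if "e \<in> E" for e using that by (rule edge_relI)
    show ?case
    proof (cases "(w, w) \<in> ?r")
      \<comment> \<open>By \<open>loops\<close> no cycle passes through \<open>w\<close>, so all its
        predecessors come strictly earlier.\<close>
      case False
      show ?thesis
      proof (rule cesaro_regular_Suc)
        have "cesaro_regular M (\<lambda>n. \<Sum>e | e \<in> E \<and> tgt e = w. b n (src e)) (\<lambda>n x. \<Sum>e | e \<in> E \<and> tgt e = w. F n (src e) (\<tau> e x))"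
        proof (intro cesaro_regular_sum G.finite_in)
          fix e assume "e \<in> {e. e \<in> E \<and> tgt e = w}"
          then have e: "e \<in> E" "tgt e = w" by auto
          have "(w, src e) \<notin> ?r\<^sup>*"
          proof
            assume "(w, src e) \<in> ?r\<^sup>*"
            then have "(w, w) \<in> ?r\<^sup>+" using edge[OF e(1)] e(2) by (metis rtrancl_into_trancl1)
            then show False using False loops by blast
          qed
          moreover have "(src e, w) \<in> ?r\<^sup>*" using edge[OF e(1)] e(2) by (metis r_into_rtrancl)
          ultimately have "cesaro_regular M (\<lambda>n. b n (src e)) (\<lambda>n. F n (src e))" by (intro IH G.src e)
          then show "cesaro_regular M (\<lambda>n. b n (src e)) (\<lambda>n x. F n (src e) (\<tau> e x))"
            by (rule cesaro_regular_comp) (use meas pres e in auto)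
        qed
        then have reg: "cesaro_regular M (\<lambda>n. b (Suc n) w) (\<lambda>n x. \<Sum>e | e \<in> E \<and> tgt e = w. F n (src e) (\<tau> e x))"
          by (simp add: b_rec[OF w])
        show "cesaro_regular M (\<lambda>n. b (Suc n) w) (\<lambda>n. F (Suc n) w)"
          by (rule cesaro_regular_cong[OF reg]) (simp add: F_rec[OF w])
      qed (use b_init[OF w] F_init_meas[OF w] F_init_le[OF w] in auto)
    next
      case True
      define C where "C = {u \<in> V. (u, w) \<in> ?r\<^sup>* \<and> (w, u) \<in> ?r\<^sup>*}"
      define EC where "EC = {e \<in> E. src e \<in> C \<and> tgt e \<in> C}"
      have CV: "C \<subseteq> V" by (auto simp: C_def)
      have GC: "edge_graph C EC src tgt"
        by unfold_locales (use G.finC G.finE in \<open>auto simp: C_def EC_def\<close>)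
      have split: "(\<Sum>e | e \<in> E \<and> tgt e = u. f e) = (\<Sum>e | e \<in> EC \<and> tgt e = u. f e) + (\<Sum>e | e \<in> E \<and> tgt e = u \<and> src e \<notin> C. f e)"
        if "u \<in> C" for u and f :: "'e \<Rightarrow> real"
      proof -
        have "{e. e \<in> E \<and> tgt e = u} = {e. e \<in> EC \<and> tgt e = u} \<union> {e. e \<in> E \<and> tgt e = u \<and> src e \<notin> C}"
          using that by (auto simp: EC_def)
        then show ?thesis by (simp only:) (rule sum.union_disjoint, use G.finE in \<open>auto simp: EC_def\<close>)
      qed
      show ?thesis
      proof (rule component_regular[OF prob GC,
            where \<gamma>="\<lambda>n u. \<Sum>e | e \<in> E \<and> tgt e = u \<and> src e \<notin> C. b n (src e)"
              and g="\<lambda>n u x. \<Sum>e | e \<in> E \<and> tgt e = u \<and> src e \<notin> C. F n (src e) (\<tau> e x)" and \<tau>=\<tau>])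
        show "w \<in> C" using w by (simp add: C_def)
        then show "C \<noteq> {}" by blast
        fix u assume u: "u \<in> C"
        have uV: "u \<in> V" using u CV by blast
        show "(u, u) \<in> edge_rel EC src tgt"
        proof -
          have "(u, u) \<in> ?r\<^sup>+" using u True by (auto simp: C_def intro: rtrancl_trancl_trancl trancl_rtrancl_trancl)
          then have "(u, u) \<in> ?r" by (rule loops)
          then obtain e where "e \<in> E" "src e = u" "tgt e = u" by (rule edge_relE)
          then show ?thesis using u edge_relI[of e EC src tgt] by (simp add: EC_def)
        qed
        \<comment> \<open>A path between vertices of \<open>C\<close> stays in \<open>C\<close>:
          each vertex on it is reachable from \<open>w\<close> and leads back to
          \<open>w\<close>.\<close>
        show "(v, u) \<in> (edge_rel EC src tgt)\<^sup>*" if "v \<in> C" for v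
        proof -
          have "(v, u) \<in> ?r\<^sup>*" using that u by (auto simp: C_def intro: rtrancl_trans)
          then show ?thesis using that
          proof (induction rule: converse_rtrancl_induct)
            case (step y z)
            have "z \<in> C"
            proof -
              have "(w, z) \<in> ?r\<^sup>*" using step.prems step.hyps(1) by (auto simp: C_def intro: rtrancl_into_rtrancl)
              moreover have "(z, w) \<in> ?r\<^sup>*" using step.hyps(2) u by (auto simp: C_def intro: rtrancl_trans)
              moreover have "z \<in> V" using step.hyps(1) G.tgt by (auto elim: edge_relE)
              ultimately show ?thesis by (simp add: C_def)
            qed
            obtain e where "e \<in> E" "src e = y" "tgt e = z" using step.hyps(1) by (rule edge_relE)
            then have "(y, z) \<in> edge_rel EC src tgt"
              using edge_relI[of e EC src tgt] step.prems \<open>z \<in> C\<close> by (simp add: EC_def)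
            then show ?case using step.IH[OF \<open>z \<in> C\<close>] by (rule converse_rtrancl_into_rtrancl)
          qed simp
        qed
        show "cesaro_regular M (\<lambda>n. \<Sum>e | e \<in> E \<and> tgt e = u \<and> src e \<notin> C. b n (src e))
          (\<lambda>n x. \<Sum>e | e \<in> E \<and> tgt e = u \<and> src e \<notin> C. F n (src e) (\<tau> e x))"
        proof (rule cesaro_regular_sum)
          show "finite {e. e \<in> E \<and> tgt e = u \<and> src e \<notin> C}" using G.finE by simp
          fix e assume "e \<in> {e. e \<in> E \<and> tgt e = u \<and> src e \<notin> C}"
          then have e: "e \<in> E" "tgt e = u" "src e \<notin> C" by auto
          have "(src e, w) \<in> ?r\<^sup>*" using edge[OF e(1)] e(2) u by (auto simp: C_def intro: converse_rtrancl_into_rtrancl)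
          moreover then have "(w, src e) \<notin> ?r\<^sup>*" using e(3) G.src[OF e(1)] by (simp add: C_def)
          ultimately have "cesaro_regular M (\<lambda>n. b n (src e)) (\<lambda>n. F n (src e))" by (intro IH G.src e)
          then show "cesaro_regular M (\<lambda>n. b n (src e)) (\<lambda>n x. F n (src e) (\<tau> e x))"
            by (rule cesaro_regular_comp) (use meas pres e in auto)
        qed
        show "0 \<le> b 0 u" by (rule b_init[OF uV])
        show "b (Suc n) u = (\<Sum>e | e \<in> EC \<and> tgt e = u. b n (src e)) + (\<Sum>e | e \<in> E \<and> tgt e = u \<and> src e \<notin> C. b n (src e))" for n
          using b_rec[OF uV] split[OF u] by simp
        show "F 0 u \<in> borel_measurable M" by (rule F_init_meas[OF uV])
        show "\<bar>F 0 u x\<bar> \<le> K * b 0 u" if "x \<in> space M" for x by (rule F_init_le[OF uV that])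
        show "F (Suc n) u x = (\<Sum>e | e \<in> EC \<and> tgt e = u. F n (src e) (\<tau> e x))
           + (\<Sum>e | e \<in> E \<and> tgt e = u \<and> src e \<notin> C. F n (src e) (\<tau> e x))" if "x \<in> space M" for n x
          using F_rec[OF uV that] split[OF u, of "\<lambda>e. F n (src e) (\<tau> e x)"] by simp
      qed (use meas pres in \<open>auto simp: EC_def\<close>)
    qed
  qed
qed

section \<open>Convergence in the mean\<close>

text \<open>Jensen's inequality for weights of total \<open>t \<le> 1\<close>: normalise by
  \<open>t\<close>, then use \<open>t powr p \<le> t\<close>.\<close>

lemma powr_sum_le:
  fixes a f :: "'i \<Rightarrow> real"
  assumes "finite I" and a: "\<And>i. i \<in> I \<Longrightarrow> 0 \<le> a i" and s: "sum a I \<le> 1" and p: "1 \<le> p"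
  shows "\<bar>\<Sum>i\<in>I. a i * f i\<bar> powr p \<le> (\<Sum>i\<in>I. a i * \<bar>f i\<bar> powr p)"
proof -
  \<comment> \<open>Terms with weight or value zero contribute to neither side; without them all
    arguments of the power are positive, as is the normaliser when any term remains.\<close>
  define J where "J = {i\<in>I. 0 < a i \<and> f i \<noteq> 0}"
  have J: "finite J" "J \<subseteq> I" using assms by (auto simp: J_def)
  define t where "t = sum a J"
  have t1: "t \<le> 1" using sum_mono2[OF \<open>finite I\<close> J(2), of a] a s by (force simp: t_def)
  have eqJ: "(\<Sum>i\<in>I. a i * \<bar>f i\<bar> powr p) = (\<Sum>i\<in>J. a i * \<bar>f i\<bar> powr p)"
    by (rule sum.mono_neutral_right) (use assms J a in \<open>auto simp: J_def less_le\<close>)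
  have "\<bar>\<Sum>i\<in>I. a i * f i\<bar> \<le> (\<Sum>i\<in>I. a i * \<bar>f i\<bar>)"
    by (rule order_trans[OF sum_abs]) (auto intro!: sum_mono simp: abs_mult a)
  also have "\<dots> = (\<Sum>i\<in>J. a i * \<bar>f i\<bar>)"
    by (rule sum.mono_neutral_right) (use assms J a in \<open>auto simp: J_def less_le\<close>)
  finally have le: "\<bar>\<Sum>i\<in>I. a i * f i\<bar> powr p \<le> (\<Sum>i\<in>J. a i * \<bar>f i\<bar>) powr p"
    using p by (intro powr_mono2) auto
  show ?thesis
  proof (cases "J = {}")
    case True then show ?thesis using le p eqJ by simp
  next
    case False
    have t0: "0 < t" unfolding t_def using J False by (intro sum_pos) (auto simp: J_def)
    have "(\<Sum>i\<in>J. (a i / t) *\<^sub>R \<bar>f i\<bar>) powr p \<le> (\<Sum>i\<in>J. (a i / t) * (\<bar>f i\<bar> powr p))"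
    proof (rule convex_on_sum[OF J(1) False powr_convex[OF p]])
      show "(\<Sum>i\<in>J. a i / t) = 1" using t0 by (simp add: sum_divide_distrib[symmetric] t_def)
    qed (use t0 in \<open>auto simp: J_def\<close>)
    then have cv: "((\<Sum>i\<in>J. a i * \<bar>f i\<bar>) / t) powr p \<le> (\<Sum>i\<in>J. a i * \<bar>f i\<bar> powr p) / t"
      by (simp add: sum_divide_distrib)
    have S0: "0 \<le> (\<Sum>i\<in>J. a i * \<bar>f i\<bar>)" by (intro sum_nonneg) (auto simp: J_def)
    have "(\<Sum>i\<in>J. a i * \<bar>f i\<bar>) powr p = t powr p * ((\<Sum>i\<in>J. a i * \<bar>f i\<bar>) / t) powr p"
      using t0 S0 by (simp add: powr_divide)
    also have "\<dots> \<le> t powr p * ((\<Sum>i\<in>J. a i * \<bar>f i\<bar> powr p) / t)"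
      using cv by (intro mult_left_mono) auto
    also have "\<dots> \<le> t * ((\<Sum>i\<in>J. a i * \<bar>f i\<bar> powr p) / t)"
    proof (rule mult_right_mono)
      have "t powr p \<le> t powr 1" using t0 t1 p by (intro powr_mono') auto
      then show "t powr p \<le> t" using t0 by simp
      show "0 \<le> (\<Sum>i\<in>J. a i * \<bar>f i\<bar> powr p) / t" using t0 by (intro divide_nonneg_pos sum_nonneg) (auto simp: J_def)
    qed
    also have "\<dots> = (\<Sum>i\<in>J. a i * \<bar>f i\<bar> powr p)" using t0 by simp
    finally show ?thesis using le eqJ by simp
  qed
qed

lemma powr_abs_add_le:
  fixes x y p :: real
  assumes "0 \<le> p"
  shows "\<bar>x + y\<bar> powr p \<le> 2 powr p * (\<bar>x\<bar> powr p + \<bar>y\<bar> powr p)"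
proof -
  have "\<bar>x + y\<bar> powr p \<le> (2 * max \<bar>x\<bar> \<bar>y\<bar>) powr p" using assms by (intro powr_mono2) auto
  also have "\<dots> = 2 powr p * max \<bar>x\<bar> \<bar>y\<bar> powr p" by (simp add: powr_mult)
  also have "\<dots> \<le> 2 powr p * (\<bar>x\<bar> powr p + \<bar>y\<bar> powr p)"
    by (intro mult_left_mono) (auto simp: max_def)
  finally show ?thesis .
qed

lemma in_Lp_add:
  assumes "in_Lp M p f" "in_Lp M p g" "0 \<le> p"
  shows "in_Lp M p (\<lambda>x. f x + g x)"
proof -
  have [measurable]: "f \<in> borel_measurable M" "g \<in> borel_measurable M" using assms by (auto simp: in_Lp_def)
  have "integrable M (\<lambda>x. \<bar>f x + g x\<bar> powr p)"
  proof (rule Bochner_Integration.integrable_bound)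
    show "integrable M (\<lambda>x. 2 powr p * (\<bar>f x\<bar> powr p + \<bar>g x\<bar> powr p))"
      using assms by (auto simp: in_Lp_def)
    show "AE x in M. norm (\<bar>f x + g x\<bar> powr p) \<le> norm (2 powr p * (\<bar>f x\<bar> powr p + \<bar>g x\<bar> powr p))"
      using powr_abs_add_le[OF assms(3)] by (intro AE_I2) simp
  qed measurable
  then show ?thesis by (simp add: in_Lp_def)
qed

lemma in_Lp_minus: "in_Lp M p f \<Longrightarrow> in_Lp M p (\<lambda>x. - f x)"
  by (auto simp: in_Lp_def)

lemma in_Lp_diff:
  assumes "in_Lp M p f" "in_Lp M p g" "0 \<le> p"
  shows "in_Lp M p (\<lambda>x. f x - g x)"
  using in_Lp_add[OF assms(1) in_Lp_minus[OF assms(2)] assms(3)] by simp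

lemma in_Lp_bound:
  assumes "in_Lp M p g" "f \<in> borel_measurable M" "AE x in M. \<bar>f x\<bar> \<le> \<bar>g x\<bar>" "0 \<le> p"
  shows "in_Lp M p f"
proof -
  have [measurable]: "f \<in> borel_measurable M" by fact
  have "integrable M (\<lambda>x. \<bar>f x\<bar> powr p)"
  proof (rule Bochner_Integration.integrable_bound)
    show "integrable M (\<lambda>x. \<bar>g x\<bar> powr p)" using assms by (simp add: in_Lp_def)
    show "AE x in M. norm (\<bar>f x\<bar> powr p) \<le> norm (\<bar>g x\<bar> powr p)"
      using assms(3) by eventually_elim (use assms(4) in \<open>auto intro: powr_mono2\<close>)
  qed measurable
  then show ?thesis using assms(2) by (simp add: in_Lp_def)
qed

lemma integral_powr_add_le:
  assumes "in_Lp M p f" "in_Lp M p g" "0 \<le> p"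
  shows "(\<integral>x. \<bar>f x + g x\<bar> powr p \<partial>M) \<le> 2 powr p * ((\<integral>x. \<bar>f x\<bar> powr p \<partial>M) + (\<integral>x. \<bar>g x\<bar> powr p \<partial>M))"
proof -
  have "(\<integral>x. \<bar>f x + g x\<bar> powr p \<partial>M) \<le> (\<integral>x. 2 powr p * (\<bar>f x\<bar> powr p + \<bar>g x\<bar> powr p) \<partial>M)"
    by (rule integral_mono) (use in_Lp_add[OF assms] assms powr_abs_add_le in \<open>auto simp: in_Lp_def\<close>)
  then show ?thesis using assms by (simp add: in_Lp_def)
qed

lemma integral_powr_dominated:
  assumes g: "in_Lp M p g" and f: "\<And>n. f n \<in> borel_measurable M"
    and le: "\<And>n. AE x in M. \<bar>f n x\<bar> \<le> \<bar>g x\<bar>" and lim: "AE x in M. (\<lambda>n. f n x) \<longlonglongrightarrow> 0" and p: "0 < p"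
  shows "(\<lambda>n. \<integral>x. \<bar>f n x\<bar> powr p \<partial>M) \<longlonglongrightarrow> 0"
proof -
  have [measurable]: "f n \<in> borel_measurable M" for n by (rule f)
  have "(\<lambda>n. \<integral>x. \<bar>f n x\<bar> powr p \<partial>M) \<longlonglongrightarrow> (\<integral>x. 0 \<partial>M)"
  proof (rule integral_dominated_convergence[where w="\<lambda>x. \<bar>g x\<bar> powr p"])
    show "integrable M (\<lambda>x. \<bar>g x\<bar> powr p)" using g by (simp add: in_Lp_def)
    show "AE x in M. (\<lambda>n. \<bar>f n x\<bar> powr p) \<longlonglongrightarrow> 0"
      using lim
    proof eventually_elim
      case (elim x)
      then have "(\<lambda>n. \<bar>f n x\<bar>) \<longlonglongrightarrow> 0" by (rule tendsto_rabs_zero)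
      then show ?case using p by (intro tendsto_zero_powrI[where b=p]) auto
    qed
    show "AE x in M. norm (\<bar>f n x\<bar> powr p) \<le> \<bar>g x\<bar> powr p" for n
      using le[of n] by eventually_elim (use p in \<open>auto intro: powr_mono2\<close>)
  qed simp_all
  then show ?thesis by simp
qed

text \<open>Isolates what truncation uses: subprobability weights over measure-preserving maps and
  convergence for bounded functions. The total weight may be below 1, as happens when a sphere is
  empty.\<close>

locale weighted_averages = prob_space M for M :: "'x measure" +
  fixes J :: "nat \<Rightarrow> 'i set" and a :: "nat \<Rightarrow> 'i \<Rightarrow> real" and U :: "'i \<Rightarrow> 'x \<Rightarrow> 'x"
    and A :: "nat \<Rightarrow> ('x \<Rightarrow> real) \<Rightarrow> 'x \<Rightarrow> real"
  assumes A_eq: "\<And>N f x. A N f x = (\<Sum>i\<in>J N. a N i * f (U i x))"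
    and finJ: "\<And>N. finite (J N)" and a_nonneg: "\<And>N i. i \<in> J N \<Longrightarrow> 0 \<le> a N i"
    and a_sum: "\<And>N. sum (a N) (J N) \<le> 1"
    and U_meas: "\<And>i. U i \<in> M \<rightarrow>\<^sub>M M" and U_pres: "\<And>i. distr M M (U i) = M"
    and pointwise: "\<And>f K. f \<in> borel_measurable M \<Longrightarrow> (\<And>x. x \<in> space M \<Longrightarrow> \<bar>f x\<bar> \<le> K) \<Longrightarrow>
      AE x in M. convergent (\<lambda>N. A N f x)"
begin

lemma A_meas: "f \<in> borel_measurable M \<Longrightarrow> A N f \<in> borel_measurable M"
  unfolding A_eq[abs_def]
  by (intro borel_measurable_sum borel_measurable_times borel_measurable_const measurable_compose[OF U_meas])

lemma A_diff: "A N (\<lambda>x. f x - g x) x = A N f x - A N g x"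
  by (simp add: A_eq right_diff_distrib sum_subtractf)

lemma A_mono: "(\<And>x. x \<in> space M \<Longrightarrow> f x \<le> g x) \<Longrightarrow> x \<in> space M \<Longrightarrow> A N f x \<le> A N g x"
  unfolding A_eq by (intro sum_mono mult_left_mono) (auto intro: a_nonneg measurable_space[OF U_meas])

lemma A_bound:
  assumes "\<And>x. x \<in> space M \<Longrightarrow> \<bar>f x\<bar> \<le> K" "x \<in> space M"
  shows "\<bar>A N f x\<bar> \<le> K"
proof -
  have K0: "0 \<le> K" using assms abs_ge_zero order_trans by blast
  have "\<bar>A N f x\<bar> \<le> (\<Sum>i\<in>J N. a N i * K)" unfolding A_eq
    by (rule order_trans[OF sum_abs], rule sum_mono)
      (auto simp: abs_mult a_nonneg intro!: mult_left_mono assms measurable_space[OF U_meas] )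
  also have "\<dots> = sum (a N) (J N) * K" by (simp add: sum_distrib_right)
  also have "\<dots> \<le> 1 * K" using a_sum K0 by (intro mult_right_mono)
  finally show ?thesis by simp
qed

lemma U_integral:
  fixes f :: "'x \<Rightarrow> real"
  assumes "integrable M f"
  shows "integrable M (\<lambda>x. f (U i x))" "(\<integral>x. f (U i x) \<partial>M) = (\<integral>x. f x \<partial>M)"
proof -
  have f: "f \<in> borel_measurable M" using assms by auto
  have "integrable (distr M M (U i)) f" by (subst U_pres) (rule assms)
  then show "integrable M (\<lambda>x. f (U i x))" using integrable_distr_eq[OF U_meas f, of i] by simp
  show "(\<integral>x. f (U i x) \<partial>M) = (\<integral>x. f x \<partial>M)"
    using integral_distr[OF U_meas[of i] f] unfolding U_pres by simp
qed

text \<open>Jensen's inequality pointwise, then measure preservation for each map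
  \<open>U i\<close>.\<close>

lemma A_Lp:
  assumes "in_Lp M p f" "1 \<le> p"
  shows "in_Lp M p (A N f)" "(\<integral>x. \<bar>A N f x\<bar> powr p \<partial>M) \<le> (\<integral>x. \<bar>f x\<bar> powr p \<partial>M)"
proof -
  have f: "f \<in> borel_measurable M" and i: "integrable M (\<lambda>x. \<bar>f x\<bar> powr p)" using assms by (auto simp: in_Lp_def)
  have [measurable]: "A N f \<in> borel_measurable M" by (rule A_meas[OF f])
  have J: "\<bar>A N f x\<bar> powr p \<le> A N (\<lambda>x. \<bar>f x\<bar> powr p) x" for x
    unfolding A_eq by (rule powr_sum_le[OF finJ a_nonneg a_sum assms(2)])
  have Ai: "integrable M (A N (\<lambda>x. \<bar>f x\<bar> powr p))"
    unfolding A_eq[abs_def] by (intro Bochner_Integration.integrable_sum integrable_mult_right U_integral(1)[OF i])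
  have "integrable M (\<lambda>x. \<bar>A N f x\<bar> powr p)"
  proof (rule Bochner_Integration.integrable_bound[OF Ai])
    show "AE x in M. norm (\<bar>A N f x\<bar> powr p) \<le> norm (A N (\<lambda>x. \<bar>f x\<bar> powr p) x)"
      by (intro AE_I2) (simp add: order_trans[OF J abs_ge_self])
  qed measurable
  then show L: "in_Lp M p (A N f)" by (simp add: in_Lp_def)
  have "(\<integral>x. \<bar>A N f x\<bar> powr p \<partial>M) \<le> (\<integral>x. A N (\<lambda>x. \<bar>f x\<bar> powr p) x \<partial>M)"
    by (rule integral_mono[OF _ Ai]) (use L J in \<open>auto simp: in_Lp_def\<close>)
  also have "\<dots> = (\<Sum>i\<in>J N. a N i * (\<integral>x. \<bar>f x\<bar> powr p \<partial>M))"
    unfolding A_eq[abs_def] by (simp add: U_integral[OF i])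
  also have "\<dots> = sum (a N) (J N) * (\<integral>x. \<bar>f x\<bar> powr p \<partial>M)" by (simp add: sum_distrib_right)
  also have "\<dots> \<le> 1 * (\<integral>x. \<bar>f x\<bar> powr p \<partial>M)" using a_sum by (intro mult_right_mono) auto
  finally show "(\<integral>x. \<bar>A N f x\<bar> powr p \<partial>M) \<le> (\<integral>x. \<bar>f x\<bar> powr p \<partial>M)" by simp
qed

text \<open>For nonnegative \<open>\<phi>\<close> the truncations \<open>f k\<close> increase, hence
  so do the limits \<open>g k\<close> of their averages; bounded \<open>p\<close>-th moments and
  monotone convergence give \<open>\<psi>\<close> as a pointwise limit lying in \<open>L^p\<close>.
  Then \<open>A N \<phi> - \<psi>\<close> splits into the averaged truncation error, the bounded
  case, and \<open>g k - \<psi>\<close>.\<close>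

lemma Lp_convergence_nonneg:
  assumes Lp: "in_Lp M p \<phi>" and p: "1 \<le> p" and nn: "\<And>x. 0 \<le> \<phi> x"
  shows "\<exists>\<psi>. in_Lp M p \<psi> \<and> (\<lambda>N. \<integral>x. \<bar>A N \<phi> x - \<psi> x\<bar> powr p \<partial>M) \<longlonglongrightarrow> 0"
proof -
  have [measurable]: "\<phi> \<in> borel_measurable M" using Lp by (simp add: in_Lp_def)
  have p0: "0 \<le> p" "0 < p" using p by auto
  define f where "f k x = min (\<phi> x) (real k)" for k :: nat and x
  have fm [measurable]: "f k \<in> borel_measurable M" for k unfolding f_def[abs_def] by measurable
  have fb: "\<bar>f k x\<bar> \<le> real k" for k x using nn[of x] by (auto simp: f_def)
  have f0: "0 \<le> f k x" for k x using nn[of x] by (simp add: f_def)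
  have fLp: "in_Lp M p (f k)" for k by (rule in_Lp_bound[OF Lp fm _ p0(1)]) (use nn in \<open>auto simp: f_def\<close>)
  have Am [measurable]: "A N (f k) \<in> borel_measurable M" for N k by (rule A_meas[OF fm])
  have Ab: "\<bar>A N (f k) x\<bar> \<le> real k" if "x \<in> space M" for N k x by (rule A_bound[OF fb that])
  have A0: "0 \<le> A N (f k) x" for N k x unfolding A_eq by (intro sum_nonneg mult_nonneg_nonneg a_nonneg f0)
  define g where "g k x = rlimsup (\<lambda>N. A N (f k) x)" for k x
  have gm [measurable]: "g k \<in> borel_measurable M" for k unfolding g_def[abs_def] by (intro borel_measurable_rlimsup Am)
  have gb: "\<bar>g k x\<bar> \<le> real k" if "x \<in> space M" for k x unfolding g_def by (rule abs_rlimsup_le[OF Ab[OF that]])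
  have fconv: "AE x in M. convergent (\<lambda>N. A N (f k) x)" for k by (rule pointwise[OF fm fb])
  have glim: "AE x in M. (\<lambda>N. A N (f k) x) \<longlonglongrightarrow> g k x" for k
    using fconv[of k] AE_space
  proof eventually_elim
    case (elim x)
    then obtain L where L: "(\<lambda>N. A N (f k) x) \<longlonglongrightarrow> L" by (auto simp: convergent_def)
    have "g k x = L" unfolding g_def by (rule rlimsup_tendsto_eq[OF Ab[OF elim(2)] L])
    with L show ?case by simp
  qed
  have gmono: "g k x \<le> g (Suc k) x" if "x \<in> space M" for k x
    unfolding g_def by (rule rlimsup_mono[OF Ab[OF that] Ab[OF that]], rule A_mono[OF _ that]) (auto simp: f_def)
  have g0: "0 \<le> g k x" if "x \<in> space M" for k x
  proof -
    have "rlimsup (\<lambda>N. 0) \<le> rlimsup (\<lambda>N. A N (f k) x)"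
      by (rule rlimsup_mono[of _ 0 _ "real k"]) (use Ab[OF that] A0 in auto)
    moreover have "rlimsup (\<lambda>N. 0) = 0" by (rule rlimsup_tendsto_eq[of _ 0]) auto
    ultimately show ?thesis by (simp add: g_def)
  qed
  have gmono': "g k x \<le> g k' x" if "x \<in> space M" "k \<le> k'" for k k' x
    by (rule lift_Suc_mono_le[of "\<lambda>k. g k x", OF _ that(2)]) (rule gmono[OF that(1)])
  have const_Lp: "in_Lp M p (\<lambda>x. c)" for c by (simp add: in_Lp_def)
  have gLp: "in_Lp M p (g k)" for k by (rule in_Lp_bound[OF const_Lp[of "real k"] gm _ p0(1)]) (use gb in auto)
  have conv: "(\<lambda>N. \<integral>x. \<bar>A N (f k) x - g k x\<bar> powr p \<partial>M) \<longlonglongrightarrow> 0" for k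
  proof (rule integral_powr_dominated[OF const_Lp[of "2 * real k"]])
    show "AE x in M. \<bar>A N (f k) x - g k x\<bar> \<le> \<bar>2 * real k\<bar>" for N
      using AE_space
    proof eventually_elim
      case (elim x) show ?case using Ab[OF elim, of N k] gb[OF elim, of k] by linarith
    qed
    show "AE x in M. (\<lambda>n. A n (f k) x - g k x) \<longlonglongrightarrow> 0" using glim[of k] by eventually_elim (rule LIM_zero)
  qed (use p0 in auto)
  have gint: "(\<integral>x. \<bar>g k x\<bar> powr p \<partial>M) \<le> (\<integral>x. \<bar>\<phi> x\<bar> powr p \<partial>M)" for k
  proof -
    have "(\<lambda>N. \<integral>x. \<bar>A N (f k) x\<bar> powr p \<partial>M) \<longlonglongrightarrow> (\<integral>x. \<bar>g k x\<bar> powr p \<partial>M)"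
    proof (rule integral_dominated_convergence[where w="\<lambda>_. real k powr p"])
      show "AE x in M. (\<lambda>N. \<bar>A N (f k) x\<bar> powr p) \<longlonglongrightarrow> \<bar>g k x\<bar> powr p"
        using glim[of k]
      proof eventually_elim
        case (elim x)
        have "(\<lambda>N. \<bar>A N (f k) x\<bar>) \<longlonglongrightarrow> \<bar>g k x\<bar>" by (rule tendsto_rabs[OF elim])
        then show ?case using p0 by (intro tendsto_powr2 tendsto_const) auto
      qed
      show "AE x in M. norm (\<bar>A N (f k) x\<bar> powr p) \<le> real k powr p" for N
        using Ab p0 by (intro AE_I2) (auto intro: powr_mono2)
    qed simp_all
    moreover have "(\<integral>x. \<bar>A N (f k) x\<bar> powr p \<partial>M) \<le> (\<integral>x. \<bar>\<phi> x\<bar> powr p \<partial>M)" for N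
    proof -
      have "(\<integral>x. \<bar>A N (f k) x\<bar> powr p \<partial>M) \<le> (\<integral>x. \<bar>f k x\<bar> powr p \<partial>M)" by (rule A_Lp(2)[OF fLp p])
      also have "\<dots> \<le> (\<integral>x. \<bar>\<phi> x\<bar> powr p \<partial>M)"
        by (rule integral_mono) (use fLp Lp p0 nn in \<open>auto simp: in_Lp_def f_def intro!: powr_mono2\<close>)
      finally show ?thesis .
    qed
    ultimately show ?thesis by (meson LIMSEQ_le_const2)
  qed
  \<comment> \<open>\<open>g k\<close> is known to increase only on \<open>space M\<close>; the
    indicator makes \<open>G\<close> monotone at every point.\<close>
  define G where "G k x = ennreal (\<bar>g k x\<bar> powr p * indicator (space M) x)" for k x
  have Gm [measurable]: "G k \<in> borel_measurable M" for k unfolding G_def[abs_def] by measurable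
  have Gint: "integral\<^sup>N M (G k) \<le> ennreal (\<integral>x. \<bar>\<phi> x\<bar> powr p \<partial>M)" for k
  proof -
    have "integral\<^sup>N M (G k) = (\<integral>\<^sup>+x. ennreal (\<bar>g k x\<bar> powr p) \<partial>M)"
      by (rule nn_integral_cong) (simp add: G_def)
    also have "\<dots> = ennreal (\<integral>x. \<bar>g k x\<bar> powr p \<partial>M)"
      by (rule nn_integral_eq_integral) (use gLp[of k] in \<open>auto simp: in_Lp_def\<close>)
    finally show ?thesis using gint[of k] by (simp add: ennreal_leI)
  qed
  have "incseq G"
  proof (rule incseq_SucI, rule le_funI)
    fix k x
    show "G k x \<le> G (Suc k) x"
    proof (cases "x \<in> space M")
      case True
      have "\<bar>g k x\<bar> powr p \<le> \<bar>g (Suc k) x\<bar> powr p"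
        using gmono[OF True, of k] g0[OF True] p0 by (intro powr_mono2) auto
      then show ?thesis using True by (simp add: G_def ennreal_leI)
    qed (simp add: G_def)
  qed
  then have "(\<integral>\<^sup>+x. (SUP k. G k x) \<partial>M) = (SUP k. integral\<^sup>N M (G k))"
    by (rule nn_integral_monotone_convergence_SUP) measurable
  also have "\<dots> \<le> ennreal (\<integral>x. \<bar>\<phi> x\<bar> powr p \<partial>M)" by (rule SUP_least) (rule Gint)
  finally have Sfin: "(\<integral>\<^sup>+x. (SUP k. G k x) \<partial>M) \<le> ennreal (\<integral>x. \<bar>\<phi> x\<bar> powr p \<partial>M)" .
  then have "(\<integral>\<^sup>+x. (SUP k. G k x) \<partial>M) \<noteq> \<infinity>" by (metis ennreal_less_top infinity_ennreal_def leD)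
  then have AEfin: "AE x in M. (SUP k. G k x) \<noteq> \<infinity>" by (intro nn_integral_PInf_AE) measurable
  define \<psi> where "\<psi> x = lim (\<lambda>k. g k x)" for x
  have \<psi>m [measurable]: "\<psi> \<in> borel_measurable M" unfolding \<psi>_def[abs_def] by measurable
  have \<psi>lim: "AE x in M. (\<lambda>k. g k x) \<longlonglongrightarrow> \<psi> x"
    using AEfin AE_space
  proof eventually_elim
    case (elim x)
    obtain c where c: "(SUP k. G k x) = ennreal c" "0 \<le> c"
      using elim(1) by (metis ennreal_cases infinity_ennreal_def)
    have "g k x \<le> c powr (1 / p)" for k
    proof -
      have "G k x \<le> ennreal c" using c(1) by (metis SUP_upper UNIV_I)
      then have "\<bar>g k x\<bar> powr p \<le> c" using elim(2) c(2) by (simp add: G_def ennreal_le_iff)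
      then have "(\<bar>g k x\<bar> powr p) powr (1 / p) \<le> c powr (1 / p)" using p0 by (intro powr_mono2) auto
      then show ?thesis using p0 g0[OF elim(2), of k] by (simp add: powr_powr)
    qed
    then have ub: "\<forall>k. g k x \<le> c powr (1 / p)" by blast
    have "incseq (\<lambda>k. g k x)" using gmono'[OF elim(2)] by (simp add: incseq_def)
    from incseq_convergent[OF this ub] have "convergent (\<lambda>k. g k x)" by (auto simp: convergent_def)
    then show ?case unfolding \<psi>_def by (simp add: convergent_LIMSEQ_iff)
  qed
  have \<psi>ge: "AE x in M. \<forall>k. g k x \<le> \<psi> x"
    using \<psi>lim AE_space
  proof eventually_elim
    case (elim x)
    then show ?case using incseq_le[OF _ elim(1)] gmono'[OF elim(2)] by (simp add: incseq_def)
  qed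
  have \<psi>Lp: "in_Lp M p \<psi>"
  proof -
    have "(\<integral>\<^sup>+x. ennreal (norm (\<bar>\<psi> x\<bar> powr p)) \<partial>M) \<le> (\<integral>\<^sup>+x. (SUP k. G k x) \<partial>M)"
    proof (rule nn_integral_mono_AE)
      show "AE x in M. ennreal (norm (\<bar>\<psi> x\<bar> powr p)) \<le> (SUP k. G k x)"
        using \<psi>lim AE_space
      proof eventually_elim
        case (elim x)
        have "(\<lambda>k. \<bar>g k x\<bar> powr p) \<longlonglongrightarrow> \<bar>\<psi> x\<bar> powr p"
          using tendsto_rabs[OF elim(1)] p0 by (intro tendsto_powr2 tendsto_const) auto
        then have "(\<lambda>k. G k x) \<longlonglongrightarrow> ennreal (\<bar>\<psi> x\<bar> powr p)" using elim(2) by (simp add: G_def tendsto_ennrealI)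
        then have "ennreal (\<bar>\<psi> x\<bar> powr p) \<le> (SUP k. G k x)"
          by (rule LIMSEQ_le_const2) (intro exI[of _ 0] allI impI SUP_upper UNIV_I)
        then show ?case by simp
      qed
    qed
    then have "(\<integral>\<^sup>+x. ennreal (norm (\<bar>\<psi> x\<bar> powr p)) \<partial>M) < \<infinity>"
      using Sfin by (metis ennreal_less_top infinity_ennreal_def order_le_less_trans)
    then show ?thesis unfolding in_Lp_def by (auto intro!: integrableI_bounded)
  qed
  have t1: "(\<lambda>k. \<integral>x. \<bar>\<phi> x - f k x\<bar> powr p \<partial>M) \<longlonglongrightarrow> 0"
  proof (rule integral_powr_dominated[OF Lp])
    show "AE x in M. \<bar>\<phi> x - f k x\<bar> \<le> \<bar>\<phi> x\<bar>" for k using nn by (intro AE_I2) (auto simp: f_def min_def)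
    show "AE x in M. (\<lambda>k. \<phi> x - f k x) \<longlonglongrightarrow> 0"
    proof (rule AE_I2)
      fix x
      obtain k0 :: nat where k0: "\<phi> x \<le> real k0" using real_arch_simple by blast
      have "\<forall>\<^sub>F k in sequentially. \<phi> x - f k x = 0"
        using eventually_ge_at_top[of k0] by eventually_elim (use k0 in \<open>auto simp: f_def min_def\<close>)
      then show "(\<lambda>k. \<phi> x - f k x) \<longlonglongrightarrow> 0" by (rule tendsto_eventually)
    qed
  qed (use p0 in auto)
  have t3: "(\<lambda>k. \<integral>x. \<bar>g k x - \<psi> x\<bar> powr p \<partial>M) \<longlonglongrightarrow> 0"
  proof (rule integral_powr_dominated[OF \<psi>Lp])
    show "AE x in M. \<bar>g k x - \<psi> x\<bar> \<le> \<bar>\<psi> x\<bar>" for k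
      using \<psi>ge AE_space
    proof eventually_elim
      case (elim x) then show ?case using g0[OF elim(2), of k] by (auto simp: abs_le_iff dest: spec[of _ k])
    qed
    show "AE x in M. (\<lambda>k. g k x - \<psi> x) \<longlonglongrightarrow> 0" using \<psi>lim by eventually_elim (rule LIM_zero)
  qed (use p0 in auto)
  \<comment> \<open>Constant of the crude triangle inequality \<open>integral_powr_add_le\<close>,
    applied twice below.\<close>
  define c where "c = 2 powr p"
  have c: "1 \<le> c" using p0 by (simp add: c_def ge_one_powr_ge_zero)
  have main: "(\<integral>x. \<bar>A N \<phi> x - \<psi> x\<bar> powr p \<partial>M) \<le> c * (\<integral>x. \<bar>\<phi> x - f k x\<bar> powr p \<partial>M)
      + c * (c * ((\<integral>x. \<bar>A N (f k) x - g k x\<bar> powr p \<partial>M) + (\<integral>x. \<bar>g k x - \<psi> x\<bar> powr p \<partial>M)))" for N k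
  proof -
    have d: "in_Lp M p (\<lambda>x. \<phi> x - f k x)" by (rule in_Lp_diff[OF Lp fLp p0(1)])
    have 1: "in_Lp M p (A N (\<lambda>x. \<phi> x - f k x))" by (rule A_Lp(1)[OF d p])
    have 2: "in_Lp M p (\<lambda>x. A N (f k) x - g k x)" by (rule in_Lp_diff[OF A_Lp(1)[OF fLp p] gLp p0(1)])
    have 3: "in_Lp M p (\<lambda>x. g k x - \<psi> x)" by (rule in_Lp_diff[OF gLp \<psi>Lp p0(1)])
    have "(\<integral>x. \<bar>A N \<phi> x - \<psi> x\<bar> powr p \<partial>M)
      = (\<integral>x. \<bar>A N (\<lambda>x. \<phi> x - f k x) x + ((A N (f k) x - g k x) + (g k x - \<psi> x))\<bar> powr p \<partial>M)"
      by (simp add: A_diff)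
    also have "\<dots> \<le> c * ((\<integral>x. \<bar>A N (\<lambda>x. \<phi> x - f k x) x\<bar> powr p \<partial>M) + (\<integral>x. \<bar>(A N (f k) x - g k x) + (g k x - \<psi> x)\<bar> powr p \<partial>M))"
      unfolding c_def by (rule integral_powr_add_le[OF 1 in_Lp_add[OF 2 3 p0(1)] p0(1)])
    also have "\<dots> \<le> c * ((\<integral>x. \<bar>\<phi> x - f k x\<bar> powr p \<partial>M) + c * ((\<integral>x. \<bar>A N (f k) x - g k x\<bar> powr p \<partial>M) + (\<integral>x. \<bar>g k x - \<psi> x\<bar> powr p \<partial>M)))"
      using c integral_powr_add_le[OF 2 3 p0(1)] A_Lp(2)[OF d p, of N] unfolding c_def[symmetric]
      by (intro mult_left_mono add_mono) auto
    finally show ?thesis by (simp add: distrib_left)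
  qed
  have "(\<lambda>N. \<integral>x. \<bar>A N \<phi> x - \<psi> x\<bar> powr p \<partial>M) \<longlonglongrightarrow> 0"
  proof (rule LIMSEQ_I)
    fix e :: real assume e: "e > 0"
    have "(\<lambda>k. c * (\<integral>x. \<bar>\<phi> x - f k x\<bar> powr p \<partial>M) + c * (c * (\<integral>x. \<bar>g k x - \<psi> x\<bar> powr p \<partial>M))) \<longlonglongrightarrow> c * 0 + c * (c * 0)"
      by (intro tendsto_add tendsto_mult tendsto_const t1 t3)
    then have "\<forall>\<^sub>F k in sequentially. c * (\<integral>x. \<bar>\<phi> x - f k x\<bar> powr p \<partial>M) + c * (c * (\<integral>x. \<bar>g k x - \<psi> x\<bar> powr p \<partial>M)) < e / 2"
      by (rule order_tendstoD(2)) (use e in simp)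
    then obtain k where k: "c * (\<integral>x. \<bar>\<phi> x - f k x\<bar> powr p \<partial>M) + c * (c * (\<integral>x. \<bar>g k x - \<psi> x\<bar> powr p \<partial>M)) < e / 2"
      by (auto simp: eventually_sequentially)
    have "(\<lambda>N. c * (c * (\<integral>x. \<bar>A N (f k) x - g k x\<bar> powr p \<partial>M))) \<longlonglongrightarrow> c * (c * 0)"
      by (intro tendsto_mult tendsto_const conv)
    then have "\<forall>\<^sub>F N in sequentially. c * (c * (\<integral>x. \<bar>A N (f k) x - g k x\<bar> powr p \<partial>M)) < e / 2"
      by (rule order_tendstoD(2)) (use e in simp)
    then have "\<forall>\<^sub>F N in sequentially. norm ((\<integral>x. \<bar>A N \<phi> x - \<psi> x\<bar> powr p \<partial>M) - 0) < e"
    proof eventually_elim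
      case (elim N)
      have "(\<integral>x. \<bar>A N \<phi> x - \<psi> x\<bar> powr p \<partial>M) < e" using main[of N k] k elim by (simp add: distrib_left)
      moreover have "0 \<le> (\<integral>x. \<bar>A N \<phi> x - \<psi> x\<bar> powr p \<partial>M)" by simp
      ultimately show ?case by simp
    qed
    then show "\<exists>no. \<forall>n\<ge>no. norm ((\<integral>x. \<bar>A n \<phi> x - \<psi> x\<bar> powr p \<partial>M) - 0) < e" by (simp add: eventually_sequentially)
  qed
  then show ?thesis using \<psi>Lp by blast
qed

theorem Lp_convergence:
  assumes Lp: "in_Lp M p \<phi>" and p: "1 \<le> p"
  shows "\<exists>\<psi>. in_Lp M p \<psi> \<and> (\<lambda>N. \<integral>x. \<bar>A N \<phi> x - \<psi> x\<bar> powr p \<partial>M) \<longlonglongrightarrow> 0"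
proof -
  have [measurable]: "\<phi> \<in> borel_measurable M" using Lp by (simp add: in_Lp_def)
  have p0: "0 \<le> p" using p by simp
  define f where "f x = max 0 (\<phi> x)" for x
  define g where "g x = max 0 (- \<phi> x)" for x
  have fg: "\<phi> x = f x - g x" for x by (simp add: f_def g_def)
  have fm: "f \<in> borel_measurable M" "g \<in> borel_measurable M" unfolding f_def[abs_def] g_def[abs_def] by measurable
  have fLp: "in_Lp M p f" by (rule in_Lp_bound[OF Lp fm(1) _ p0]) (auto simp: f_def)
  have gLp: "in_Lp M p g" by (rule in_Lp_bound[OF Lp fm(2) _ p0]) (auto simp: g_def)
  obtain u where u: "in_Lp M p u" "(\<lambda>N. \<integral>x. \<bar>A N f x - u x\<bar> powr p \<partial>M) \<longlonglongrightarrow> 0"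
    using Lp_convergence_nonneg[OF fLp p] by (auto simp: f_def)
  obtain v where v: "in_Lp M p v" "(\<lambda>N. \<integral>x. \<bar>A N g x - v x\<bar> powr p \<partial>M) \<longlonglongrightarrow> 0"
    using Lp_convergence_nonneg[OF gLp p] by (auto simp: g_def)
  have le: "(\<integral>x. \<bar>A N \<phi> x - (u x - v x)\<bar> powr p \<partial>M)
    \<le> 2 powr p * ((\<integral>x. \<bar>A N f x - u x\<bar> powr p \<partial>M) + (\<integral>x. \<bar>A N g x - v x\<bar> powr p \<partial>M))" for N
  proof -
    have 1: "in_Lp M p (\<lambda>x. A N f x - u x)" by (rule in_Lp_diff[OF A_Lp(1)[OF fLp p] u(1) p0])
    have 2: "in_Lp M p (\<lambda>x. - (A N g x - v x))" by (rule in_Lp_minus[OF in_Lp_diff[OF A_Lp(1)[OF gLp p] v(1) p0]])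
    have "A N \<phi> x = A N f x - A N g x" for x unfolding A_diff[symmetric] by (simp add: A_eq fg)
    then have "A N \<phi> x - (u x - v x) = (A N f x - u x) + - (A N g x - v x)" for x by simp
    then have "(\<integral>x. \<bar>A N \<phi> x - (u x - v x)\<bar> powr p \<partial>M) = (\<integral>x. \<bar>(A N f x - u x) + - (A N g x - v x)\<bar> powr p \<partial>M)"
      by (simp only:)
    also have "\<dots> \<le> 2 powr p * ((\<integral>x. \<bar>A N f x - u x\<bar> powr p \<partial>M) + (\<integral>x. \<bar>- (A N g x - v x)\<bar> powr p \<partial>M))"
      by (rule integral_powr_add_le[OF 1 2 p0])
    finally show ?thesis by (simp only: abs_minus_cancel)
  qed
  have "(\<lambda>N. 2 powr p * ((\<integral>x. \<bar>A N f x - u x\<bar> powr p \<partial>M) + (\<integral>x. \<bar>A N g x - v x\<bar> powr p \<partial>M))) \<longlonglongrightarrow> 2 powr p * (0 + 0)"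
    by (intro tendsto_mult tendsto_add tendsto_const u v)
  then have lim: "(\<lambda>N. 2 powr p * ((\<integral>x. \<bar>A N f x - u x\<bar> powr p \<partial>M) + (\<integral>x. \<bar>A N g x - v x\<bar> powr p \<partial>M))) \<longlonglongrightarrow> 0"
    by simp
  have "(\<lambda>N. \<integral>x. \<bar>A N \<phi> x - (u x - v x)\<bar> powr p \<partial>M) \<longlonglongrightarrow> 0"
    by (rule tendsto_sandwich[OF _ _ tendsto_const lim]; intro always_eventually allI le) simp
  then show ?thesis using in_Lp_diff[OF u(1) v(1) p0] by blast
qed

end

section \<open>Path graphs and spherical averages\<close>

definition word_start :: "('e \<Rightarrow> 'v) \<Rightarrow> 'e list \<times> 'v \<Rightarrow> 'v" where
  "word_start src q = (case fst q of [] \<Rightarrow> snd q | e # _ \<Rightarrow> src e)"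

text \<open>The arcs of the \<open>d\<close>-th power of a graph: paths of length \<open>d\<close> together with their end point,
  the latter being needed for \<open>d = 0\<close>.\<close>

primrec power_arcs :: "'v set \<Rightarrow> 'e set \<Rightarrow> ('e \<Rightarrow> 'v) \<Rightarrow> ('e \<Rightarrow> 'v) \<Rightarrow> nat \<Rightarrow> ('e list \<times> 'v) set" where
  "power_arcs V E src tgt 0 = {[]} \<times> V"
| "power_arcs V E src tgt (Suc d) =
     (\<lambda>(q, e). (e # fst q, snd q)) ` (SIGMA q : power_arcs V E src tgt d. {e \<in> E. tgt e = word_start src q})"

context edge_graph
begin

abbreviation "arcs \<equiv> power_arcs C E src tgt"

lemma finite_arcs: "finite (arcs d)"
  by (induction d) (use finC finE in auto)

lemma snd_arcs: "q \<in> arcs d \<Longrightarrow> snd q \<in> C"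
  by (induction d arbitrary: q) auto

lemma start_arcs: "q \<in> arcs d \<Longrightarrow> word_start src q \<in> C"
  by (cases d) (auto simp: word_start_def src)

lemma set_arcs: "q \<in> arcs d \<Longrightarrow> set (fst q) \<subseteq> E"
  by (induction d arbitrary: q) fastforce+

lemma edge_rel_arcs:
  "(v, w) \<in> edge_rel (arcs d) (word_start src) snd \<longleftrightarrow> w \<in> C \<and> (v, w) \<in> edge_rel E src tgt ^^ d"
proof (induction d arbitrary: v)
  case 0
  show ?case by (auto simp: edge_rel_def word_start_def image_iff)
next
  case (Suc d)
  have "(v, w) \<in> edge_rel (arcs (Suc d)) (word_start src) snd \<longleftrightarrow>
      (\<exists>u. (v, u) \<in> edge_rel E src tgt \<and> (u, w) \<in> edge_rel (arcs d) (word_start src) snd)"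
  proof
    assume "(v, w) \<in> edge_rel (arcs (Suc d)) (word_start src) snd"
    then obtain q' where q': "q' \<in> arcs (Suc d)" "word_start src q' = v" "snd q' = w" by (rule edge_relE)
    then obtain q e where q: "q \<in> arcs d" "e \<in> E" "tgt e = word_start src q" "q' = (e # fst q, snd q)" by auto
    have "v = src e" "w = snd q" using q' q(4) by (auto simp: word_start_def)
    then show "\<exists>u. (v, u) \<in> edge_rel E src tgt \<and> (u, w) \<in> edge_rel (arcs d) (word_start src) snd"
      using edge_relI[OF q(2), of src tgt] edge_relI[OF q(1), of "word_start src" snd] q(3) by auto
  next
    assume "\<exists>u. (v, u) \<in> edge_rel E src tgt \<and> (u, w) \<in> edge_rel (arcs d) (word_start src) snd"
    then obtain e q where q: "e \<in> E" "src e = v" "q \<in> arcs d" "tgt e = word_start src q" "snd q = w"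
      by (auto elim!: edge_relE)
    then have "(e # fst q, snd q) \<in> arcs (Suc d)" by (auto intro!: image_eqI[of _ _ "(q, e)"])
    from edge_relI[OF this, of "word_start src" snd]
    show "(v, w) \<in> edge_rel (arcs (Suc d)) (word_start src) snd" using q by (simp add: word_start_def)
  qed
  also have "\<dots> \<longleftrightarrow> w \<in> C \<and> (\<exists>u. (v, u) \<in> edge_rel E src tgt \<and> (u, w) \<in> edge_rel E src tgt ^^ d)"
    using Suc.IH by blast
  also have "(\<exists>u. (v, u) \<in> edge_rel E src tgt \<and> (u, w) \<in> edge_rel E src tgt ^^ d) \<longleftrightarrow> (v, w) \<in> edge_rel E src tgt ^^ Suc d"
    \<comment> \<open>Arcs of the power graph grow by prepending, relational powers by appending;
      commutation reconciles the two.\<close>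
    unfolding relpow.simps(2) relpow_commute[symmetric] by blast
  finally show ?case .
qed

text \<open>Iterating the recursion \<open>d\<close> times is one step over the arcs of the
  \<open>d\<close>-th power. With \<open>foldr\<close> the last arc of a path acts first on
  \<open>x\<close>, as in the original recursion.\<close>

lemma power_recursion:
  fixes F :: "nat \<Rightarrow> 'v \<Rightarrow> 'x \<Rightarrow> real"
  assumes rec: "\<And>n w x. w \<in> C \<Longrightarrow> x \<in> X \<Longrightarrow> F (Suc n) w x = (\<Sum>e | e \<in> E \<and> tgt e = w. F n (src e) (S e x))"
    and S: "\<And>e x. e \<in> E \<Longrightarrow> x \<in> X \<Longrightarrow> S e x \<in> X" and w: "w \<in> C" and x: "x \<in> X"
  shows "F (n + d) w x = (\<Sum>q | q \<in> arcs d \<and> snd q = w. F n (word_start src q) (foldr S (fst q) x))"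
proof (induction d arbitrary: n)
  case 0
  have "{q. q \<in> arcs 0 \<and> snd q = w} = {([], w)}" using w by auto
  then show ?case by (simp add: word_start_def)
next
  case (Suc d)
  have X: "foldr S es x \<in> X" if "set es \<subseteq> E" for es
    using that by (induction es) (auto simp: x S)
  let ?I = "SIGMA q : {q. q \<in> arcs d \<and> snd q = w}. {e. e \<in> E \<and> tgt e = word_start src q}"
  have "F (n + Suc d) w x = F (Suc n + d) w x" by simp
  also have "\<dots> = (\<Sum>q | q \<in> arcs d \<and> snd q = w. F (Suc n) (word_start src q) (foldr S (fst q) x))" by (rule Suc)
  also have "\<dots> = (\<Sum>q | q \<in> arcs d \<and> snd q = w. \<Sum>e | e \<in> E \<and> tgt e = word_start src q. F n (src e) (S e (foldr S (fst q) x)))"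
    by (intro sum.cong refl rec X start_arcs set_arcs) auto
  also have "\<dots> = (\<Sum>(q, e)\<in>?I. F n (src e) (S e (foldr S (fst q) x)))"
    by (rule sum.Sigma) (use finite_arcs finE in auto)
  also have "\<dots> = (\<Sum>q\<in>(\<lambda>(q, e). (e # fst q, snd q)) ` ?I. F n (word_start src q) (foldr S (fst q) x))"
    by (subst sum.reindex) (auto simp: inj_on_def word_start_def prod_eq_iff intro!: sum.cong)
  also have "(\<lambda>(q, e). (e # fst q, snd q)) ` ?I = {q. q \<in> arcs (Suc d) \<and> snd q = w}" by (auto simp: image_iff)
  finally show ?case .
qed

text \<open>Repeating a cycle multiplies its length, so the product of one cycle length per vertex
  is attained at all of them.\<close>

lemma common_cycle_length:
  obtains d where "d > 0" "\<And>w. w \<in> C \<Longrightarrow> (w, w) \<in> (edge_rel E src tgt)\<^sup>+ \<Longrightarrow> (w, w) \<in> edge_rel E src tgt ^^ d"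
proof -
  let ?r = "edge_rel E src tgt"
  \<comment> \<open>The value 1 at vertices off all cycles leaves the product unchanged and
    positive.\<close>
  define l where "l w = (if (w, w) \<in> ?r\<^sup>+ then SOME n. n > 0 \<and> (w, w) \<in> ?r ^^ n else 1)" for w
  have l: "l w > 0 \<and> (w, w) \<in> ?r ^^ l w" if "(w, w) \<in> ?r\<^sup>+" for w
  proof -
    have "\<exists>n. n > 0 \<and> (w, w) \<in> ?r ^^ n" using that by (auto simp: trancl_power)
    then have "(SOME n. n > 0 \<and> (w, w) \<in> ?r ^^ n) > 0 \<and> (w, w) \<in> ?r ^^ (SOME n. n > 0 \<and> (w, w) \<in> ?r ^^ n)"
      by (rule someI_ex)
    then show ?thesis using that by (simp add: l_def)
  qed
  have l0: "l w > 0" for w using l[of w] by (cases "(w, w) \<in> ?r\<^sup>+") (auto simp: l_def)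
  have mult: "(w, w) \<in> ?r ^^ (n * k)" if "(w, w) \<in> ?r ^^ n" for w n k
  proof (induction k)
    case (Suc k)
    have "(w, w) \<in> ?r ^^ n O ?r ^^ (n * k)" using that Suc by blast
    then show ?case by (simp add: relpow_add[symmetric])
  qed simp
  have "(w, w) \<in> ?r ^^ prod l C" if "w \<in> C" "(w, w) \<in> ?r\<^sup>+" for w
  proof -
    have "l w dvd prod l C" using finC that(1) by (rule dvd_prodI)
    then obtain k where "prod l C = l w * k" by (auto simp: dvd_def)
    then show ?thesis using mult[of w "l w" k] l[OF that(2)] by simp
  qed
  moreover have "prod l C > 0" using l0 by (simp add: prod_pos)
  ultimately show ?thesis using that[of "prod l C"] by blast
qed

text \<open>On each residue class modulo \<open>d\<close> the recursion runs over the
  \<open>d\<close>-th power, where each vertex on a cycle has a loop by the choice of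
  \<open>d\<close>. The sums over vertices inherit regularity, and the residue classes are
  reassembled at the end.\<close>

lemma averages_convergent:
  fixes b :: "nat \<Rightarrow> 'v \<Rightarrow> real" and F :: "nat \<Rightarrow> 'v \<Rightarrow> 'x \<Rightarrow> real"
  assumes prob: "prob_space M"
    and meas: "\<And>e. e \<in> E \<Longrightarrow> S e \<in> M \<rightarrow>\<^sub>M M" and pres: "\<And>e. e \<in> E \<Longrightarrow> distr M M (S e) = M"
    and b_nonneg: "\<And>n w. w \<in> C \<Longrightarrow> 0 \<le> b n w"
    and b_rec: "\<And>n w. w \<in> C \<Longrightarrow> b (Suc n) w = (\<Sum>e | e \<in> E \<and> tgt e = w. b n (src e))"
    and F_meas: "\<And>n w. w \<in> C \<Longrightarrow> F n w \<in> borel_measurable M"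
    and F_le: "\<And>n w x. w \<in> C \<Longrightarrow> x \<in> space M \<Longrightarrow> \<bar>F n w x\<bar> \<le> K * b n w"
    and F_rec: "\<And>n w x. w \<in> C \<Longrightarrow> x \<in> space M \<Longrightarrow> F (Suc n) w x = (\<Sum>e | e \<in> E \<and> tgt e = w. F n (src e) (S e x))"
    and K: "0 \<le> K"
  shows "AE x in M. convergent (cesaro_mean (\<lambda>n. (\<Sum>w\<in>C. F n w x) / (\<Sum>w\<in>C. b n w)))"
proof -
  obtain d where d: "d > 0"
    and cyc: "\<And>w. w \<in> C \<Longrightarrow> (w, w) \<in> (edge_rel E src tgt)\<^sup>+ \<Longrightarrow> (w, w) \<in> edge_rel E src tgt ^^ d"
    by (rule common_cycle_length) blast
  let ?r = "edge_rel E src tgt" and ?rd = "edge_rel (arcs d) (word_start src) snd"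
  interpret D: edge_graph C "arcs d" "word_start src" snd
    by unfold_locales (use finC finite_arcs start_arcs snd_arcs in auto)
  have S_space: "S e x \<in> space M" if "e \<in> E" "x \<in> space M" for e x using measurable_space[OF meas] that by blast
  have fold: "foldr S es \<in> M \<rightarrow>\<^sub>M M \<and> distr M M (foldr S es) = M" if "set es \<subseteq> E" for es
    using that
  proof (induction es)
    case Nil
    show ?case using distr_id[of M] by (simp add: id_def)
  next
    case (Cons e es)
    then have 1: "foldr S es \<in> M \<rightarrow>\<^sub>M M" "distr M M (foldr S es) = M" "S e \<in> M \<rightarrow>\<^sub>M M" "distr M M (S e) = M"
      using meas pres by auto
    have "foldr S (e # es) = S e \<circ> foldr S es" by (simp add: fun_eq_iff)
    moreover have "distr (distr M M (foldr S es)) M (S e) = distr M M (S e \<circ> foldr S es)"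
      by (rule distr_distr[OF 1(3,1)])
    ultimately show ?case using 1 measurable_comp[OF 1(1,3)] by metis
  qed
  have loops: "(w, w) \<in> ?rd" if "(w, w) \<in> ?rd\<^sup>+" for w
  proof -
    \<comment> \<open>As \<open>d > 0\<close>, an arc of the power is a nonempty path of the graph,
      so cycles of the power come from cycles of the graph.\<close>
    have sub: "?rd \<subseteq> ?r\<^sup>+"
    proof (rule subrelI)
      fix v w assume "(v, w) \<in> ?rd"
      then show "(v, w) \<in> ?r\<^sup>+" using d by (auto simp: edge_rel_arcs trancl_power)
    qed
    have w: "w \<in> C" using that by (cases rule: tranclE) (auto simp: edge_rel_arcs)
    have "(w, w) \<in> (?r\<^sup>+)\<^sup>+" using trancl_mono[OF that sub] .
    then have "(w, w) \<in> ?r\<^sup>+" by simp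
    then show ?thesis using cyc[OF w] w by (simp add: edge_rel_arcs)
  qed
  have "AE x in M. convergent (cesaro_mean (\<lambda>m. (\<Sum>w\<in>C. F (d * m + r) w x) / (\<Sum>w\<in>C. b (d * m + r) w)))" for r
  proof -
    have "cesaro_regular M (\<lambda>m. b (d * m + r) w) (\<lambda>m. F (d * m + r) w)" if "w \<in> C" for w
    proof (rule graph_regular[OF prob D.edge_graph_axioms, where \<tau>="\<lambda>q. foldr S (fst q)" and K=K
          and b="\<lambda>m. b (d * m + r)" and F="\<lambda>m. F (d * m + r)"])
      show "foldr S (fst q) \<in> M \<rightarrow>\<^sub>M M" "distr M M (foldr S (fst q)) = M" if "q \<in> arcs d" for q
        using fold[OF set_arcs[OF that]] by auto
      show "(w, w) \<in> ?rd" if "(w, w) \<in> ?rd\<^sup>+" for w by (rule loops[OF that])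
      fix m w assume w: "w \<in> C"
      obtain x0 where x0: "x0 \<in> space M" using prob_space.not_empty[OF prob] by blast
      \<comment> \<open>The counts are treated as functions constant in \<open>x\<close>, with
        identity maps along the arcs; \<open>x0\<close> is only a point at which to evaluate
        them.\<close>
      show "b (d * Suc m + r) w = (\<Sum>q | q \<in> arcs d \<and> snd q = w. b (d * m + r) (word_start src q))"
        using power_recursion[of UNIV "\<lambda>n w x. b n w" "\<lambda>e x. x" w x0 "d * m + r" d] b_rec w
        by (simp add: add_ac)
      fix x assume x: "x \<in> space M"
      show "F (d * Suc m + r) w x = (\<Sum>q | q \<in> arcs d \<and> snd q = w. F (d * m + r) (word_start src q) (foldr S (fst q) x))"
        using power_recursion[of "space M" F S w x "d * m + r" d] F_rec S_space w x by (simp add: add_ac)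
    qed (use that b_nonneg F_meas F_le in auto)
    from cesaro_regular_sum[OF finC this] show ?thesis by (simp add: cesaro_regular_def)
  qed
  then have "AE x in M. \<forall>r. convergent (cesaro_mean (\<lambda>m. (\<Sum>w\<in>C. F (d * m + r) w x) / (\<Sum>w\<in>C. b (d * m + r) w)))"
    by (simp add: AE_all_countable)
  then show ?thesis using AE_space
  proof eventually_elim
    case (elim x)
    show ?case
    proof (rule convergent_cesaro_mean_residues[OF d, where K=K])
      show "\<bar>(\<Sum>w\<in>C. F n w x) / (\<Sum>w\<in>C. b n w)\<bar> \<le> K" for n
      proof (rule abs_quotient_le[OF _ _ K])
        show "\<bar>\<Sum>w\<in>C. F n w x\<bar> \<le> K * (\<Sum>w\<in>C. b n w)"
          unfolding sum_distrib_left by (rule order_trans[OF sum_abs sum_mono]) (rule F_le[OF _ elim(2)])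
        show "0 \<le> (\<Sum>w\<in>C. b n w)" by (intro sum_nonneg b_nonneg)
      qed
    qed (use elim(1) in blast)
  qed
qed

end

section \<open>Paths in the Markov graph and spherical averages\<close>

definition path_end :: "(nat \<Rightarrow> nat) \<Rightarrow> nat \<Rightarrow> nat list \<Rightarrow> nat" where
  "path_end tgt v0 p = (if p = [] then v0 else tgt (last p))"

definition paths_to :: "nat set \<Rightarrow> (nat \<Rightarrow> nat) \<Rightarrow> (nat \<Rightarrow> nat) \<Rightarrow> nat \<Rightarrow> nat \<Rightarrow> nat \<Rightarrow> nat list set" where
  "paths_to E src tgt v0 n w = {p \<in> graph_paths E src tgt v0. length p = n \<and> path_end tgt v0 p = w}"

lemma graph_paths_snoc:
  "p @ [e] \<in> graph_paths E src tgt v0 \<longleftrightarrow> p \<in> graph_paths E src tgt v0 \<and> e \<in> E \<and> path_end tgt v0 p = src e"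
proof (cases "p = []")
  case True then show ?thesis by (auto simp: graph_paths_def path_end_def)
next
  case False
  have "(\<forall>i. Suc i < length (p @ [e]) \<longrightarrow> tgt ((p @ [e]) ! i) = src ((p @ [e]) ! Suc i)) \<longleftrightarrow>
    (\<forall>i. Suc i < length p \<longrightarrow> tgt (p ! i) = src (p ! Suc i)) \<and> tgt (last p) = src e" (is "?L \<longleftrightarrow> ?R1 \<and> ?R2")
  proof (intro iffI conjI allI impI)
    fix i assume L: ?L and i: "Suc i < length p"
    then show "tgt (p ! i) = src (p ! Suc i)" using spec[OF L, of i] by (simp add: nth_append)
  next
    assume L: ?L
    show ?R2 using spec[OF L, of "length p - 1"] False by (simp add: nth_append last_conv_nth)
  next
    fix i assume R: "?R1 \<and> ?R2" and i: "Suc i < length (p @ [e])"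
    show "tgt ((p @ [e]) ! i) = src ((p @ [e]) ! Suc i)"
    proof (cases "Suc i < length p")
      case True then show ?thesis using R by (simp add: nth_append)
    next
      case ge: False
      then have "i = length p - 1" "Suc i = length p" using i by auto
      then show ?thesis using R False by (simp add: nth_append last_conv_nth)
    qed
  qed
  then show ?thesis using False by (auto simp: graph_paths_def path_end_def)
qed

lemma finite_paths_to: "finite E \<Longrightarrow> finite (paths_to E src tgt v0 n w)"
  by (rule finite_subset[OF _ finite_lists_length_eq[of E n]]) (auto simp: paths_to_def graph_paths_def)

text \<open>Splitting off the last arc is a bijection, because an arc can be appended exactly when
  it leaves the end vertex. This is the source of the recursion over incoming arcs.\<close>

lemma sum_paths_to_Suc:
  fixes f :: "nat list \<Rightarrow> real"
  assumes "finite E"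
  shows "(\<Sum>p\<in>paths_to E src tgt v0 (Suc n) w. f p)
    = (\<Sum>e | e \<in> E \<and> tgt e = w. \<Sum>p\<in>paths_to E src tgt v0 n (src e). f (p @ [e]))"
proof -
  let ?I = "SIGMA e : {e. e \<in> E \<and> tgt e = w}. paths_to E src tgt v0 n (src e)"
  have "paths_to E src tgt v0 (Suc n) w = (\<lambda>(e, p). p @ [e]) ` ?I"
  proof (intro set_eqI iffI)
    fix p assume p: "p \<in> paths_to E src tgt v0 (Suc n) w"
    then have "p \<noteq> []" by (auto simp: paths_to_def)
    then obtain q e where q: "p = q @ [e]" by (metis rev_exhaust)
    then have "(e, q) \<in> ?I" using p by (auto simp: paths_to_def graph_paths_snoc path_end_def)
    then show "p \<in> (\<lambda>(e, p). p @ [e]) ` ?I" using q by (auto intro!: image_eqI[of _ _ "(e, q)"])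
  next
    fix p assume "p \<in> (\<lambda>(e, p). p @ [e]) ` ?I"
    then show "p \<in> paths_to E src tgt v0 (Suc n) w"
      by (auto simp: paths_to_def graph_paths_snoc) (auto simp: path_end_def)
  qed
  then have "(\<Sum>p\<in>paths_to E src tgt v0 (Suc n) w. f p) = (\<Sum>(e, p)\<in>?I. f (p @ [e]))"
    by (simp only:) (subst sum.reindex, auto simp: inj_on_def split_beta)
  also have "\<dots> = (\<Sum>e | e \<in> E \<and> tgt e = w. \<Sum>p\<in>paths_to E src tgt v0 n (src e). f (p @ [e]))"
    by (rule sum.Sigma[symmetric]) (use assms finite_paths_to[OF assms] in auto)
  finally show ?thesis .
qed

locale markov_action =
  fixes Gen :: "'g::monoid_mult set" and M :: "'x measure" and T :: "'g \<Rightarrow> 'x \<Rightarrow> 'x"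
  assumes markov: "markov Gen" and prob: "prob_space M"
    and meas: "\<And>g. T g \<in> M \<rightarrow>\<^sub>M M" and pres: "\<And>g. distr M M (T g) = M"
    and T_mult: "\<And>g h x. x \<in> space M \<Longrightarrow> T (g * h) x = T g (T h x)"
begin

text \<open>The coding is bijective and preserves length, so the sphere of radius \<open>n\<close>
  corresponds to the paths of length \<open>n\<close> from \<open>v0\<close>, which are then sorted
  by end vertex.\<close>

lemma sphere_paths:
  obtains V E src tgt lab v0 where "edge_graph V E src tgt"
    "\<And>n f. (\<Sum>g\<in>sphere Gen n. f g) = (\<Sum>w\<in>V. \<Sum>p\<in>paths_to E src tgt v0 n w. f (prod_list (map lab p)) :: real)"
    "\<And>n. finite (sphere Gen n)"
proof -
  obtain V E :: "nat set" and src tgt :: "nat \<Rightarrow> nat" and lab :: "nat \<Rightarrow> 'g" and v0 where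
    H: "finite V \<and> finite E \<and> v0 \<in> V \<and> src ` E \<subseteq> V \<and> tgt ` E \<subseteq> V \<and> lab ` E \<subseteq> Gen \<and>
      bij_betw (\<lambda>p. prod_list (map lab p)) (graph_paths E src tgt v0) UNIV \<and>
      (\<forall>p\<in>graph_paths E src tgt v0. word_length Gen (prod_list (map lab p)) = length p)"
    using markov unfolding markov_def by (elim exE) (rule that)
  then have G: "finite V" "finite E" "v0 \<in> V" "src ` E \<subseteq> V" "tgt ` E \<subseteq> V"
    and bij: "bij_betw (\<lambda>p. prod_list (map lab p)) (graph_paths E src tgt v0) UNIV"
    and len: "\<And>p. p \<in> graph_paths E src tgt v0 \<Longrightarrow> word_length Gen (prod_list (map lab p)) = length p"
    by simp_all
  have graph: "edge_graph V E src tgt" by unfold_locales (use G in auto)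
  let ?\<xi> = "\<lambda>p. prod_list (map lab p)"
  define P where "P n = {p \<in> graph_paths E src tgt v0. length p = n}" for n
  have sph: "sphere Gen n = ?\<xi> ` P n" for n
  proof (intro set_eqI iffI)
    fix g assume g: "g \<in> sphere Gen n"
    obtain p where p: "p \<in> graph_paths E src tgt v0" "g = ?\<xi> p" using bij unfolding bij_betw_def by (metis UNIV_I image_iff)
    then show "g \<in> ?\<xi> ` P n" using g len[OF p(1)] by (auto simp: sphere_def P_def)
  next
    fix g assume "g \<in> ?\<xi> ` P n"
    then show "g \<in> sphere Gen n" using len by (auto simp: sphere_def P_def)
  qed
  have inj: "inj_on ?\<xi> (P n)" for n
    using bij unfolding bij_betw_def by (auto intro: inj_on_subset simp: P_def)
  have endV: "path_end tgt v0 p \<in> V" if "p \<in> graph_paths E src tgt v0" for p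
  proof (cases "p = []")
    case False
    then have "last p \<in> E" using that last_in_set[of p] by (auto simp: graph_paths_def)
    then show ?thesis using G False by (auto simp: path_end_def)
  qed (use G in \<open>simp add: path_end_def\<close>)
  have PU: "P n = (\<Union>w\<in>V. paths_to E src tgt v0 n w)" for n
    using endV by (auto simp: P_def paths_to_def)
  have fin: "finite (P n)" for n unfolding PU using G(1) finite_paths_to[OF G(2)] by auto
  show ?thesis
  proof (rule that[OF graph])
    show "(\<Sum>g\<in>sphere Gen n. f g) = (\<Sum>w\<in>V. \<Sum>p\<in>paths_to E src tgt v0 n w. f (?\<xi> p))" for n and f :: "'g \<Rightarrow> real"
    proof -
      have "(\<Sum>g\<in>sphere Gen n. f g) = (\<Sum>p\<in>P n. f (?\<xi> p))" unfolding sph by (simp add: sum.reindex[OF inj])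
      also have "\<dots> = (\<Sum>w\<in>V. \<Sum>p\<in>paths_to E src tgt v0 n w. f (?\<xi> p))" unfolding PU
        by (rule sum.UNION_disjoint) (use G(1) finite_paths_to[OF G(2)] in \<open>auto simp: paths_to_def\<close>)
      finally show ?thesis .
    qed
    show "finite (sphere Gen n)" for n unfolding sph using fin by simp
  qed
qed

lemma finite_sphere: "finite (sphere Gen n)"
  by (rule sphere_paths) blast

lemma cesaro_sph_eq:
  "cesaro_sph Gen T \<phi> N x = cesaro_mean (\<lambda>n. (\<Sum>g\<in>sphere Gen n. \<phi> (T g x)) / real (card (sphere Gen n))) N"
  unfolding cesaro_sph_def cesaro_mean_def by (auto intro!: sum.cong simp: sum_divide_distrib)

lemma bounded_convergent:
  assumes \<phi>: "\<phi> \<in> borel_measurable M" and K: "\<And>x. x \<in> space M \<Longrightarrow> \<bar>\<phi> x\<bar> \<le> K"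
  shows "AE x in M. convergent (\<lambda>N. cesaro_sph Gen T \<phi> N x)"
proof -
  obtain V E src tgt lab v0 where graph: "edge_graph V E src tgt"
    and sph: "\<And>n f. (\<Sum>g\<in>sphere Gen n. f g) = (\<Sum>w\<in>V. \<Sum>p\<in>paths_to E src tgt v0 n w. f (prod_list (map lab p)) :: real)"
    by (rule sphere_paths) blast
  interpret G: edge_graph V E src tgt by (rule graph)
  define b where "b n w = (\<Sum>p\<in>paths_to E src tgt v0 n w. 1 :: real)" for n w
  define F where "F n w x = (\<Sum>p\<in>paths_to E src tgt v0 n w. \<phi> (T (prod_list (map lab p)) x))" for n w x
  obtain x0 where "x0 \<in> space M" using prob_space.not_empty[OF prob] by blast
  then have K0: "0 \<le> K" using K abs_ge_zero order_trans by blast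
  have "AE x in M. convergent (cesaro_mean (\<lambda>n. (\<Sum>w\<in>V. F n w x) / (\<Sum>w\<in>V. b n w)))"
  proof (rule G.averages_convergent[OF prob, where S="\<lambda>e. T (lab e)" and K=K])
    show "0 \<le> b n w" for n w by (simp add: b_def)
    show "b (Suc n) w = (\<Sum>e | e \<in> E \<and> tgt e = w. b n (src e))" for n w
      unfolding b_def by (rule sum_paths_to_Suc[OF G.finE])
    show "F n w \<in> borel_measurable M" for n w
      unfolding F_def[abs_def] by (intro borel_measurable_sum measurable_compose[OF meas \<phi>])
    fix n w x assume x: "x \<in> space M"
    have "\<bar>F n w x\<bar> \<le> (\<Sum>p\<in>paths_to E src tgt v0 n w. K)"
      unfolding F_def by (rule order_trans[OF sum_abs sum_mono]) (rule K[OF measurable_space[OF meas x]])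
    then show "\<bar>F n w x\<bar> \<le> K * b n w" by (simp add: b_def mult.commute)
    \<comment> \<open>Appending \<open>e\<close> multiplies the group element on the right by
      \<open>lab e\<close>, so \<open>T (lab e)\<close> is applied to \<open>x\<close>
      first.\<close>
    show "F (Suc n) w x = (\<Sum>e | e \<in> E \<and> tgt e = w. F n (src e) (T (lab e) x))"
      unfolding F_def sum_paths_to_Suc[OF G.finE] by (simp add: T_mult[OF x])
  qed (use meas pres K0 in auto)
  moreover have "real (card (sphere Gen n)) = (\<Sum>w\<in>V. b n w)" for n
    using sph[of "\<lambda>_. 1" n] by (simp add: b_def)
  moreover have "(\<Sum>g\<in>sphere Gen n. \<phi> (T g x)) = (\<Sum>w\<in>V. F n w x)" for n x
    using sph[of "\<lambda>g. \<phi> (T g x)" n] by (simp add: F_def)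
  ultimately show ?thesis by (simp add: cesaro_sph_eq[abs_def])
qed

text \<open>Truncation at \<open>\<bar>c\<bar>\<close> yields a function bounded everywhere. It
  agrees with \<open>\<phi>\<close> along all \<open>T g\<close> outside one null set, since the
  elements \<open>g\<close> fill countably many finite spheres.\<close>

lemma Linf_convergent:
  assumes "in_Linf M \<phi>"
  shows "AE x in M. convergent (\<lambda>N. cesaro_sph Gen T \<phi> N x)"
proof -
  obtain c where \<phi> [measurable]: "\<phi> \<in> borel_measurable M" and c: "AE x in M. \<bar>\<phi> x\<bar> \<le> c"
    using assms by (auto simp: in_Linf_def)
  define \<psi> where "\<psi> x = max (- \<bar>c\<bar>) (min \<bar>c\<bar> (\<phi> x))" for x
  have "\<psi> \<in> borel_measurable M" unfolding \<psi>_def[abs_def] by measurable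
  moreover have "\<bar>\<psi> x\<bar> \<le> \<bar>c\<bar>" for x by (auto simp: \<psi>_def)
  ultimately have conv: "AE x in M. convergent (\<lambda>N. cesaro_sph Gen T \<psi> N x)" by (intro bounded_convergent)
  have eq: "AE x in M. \<phi> x = \<psi> x" using c by eventually_elim (auto simp: \<psi>_def)
  have "AE x in M. \<phi> (T g x) = \<psi> (T g x)" for g
  proof -
    have "AE x in distr M M (T g). \<phi> x = \<psi> x" by (subst pres) (rule eq)
    then show ?thesis by (rule AE_distrD[OF meas])
  qed
  then have "AE x in M. \<forall>g\<in>sphere Gen n. \<phi> (T g x) = \<psi> (T g x)" for n
    using finite_sphere by (intro AE_finite_allI) auto
  then have "AE x in M. \<forall>n. \<forall>g\<in>sphere Gen n. \<phi> (T g x) = \<psi> (T g x)" by (simp add: AE_all_countable)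
  with conv show ?thesis
  proof eventually_elim
    case (elim x)
    have "(\<Sum>g\<in>sphere Gen n. \<phi> (T g x)) = (\<Sum>g\<in>sphere Gen n. \<psi> (T g x))" for n
      using elim(2) by (intro sum.cong) auto
    then have "cesaro_sph Gen T \<phi> N x = cesaro_sph Gen T \<psi> N x" for N by (simp add: cesaro_sph_eq)
    then show ?case using elim(1) by simp
  qed
qed

text \<open>Pairs of a radius and an element turn the double average into one weighted family. An
  empty sphere has no pairs, which matches the convention that its average is 0.\<close>

lemma weighted_averages:
  "weighted_averages M (\<lambda>N. SIGMA n : {..<N}. sphere Gen n)
     (\<lambda>N i. 1 / (real N * real (card (sphere Gen (fst i))))) (\<lambda>i. T (snd i)) (\<lambda>N f. cesaro_sph Gen T f N)"
proof (intro weighted_averages.intro weighted_averages_axioms.intro prob)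
  have S: "(\<Sum>i\<in>(SIGMA n : {..<N}. sphere Gen n). 1 / (real N * real (card (sphere Gen (fst i)))) * f (snd i))
     = (1 / real N) * (\<Sum>n<N. (1 / real (card (sphere Gen n))) * (\<Sum>g\<in>sphere Gen n. f g))" for N and f :: "'g \<Rightarrow> real"
    by (subst sum.Sigma[symmetric, of _ _ "\<lambda>n g. 1 / (real N * real (card (sphere Gen n))) * f g", unfolded split_beta])
      (auto simp: finite_sphere sum_distrib_left)
  show "cesaro_sph Gen T f N x = (\<Sum>i\<in>(SIGMA n : {..<N}. sphere Gen n). 1 / (real N * real (card (sphere Gen (fst i)))) * f (T (snd i) x))" for N f x
    unfolding S[of N "\<lambda>g. f (T g x)"] cesaro_sph_def by (auto intro!: sum.cong)
  show "(\<Sum>i\<in>(SIGMA n : {..<N}. sphere Gen n). 1 / (real N * real (card (sphere Gen (fst i))))) \<le> 1" for N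
  proof -
    have "(\<Sum>n<N. (1 / real (card (sphere Gen n))) * (\<Sum>g\<in>sphere Gen n. 1)) \<le> (\<Sum>n<N. 1 :: real)"
      by (rule sum_mono) (auto simp: divide_le_eq)
    then have "(1 / real N) * (\<Sum>n<N. (1 / real (card (sphere Gen n))) * (\<Sum>g\<in>sphere Gen n. 1)) \<le> (1 / real N) * real N"
      by (intro mult_left_mono) auto
    also have "\<dots> \<le> 1" by simp
    finally show ?thesis using S[of N "\<lambda>_. 1"] by simp
  qed
  show "finite (SIGMA n : {..<N}. sphere Gen n)" for N using finite_sphere by auto
  show "AE x in M. convergent (\<lambda>N. cesaro_sph Gen T f N x)"
    if "f \<in> borel_measurable M" "\<And>x. x \<in> space M \<Longrightarrow> \<bar>f x\<bar> \<le> K" for f K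
    by (rule bounded_convergent[OF that])
qed (use meas pres in auto)

end

theorem theorem1:
  fixes Gen :: "'g::monoid_mult set" and M :: "'x measure" and T :: "'g \<Rightarrow> 'x \<Rightarrow> 'x"
  assumes "finite Gen" and "generates Gen" and "markov Gen"
    and "prob_space M"
    and "\<And>g. T g \<in> M \<rightarrow>\<^sub>M M"
    and "\<And>g. distr M M (T g) = M"
    and "\<And>x. x \<in> space M \<Longrightarrow> T 1 x = x"
    and "\<And>g h x. x \<in> space M \<Longrightarrow> T (g * h) x = T g (T h x)"
  shows "(\<forall>p \<phi>. 1 \<le> p \<longrightarrow> in_Lp M p \<phi> \<longrightarrow>
           (\<exists>\<psi>. in_Lp M p \<psi> \<and>
              (\<lambda>N. \<integral>x. \<bar>cesaro_sph Gen T \<phi> N x - \<psi> x\<bar> powr p \<partial>M) \<longlonglongrightarrow> 0))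
       \<and> (\<forall>\<phi>. in_Linf M \<phi> \<longrightarrow> (AE x in M. convergent (\<lambda>N. cesaro_sph Gen T \<phi> N x)))"
proof -
  interpret A: markov_action Gen M T by (rule markov_action.intro) (fact assms)+
  show ?thesis
    using weighted_averages.Lp_convergence[OF A.weighted_averages] A.Linf_convergent by blast
qed

end
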